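(* Let $\Omega\subset\mathbb{R}^d$ be a bounded $C^1$-domain. For $\varepsilon\in(0,1)$ let $$\alpha_\varepsilon(h)=\varepsilon^{-1}\,\mathbf{1}_{B_\varepsilon(0)}(h),\qquad \mu_\varepsilon(h)=\frac{d(d+2)}{\mathcal{H}^{d-1}(\mathbb{S}^{d-1})}\,\varepsilon^{-d-1}\,\mathbf{1}_{B_\varepsilon(0)}(h).$$ Let $F\in C^1(\overline\Omega;\mathbb{R}^d)$ and let $(f_\varepsilon)_{\varepsilon\in(0,1)}$ be the corresponding family of nonlocal vector fields generated by $F$ with respect to $(\alpha_\varepsilon)_\varepsilon$. Then $$\int_{\Omega^c}\mathcal{N}_\varepsilon f_\varepsilon(x)\,\mathrm{d}x\;\longrightarrow\;\int_{\partial\Omega}F(x)\cdot\vec{n}(x)\,\mathrm{d}\sigma_{d-1}(x)\qquad\text{as }\varepsilon\to0^+ .$$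
   Context: A domain is an open bounded connected subset of $\mathbb{R}^d$. $\vec{n}(x)$ is the outward unit normal vector at $x\in\partial\Omega$, $\sigma_{d-1}$ is the $(d-1)$-dimensional surface measure, $\mathcal{H}^{d-1}$ is the $(d-1)$-dimensional Hausdorff measure, $\mathbb{S}^{d-1}$ the unit sphere of $\mathbb{R}^d$, $B_\varepsilon(0)$ the ball of radius $\varepsilon$ centred at $0$, and $\Omega^c=\mathbb{R}^d\setminus\Omega$. The vector field $F$ is assumed to be extended to a compactly supported $C^1$ vector field on $\mathbb{R}^d$, again denoted $F$. The nonlocal vector field generated by $F$ with respect to $\alpha_\varepsilon$ is the antisymmetric function $$f_\varepsilon(x,y)=\alpha_\varepsilon(x-y)\int_0^1F\big(x+t(y-x)\big)\cdot(y-x)\,\mathrm{d}t\quad(x\neq y),\qquad f_\varepsilon(x,x)=0 .$$ The nonlocal normal operator is $$\mathcal{N}_\varepsilon f(x)=-2\int_\Omega f(x,y)\,\mu_\varepsilon(y-x)\,\mathrm{d}y,\qquad x\in\Omega^c .$$ *)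

theory Defs
  imports "HOL-Analysis.Analysis"
begin

subsection \<open>Continuously differentiable maps and domains\<close>

definition C1 :: "('a::euclidean_space \<Rightarrow> 'b::euclidean_space) \<Rightarrow> bool" where
  "C1 f \<longleftrightarrow> (\<exists>f' :: 'a \<Rightarrow> 'a \<Rightarrow>\<^sub>L 'b.
     continuous_on UNIV f' \<and> (\<forall>x. (f has_derivative blinfun_apply (f' x)) (at x)))"

text \<open>The space $C^1(\overline\Omega)$ for open $\Omega$: the map and its derivative on $\Omega$
  extend continuously to the closure.\<close>

definition C1_closure :: "'a::euclidean_space set \<Rightarrow> ('a \<Rightarrow> 'b::euclidean_space) \<Rightarrow> bool" where
  "C1_closure \<Omega> f \<longleftrightarrow> continuous_on (closure \<Omega>) f \<and>
     (\<exists>f' :: 'a \<Rightarrow> 'a \<Rightarrow>\<^sub>L 'b. continuous_on (closure \<Omega>) f' \<and>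
        (\<forall>x\<in>\<Omega>. (f has_derivative blinfun_apply (f' x)) (at x)))"

definition compactly_supported :: "('a::euclidean_space \<Rightarrow> 'b::euclidean_space) \<Rightarrow> bool" where
  "compactly_supported f \<longleftrightarrow> compact (closure {x. f x \<noteq> 0})"

definition domain :: "'a::euclidean_space set \<Rightarrow> bool" where
  "domain \<Omega> \<longleftrightarrow> open \<Omega> \<and> bounded \<Omega> \<and> connected \<Omega>"

text \<open>Near each boundary point, after a rotation of the coordinate axes, \<open>\<Omega>\<close> is the region strictly
  above the graph of a $C^1$ function of $d-1$ variables. The unit vector \<open>e\<close> is the rotated last
  axis; the function is evaluated only at the projection \<open>x - (x \<bullet> e) *\<^sub>R e\<close> of \<open>x\<close> onto the
  hyperplane orthogonal to \<open>e\<close>, so it is a function on that copy of $\mathbb{R}^{d-1}$ (and a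
  constant if $d = 1$).\<close>

definition C1_domain :: "'a::euclidean_space set \<Rightarrow> bool" where
  "C1_domain \<Omega> \<longleftrightarrow> domain \<Omega> \<and>
     (\<forall>x0\<in>frontier \<Omega>. \<exists>r>0. \<exists>e. \<exists>\<gamma> :: 'a \<Rightarrow> real. norm e = 1 \<and> C1 \<gamma> \<and>
        \<Omega> \<inter> ball x0 r = {x \<in> ball x0 r. x \<bullet> e > \<gamma> (x - (x \<bullet> e) *\<^sub>R e)})"


subsection \<open>Outward unit normal\<close>

text \<open>Tangent vectors are the velocities at \<open>x\<close> of curves running in \<open>S\<close>.\<close>

definition tangent_vector :: "'a::euclidean_space set \<Rightarrow> 'a \<Rightarrow> 'a \<Rightarrow> bool" where
  "tangent_vector S x v \<longleftrightarrow> (\<exists>c :: real \<Rightarrow> 'a. c 0 = x \<and>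
     (\<forall>\<^sub>F t in at 0. c t \<in> S) \<and> (c has_vector_derivative v) (at 0))"

definition is_outward_unit_normal :: "'a::euclidean_space set \<Rightarrow> 'a \<Rightarrow> 'a \<Rightarrow> bool" where
  "is_outward_unit_normal \<Omega> x \<nu> \<longleftrightarrow> norm \<nu> = 1 \<and>
     (\<forall>v. tangent_vector (frontier \<Omega>) x v \<longrightarrow> \<nu> \<bullet> v = 0) \<and>
     (\<forall>\<^sub>F t in at_right 0. x + t *\<^sub>R \<nu> \<notin> closure \<Omega> \<and> x - t *\<^sub>R \<nu> \<in> \<Omega>)"

text \<open>Determined only for \<open>x\<close> on the boundary of a $C^1$-domain.\<close>

definition outward_unit_normal :: "'a::euclidean_space set \<Rightarrow> 'a \<Rightarrow> 'a" where
  "outward_unit_normal \<Omega> x = (THE \<nu>. is_outward_unit_normal \<Omega> x \<nu>)"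


subsection \<open>Hausdorff measure and surface measure\<close>

text \<open>The normalisation \<open>unit_ball_vol k * (diam / 2) ^ k\<close> makes the $k$-dimensional Hausdorff measure
  on $\mathbb{R}^k$ the Lebesgue measure. The empty set is treated separately because of
  \<open>0 ^ 0 = 1\<close>; for \<open>k = 0\<close> one obtains the counting measure.\<close>

definition hausdorff_weight :: "nat \<Rightarrow> 'a::metric_space set \<Rightarrow> ennreal" where
  "hausdorff_weight k C =
     (if C = {} then 0 else ennreal (unit_ball_vol (real k) * (diameter C / 2) ^ k))"

definition hausdorff_pre :: "nat \<Rightarrow> real \<Rightarrow> 'a::metric_space set \<Rightarrow> ennreal" where
  "hausdorff_pre k \<delta> A =
     (INF C \<in> {C :: nat \<Rightarrow> 'a set. A \<subseteq> (\<Union>i. C i) \<and> (\<forall>i. bounded (C i) \<and> diameter (C i) \<le> \<delta>)}.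
        \<Sum>i. hausdorff_weight k (C i))"

definition hausdorff_outer :: "nat \<Rightarrow> 'a::metric_space set \<Rightarrow> ennreal" where
  "hausdorff_outer k A = (SUP \<delta> \<in> {0<..}. hausdorff_pre k \<delta> A)"

definition hausdorff_measure :: "nat \<Rightarrow> 'a::metric_space measure" where
  "hausdorff_measure k = measure_of UNIV (sets borel) (hausdorff_outer k)"

definition surface_measure :: "'a::euclidean_space set \<Rightarrow> 'a measure" where
  "surface_measure \<Omega> = restrict_space (hausdorff_measure (DIM('a) - 1)) (frontier \<Omega>)"


subsection \<open>Nonlocal vector fields and the nonlocal normal operator\<close>

definition nonlocal_field ::
    "('a::euclidean_space \<Rightarrow> real) \<Rightarrow> ('a \<Rightarrow> 'a) \<Rightarrow> 'a \<Rightarrow> 'a \<Rightarrow> real" where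
  "nonlocal_field \<alpha> F x y =
     (if x = y then 0
      else \<alpha> (x - y) * (LINT t:{0..1}|lborel. F (x + t *\<^sub>R (y - x)) \<bullet> (y - x)))"

definition nonlocal_normal ::
    "'a::euclidean_space set \<Rightarrow> ('a \<Rightarrow> real) \<Rightarrow> ('a \<Rightarrow> 'a \<Rightarrow> real) \<Rightarrow> 'a \<Rightarrow> real" where
  "nonlocal_normal \<Omega> \<mu> f x = - 2 * (LINT y:\<Omega>|lborel. f x y * \<mu> (y - x))"

definition alpha_kernel :: "real \<Rightarrow> 'a::euclidean_space \<Rightarrow> real" where
  "alpha_kernel \<epsilon> h = (1 / \<epsilon>) * indicator (ball 0 \<epsilon>) h"

definition mu_kernel :: "real \<Rightarrow> 'a::euclidean_space \<Rightarrow> real" where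
  "mu_kernel \<epsilon> h =
     real (DIM('a) * (DIM('a) + 2))
       / measure (hausdorff_measure (DIM('a) - 1)) (sphere (0::'a) 1)
     * (1 / \<epsilon> ^ (DIM('a) + 1)) * indicator (ball 0 \<epsilon>) h"

end

theory Submission
  imports Defs
begin

text \<open>Both limits equal the volume integral of the divergence of \<open>F\<close> over \<open>\<Omega>\<close>. On the
  nonlocal side, antisymmetry of $f_\varepsilon$ lets the outer integral run over the whole space, and
  after the substitution $x = y + \varepsilon z$ a Taylor expansion of \<open>F\<close> at \<open>y\<close> leaves the second
  moments of the unit ball, which turn the derivative of \<open>F\<close> into its trace. The
  normalisation of $\mu_\varepsilon$ is right because $\mathcal{H}^{d-1}(\mathbb{S}^{d-1})$ is $d$ times
  the volume of the unit ball; this, and the second moments, are instances of the divergence theorem.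

  The divergence theorem is proved locally with a smoothed indicator function of the region above a graph.
  The boundary integral then appears in graph coordinates, and the area formula identifies it
  with the integral against Hausdorff measure. The area formula compares a small piece of the
  graph with its vertical projection to a tangent hyperplane, an almost isometric map. On hyperplanes
  Hausdorff measure is Lebesgue measure by the isodiametric inequality (Steiner symmetrisation) and the
  Vitali covering theorem.\<close>

subsection \<open>Hausdorff measure\<close>

text \<open>The (d-1)-dimensional quantities never receive coordinates of their own. The size of a
  subset of a hyperplane is the d-dimensional volume of the cylinder of height 1 over it. The
  Jacobian in the area formula thereby becomes the determinant of a linear map of the whole space,
  and this map is a product of two rank-one updates.

  The expansion is made at the endpoint \<open>y\<close> in \<Omega> because the derivative then
  does not depend on the inner variable, and what remains is an integral over \<Omega>. The segment
  runs from \<open>y\<close> + \<epsilon> z to \<open>y\<close>, so its direction is -\<epsilon> z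
  and the derivative enters with the weight 1 - t, whose mean is 1/2; the resulting -1/2 cancels the
  -2 of the normal operator. With w the volume of the unit ball, the constant d(d+2)/(d w) of
  \<open>mu_kernel\<close> cancels the second moment w/(d+2).

  The remainder has to be small against \<epsilon>^(d+2) uniformly in \<open>y\<close>, which rests
  on uniform continuity of the derivative on a large ball.\<close>

lemma hausdorff_weight_empty [simp]: "hausdorff_weight k {} = 0"
  by (simp add: hausdorff_weight_def)

lemma hausdorff_pre_le:
  assumes "A \<subseteq> (\<Union>i. C i)" "\<And>i. bounded (C i)" "\<And>i. diameter (C i) \<le> \<delta>"
  shows "hausdorff_pre k \<delta> A \<le> (\<Sum>i. hausdorff_weight k (C i))"
  unfolding hausdorff_pre_def by (rule INF_lower) (use assms in auto)

lemma hausdorff_pre_mono: "A \<subseteq> B \<Longrightarrow> hausdorff_pre k \<delta> A \<le> hausdorff_pre k \<delta> B"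
  unfolding hausdorff_pre_def by (rule INF_superset_mono) auto

lemma hausdorff_pre_antimono: "\<delta> \<le> \<delta>' \<Longrightarrow> hausdorff_pre k \<delta>' A \<le> hausdorff_pre k \<delta> A"
  unfolding hausdorff_pre_def by (rule INF_superset_mono) (auto intro: order_trans)

lemma hausdorff_pre_empty: "0 \<le> \<delta> \<Longrightarrow> hausdorff_pre k \<delta> {} = 0"
  using hausdorff_pre_le[of "{}" "\<lambda>_. {}" \<delta> k] by simp

lemma hausdorff_pre_lessD:
  assumes "hausdorff_pre k \<delta> A < c"
  obtains C where "A \<subseteq> (\<Union>i. C i)" "\<And>i. bounded (C i)" "\<And>i. diameter (C i) \<le> \<delta>"
    "(\<Sum>i. hausdorff_weight k (C i)) < c"
  using assms unfolding hausdorff_pre_def INF_less_iff by blast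

text \<open>Covers of the \<open>A n\<close> that are optimal up to e/2^(n+1) are merged into one
  sequence through \<open>prod_decode\<close>; the excesses add up to e.\<close>

lemma hausdorff_pre_UN:
  fixes A :: "nat \<Rightarrow> 'a::metric_space set"
  shows "hausdorff_pre k \<delta> (\<Union>i. A i) \<le> (\<Sum>i. hausdorff_pre k \<delta> (A i))"
proof (rule ennreal_le_epsilon)
  let ?O = "hausdorff_pre k \<delta>" and ?f = "hausdorff_weight k :: 'a set \<Rightarrow> ennreal"
  fix e :: real assume "0 < e" "(\<Sum>n. ?O (A n)) < top"
  then have "?O (A n) < ?O (A n) + e * (1/2)^Suc n" for n
    by (auto simp add: less_top dest!: ennreal_suminf_lessD)
  then have "\<exists>C. A n \<subseteq> (\<Union>i. C i) \<and> (\<forall>i. bounded (C i) \<and> diameter (C i) \<le> \<delta>)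
      \<and> (\<Sum>i. ?f (C i)) \<le> ?O (A n) + e * (1/2)^(Suc n)" for n
    by (metis hausdorff_pre_lessD less_imp_le)
  then obtain B where B: "\<And>n. A n \<subseteq> (\<Union>i. B n i)" "\<And>n i. bounded (B n i)"
      "\<And>n i. diameter (B n i) \<le> \<delta>"
      "\<And>n. (\<Sum>i. ?f (B n i)) \<le> ?O (A n) + e * (1/2)^(Suc n)"
    by metis
  define C where "C = case_prod B o prod_decode"
  have A_C: "(\<Union>i. A i) \<subseteq> (\<Union>i. C i)"
    using B(1) by (auto simp add: C_def subset_eq) (metis prod.case prod_encode_inverse)
  have "?O (\<Union>i. A i) \<le> (\<Sum>i. ?f (C i))"
    using A_C by (rule hausdorff_pre_le) (use B in \<open>auto simp: C_def split: prod.split\<close>)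
  also have "\<dots> = (\<Sum>n. \<Sum>i. ?f (B n i))"
    unfolding C_def comp_def by (intro suminf_ennreal_2dimen) auto
  also have "\<dots> \<le> (\<Sum>n. ?O (A n) + e * (1/2) ^ Suc n)"
    by (intro suminf_le suminf_nonneg allI B) auto
  also have "... = (\<Sum>n. ?O (A n)) + (\<Sum>n. ennreal e * ennreal ((1/2) ^ Suc n))"
    using \<open>0 < e\<close> by (subst suminf_add[symmetric])
                     (auto simp del: ennreal_suminf_cmult simp add: ennreal_mult[symmetric])
  also have "\<dots> = (\<Sum>n. ?O (A n)) + e"
    unfolding ennreal_suminf_cmult
    by (subst suminf_ennreal_eq[OF zero_le_power power_half_series]) auto
  finally show "?O (\<Union>i. A i) \<le> (\<Sum>n. ?O (A n)) + e" .
qed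

lemma hausdorff_pre_le_outer: "0 < \<delta> \<Longrightarrow> hausdorff_pre k \<delta> A \<le> hausdorff_outer k A"
  unfolding hausdorff_outer_def by (rule SUP_upper) auto

lemma hausdorff_outer_least:
  assumes "\<And>\<delta>. 0 < \<delta> \<Longrightarrow> hausdorff_pre k \<delta> A \<le> c"
  shows "hausdorff_outer k A \<le> c"
  unfolding hausdorff_outer_def by (rule SUP_least) (use assms in auto)

lemma hausdorff_outer_mono: "A \<subseteq> B \<Longrightarrow> hausdorff_outer k A \<le> hausdorff_outer k B"
  by (meson hausdorff_outer_least hausdorff_pre_le_outer hausdorff_pre_mono order_trans)

lemma hausdorff_outer_empty [simp]: "hausdorff_outer k {} = 0"
  by (metis hausdorff_outer_least hausdorff_pre_empty le_zero_eq less_eq_real_def order_refl)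

lemma hausdorff_outer_UN:
  "hausdorff_outer k (\<Union>i::nat. A i) \<le> (\<Sum>i. hausdorff_outer k (A i))"
  by (rule hausdorff_outer_least)
     (rule order_trans[OF hausdorff_pre_UN suminf_le], auto intro: hausdorff_pre_le_outer)

lemma outer_measure_space_hausdorff: "outer_measure_space (Pow UNIV) (hausdorff_outer k)"
  by (auto simp: outer_measure_space_def positive_def increasing_def countably_subadditive_def
      intro: hausdorff_outer_mono hausdorff_outer_UN)

lemma hausdorff_pre_Un:
  assumes "0 \<le> \<delta>"
  shows "hausdorff_pre k \<delta> (A \<union> B) \<le> hausdorff_pre k \<delta> A + hausdorff_pre k \<delta> B"
proof -
  have "A \<union> B = (\<Union>i::nat. if i = 0 then A else if i = 1 then B else {})"
    by (auto split: if_splits)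
  then have "hausdorff_pre k \<delta> (A \<union> B)
      \<le> (\<Sum>i::nat. hausdorff_pre k \<delta> (if i = 0 then A else if i = 1 then B else {}))"
    by (simp only: hausdorff_pre_UN)
  also have "\<dots> = hausdorff_pre k \<delta> A + hausdorff_pre k \<delta> B"
    by (subst suminf_finite[of "{0,1}"]) (auto simp: hausdorff_pre_empty assms)
  finally show ?thesis .
qed

lemma hausdorff_outer_Un: "hausdorff_outer k (A \<union> B) \<le> hausdorff_outer k A + hausdorff_outer k B"
proof (rule hausdorff_outer_least)
  fix \<delta> :: real assume "0 < \<delta>"
  then show "hausdorff_pre k \<delta> (A \<union> B) \<le> hausdorff_outer k A + hausdorff_outer k B"
    by (intro order_trans[OF hausdorff_pre_Un] add_mono hausdorff_pre_le_outer) auto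
qed

text \<open>A set of diameter at most \<delta> cannot meet both \<open>A\<close> and
  \<open>B\<close>, so every cover of the union splits into a cover of \<open>A\<close> and one of
  \<open>B\<close>.\<close>

lemma hausdorff_pre_separated:
  assumes sep: "\<And>x y. x \<in> A \<Longrightarrow> y \<in> B \<Longrightarrow> \<delta> < dist x y"
  shows "hausdorff_pre k \<delta> A + hausdorff_pre k \<delta> B \<le> hausdorff_pre k \<delta> (A \<union> B)"
  unfolding hausdorff_pre_def[of k \<delta> "A \<union> B"]
proof (safe intro!: INF_greatest)
  fix C :: "nat \<Rightarrow> 'a set"
  assume AB: "A \<union> B \<subseteq> (\<Union>i. C i)" and C: "\<forall>i. bounded (C i) \<and> diameter (C i) \<le> \<delta>"
  define CA where "CA X i = (if C i \<inter> X = {} then {} else C i)" for X i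
  \<comment> \<open>Discarded sets are replaced by the empty set, of diameter 0, which is admissible
    only for nonnegative \<delta>; the cover itself supplies this.\<close>
  have "0 \<le> diameter (C 0)"
    using C by (intro diameter_ge_0) auto
  then have d: "0 \<le> \<delta>" using C by (meson order_trans)
  have le: "hausdorff_pre k \<delta> X \<le> (\<Sum>i. hausdorff_weight k (CA X i))" if "X \<subseteq> (\<Union>i. C i)" for X
    using that C d by (intro hausdorff_pre_le) (fastforce simp: CA_def)+
  have disj: "C i \<inter> A = {} \<or> C i \<inter> B = {}" for i
  proof (rule ccontr)
    assume "\<not> ?thesis"
    then obtain x y where "x \<in> A" "y \<in> B" "x \<in> C i" "y \<in> C i" by auto
    then show False
      using sep[of x y] C diameter_bounded_bound[of "C i" x y] by (smt (verit))
  qed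
  have "hausdorff_pre k \<delta> A + hausdorff_pre k \<delta> B
      \<le> (\<Sum>i. hausdorff_weight k (CA A i)) + (\<Sum>i. hausdorff_weight k (CA B i))"
    using AB by (intro add_mono le) auto
  also have "\<dots> = (\<Sum>i. hausdorff_weight k (CA A i) + hausdorff_weight k (CA B i))"
    by (rule suminf_add) auto
  also have "\<dots> \<le> (\<Sum>i. hausdorff_weight k (C i))"
    using disj by (intro suminf_le) (auto simp: CA_def)
  finally show "hausdorff_pre k \<delta> A + hausdorff_pre k \<delta> B \<le> (\<Sum>i. hausdorff_weight k (C i))" .
qed

lemma hausdorff_outer_separated:
  assumes "0 < \<delta>" and sep: "\<And>x y. x \<in> A \<Longrightarrow> y \<in> B \<Longrightarrow> \<delta> \<le> dist x y"
  shows "hausdorff_outer k A + hausdorff_outer k B \<le> hausdorff_outer k (A \<union> B)"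
proof -
  have *: "hausdorff_pre k a A + hausdorff_pre k b B \<le> hausdorff_outer k (A \<union> B)"
    if "0 < a" "0 < b" for a b
  proof -
    \<comment> \<open>Below both scales, so that both pre-measures only grow, and strictly below the
      distance of the two sets.\<close>
    let ?d = "min (min a b) (\<delta>/2)"
    have "hausdorff_pre k a A + hausdorff_pre k b B \<le> hausdorff_pre k ?d A + hausdorff_pre k ?d B"
      by (intro add_mono hausdorff_pre_antimono) auto
    also have "\<dots> \<le> hausdorff_pre k ?d (A \<union> B)"
      using assms by (intro hausdorff_pre_separated) force
    also have "\<dots> \<le> hausdorff_outer k (A \<union> B)"
      using that assms by (intro hausdorff_pre_le_outer) auto
    finally show ?thesis .
  qed
  have ne: "{0::real<..} \<noteq> {}" by auto
  have "hausdorff_pre k b B + hausdorff_outer k A \<le> hausdorff_outer k (A \<union> B)" if "0 < b" for b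
    unfolding add.commute[of "hausdorff_pre k b B"] hausdorff_outer_def[of k A] using * that
    by (subst ennreal_SUP_add_left[OF ne, symmetric]) (auto intro!: SUP_least)
  then show ?thesis
    unfolding hausdorff_outer_def[of k B] add.commute[of "hausdorff_outer k A"]
    by (subst ennreal_SUP_add_left[OF ne, symmetric]) (auto intro!: SUP_least)
qed

text \<open>Caratheodory's criterion for metric outer measures. The sets \<open>Y n\<close> of
  points at distance at least \<open>d n\<close> from \<open>F\<close> are separated from
  \<open>X \<inter> F\<close> and exhaust \<open>X - F\<close>. What \<open>Y n\<close> misses is a
  union of shells \<open>R m\<close> around \<open>F\<close>, whose measures form a convergent
  series, so the error is the tail of a series.\<close>

lemma hausdorff_outer_closed_split:
  fixes F :: "'a::metric_space set"
  assumes F: "closed F"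
  shows "hausdorff_outer k (X \<inter> F) + hausdorff_outer k (X - F) \<le> hausdorff_outer k X"
proof (cases "F = {} \<or> hausdorff_outer k X = top")
  case True then show ?thesis by (auto simp: top_unique)
next
  case False
  then have ne: "F \<noteq> {}" and fin: "hausdorff_outer k X < top"
    by (auto simp: less_top)
  let ?H = "hausdorff_outer k :: 'a set \<Rightarrow> ennreal"
  define d where "d n = 1 / real (Suc n)" for n
  have d0: "d n > 0" for n by (simp add: d_def)
  have dmono: "d (Suc n) < d n" for n by (simp add: d_def field_simps)
  have danti: "m \<le> n \<Longrightarrow> d n \<le> d m" for m n by (simp add: d_def field_simps)
  define Y where "Y n = {x \<in> X. d n \<le> infdist x F}" for n
  define R where "R n = {x \<in> X. d (Suc n) \<le> infdist x F \<and> infdist x F < d n}" for n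
  have lip: "infdist x F - infdist y F \<le> dist x y" for x y
    using infdist_triangle[of x F y] by simp
  \<comment> \<open>Neighbouring shells may touch, but between two shells of the same parity
    \<open>c\<close> lies a whole shell, so these are separated and their measures add up.\<close>
  have *: "(\<Sum>j<N. ?H (R (2*j+c))) \<le> ?H (\<Union>j<N. R (2*j+c))" for N c
  proof (induction N)
    case (Suc N)
    have "?H (\<Union>j<N. R (2*j+c)) + ?H (R (2*N+c)) \<le> ?H ((\<Union>j<N. R (2*j+c)) \<union> R (2*N+c))"
    proof (cases N)
      case (Suc M)
      show ?thesis
      proof (rule hausdorff_outer_separated[of "d (2*M+c+1) - d (2*N+c)"])
        show "0 < d (2*M+c+1) - d (2*N+c)" using dmono[of "2*M+c+1"] Suc by simp
        fix x y assume x: "x \<in> (\<Union>j<N. R (2*j+c))" and y: "y \<in> R (2*N+c)"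
        then obtain j where j: "j < N" "d (Suc (2*j+c)) \<le> infdist x F" by (auto simp: R_def)
        then have "d (2*M+c+1) \<le> infdist x F"
          using danti[of "Suc (2*j+c)" "2*M+c+1"] Suc by simp
        then show "d (2*M+c+1) - d (2*N+c) \<le> dist x y"
          using lip[of x y] y by (auto simp: R_def)
      qed
    qed auto
    then have "(\<Sum>j<N. ?H (R (2*j+c))) + ?H (R (2*N+c)) \<le> ?H ((\<Union>j<N. R (2*j+c)) \<union> R (2*N+c))"
      using add_right_mono[OF Suc] by (rule order_trans[rotated])
    then show ?case
      by (simp add: lessThan_Suc Un_commute add.commute[of _ "?H (R (2*N+c))"])
  qed auto
  have **: "(\<Sum>j<N. ?H (R (2*j+c))) \<le> ?H X" for N c
    using * by (rule order_trans) (auto intro!: hausdorff_outer_mono simp: R_def)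
  have "(\<Sum>m<n. ?H (R m)) \<le> ?H X + ?H X" for n
  proof -
    have "(\<Sum>m<n. ?H (R m)) \<le> (\<Sum>m<2*n. ?H (R m))"
      by (rule sum_mono2) auto
    also have "\<dots> = (\<Sum>j<n. ?H (R (2*j+0))) + (\<Sum>j<n. ?H (R (2*j+1)))"
      by (induction n) (simp_all add: ac_simps)
    also have "\<dots> \<le> ?H X + ?H X" by (intro add_mono **)
    finally show ?thesis .
  qed
  then have "(\<Sum>m. ?H (R m)) \<le> ?H X + ?H X"
    by (intro suminf_le_const) auto
  then have sfin: "(\<Sum>m. ?H (R m)) < top" using fin by (auto simp: le_less_trans)
  define r where "r m = enn2real (?H (R m))" for m
  have r: "?H (R m) = ennreal (r m)" for m
    using ennreal_suminf_lessD[OF sfin, of m] by (simp add: r_def)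
  have rnn: "r m \<ge> 0" for m by (simp add: r_def)
  have sr: "summable r"
    using sfin rnn by (intro summable_suminf_not_top) (auto simp: r)
  have UX: "X - F \<subseteq> Y n \<union> (\<Union>m. R (m + n))" for n
  proof
    fix x assume x: "x \<in> X - F"
    then have pos: "infdist x F > 0"
      using F ne by (simp add: infdist_pos_not_in_closed)
    have "d \<longlonglongrightarrow> 0" unfolding d_def by (rule LIMSEQ_Suc[OF lim_1_over_n])
    then have "eventually (\<lambda>i. d i < infdist x F) sequentially"
      using pos by (rule order_tendstoD)
    then obtain i where i: "d (i+n) < infdist x F"
      unfolding eventually_sequentially using le_add1 by blast
    show "x \<in> Y n \<union> (\<Union>m. R (m + n))"
    proof (cases "x \<in> Y n")
      case False
      then have lt: "infdist x F < d n" using x by (auto simp: Y_def)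
      \<comment> \<open>The first scale at which the point is no longer too close to
        \<open>F\<close>. It is not 0 because the point lies outside \<open>Y n\<close>, and the
        point belongs to the shell just before it.\<close>
      define m where "m = (LEAST i. d (i+n) \<le> infdist x F)"
      have m1: "d (m+n) \<le> infdist x F" unfolding m_def by (rule LeastI[of _ i]) (use i in auto)
      have "m \<noteq> 0" using m1 lt by (cases m) auto
      then obtain m' where m': "m = Suc m'" by (cases m) auto
      have "\<not> d (m'+n) \<le> infdist x F" using not_less_Least[of m' "\<lambda>i. d (i+n) \<le> infdist x F"] m' unfolding m_def by simp
      then have "x \<in> R (m'+n)" using m1 m' x by (auto simp: R_def)
      then show ?thesis by auto
    qed auto
  qed
  have main: "?H (X \<inter> F) + ?H (X - F) \<le> ?H X + ennreal (\<Sum>m. r (m + n))" for n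
  proof -
    have "?H (X - F) \<le> ?H (Y n) + ?H (\<Union>m. R (m + n))"
      by (rule order_trans[OF hausdorff_outer_mono[OF UX] hausdorff_outer_Un])
    also have "\<dots> \<le> ?H (Y n) + (\<Sum>m. ?H (R (m + n)))"
      by (intro add_left_mono hausdorff_outer_UN)
    also have "(\<Sum>m. ?H (R (m + n))) = ennreal (\<Sum>m. r (m + n))"
      unfolding r using sr rnn by (intro suminf_ennreal2) (auto simp: summable_iff_shift)
    finally have "?H (X \<inter> F) + ?H (X - F) \<le> (?H (X \<inter> F) + ?H (Y n)) + ennreal (\<Sum>m. r (m + n))"
      by (metis add.assoc add_left_mono)
    also have "?H (X \<inter> F) + ?H (Y n) \<le> ?H ((X \<inter> F) \<union> Y n)"
    proof (rule hausdorff_outer_separated[OF d0[of n]])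
      fix x y assume "x \<in> X \<inter> F" "y \<in> Y n"
      then show "d n \<le> dist x y" using infdist_le[of x F y] by (auto simp: Y_def dist_commute)
    qed
    also have "\<dots> \<le> ?H X" by (rule hausdorff_outer_mono) (auto simp: Y_def)
    finally show ?thesis by (simp add: add_right_mono)
  qed
  show ?thesis
  proof (rule ennreal_le_epsilon)
    fix e :: real assume "0 < e"
    then obtain N where "\<And>n. n \<ge> N \<Longrightarrow> norm (\<Sum>i. r (i + n)) < e"
      using suminf_exist_split[OF _ sr] by blast
    then have "(\<Sum>i. r (i + N)) \<le> e" by force
    then show "?H (X \<inter> F) + ?H (X - F) \<le> ?H X + e"
      by (intro order_trans[OF main[of N]] add_left_mono ennreal_leI)
  qed
qed

lemma borel_subset_hausdorff_lambda:
  "sets borel \<subseteq> lambda_system UNIV (Pow UNIV) (hausdorff_outer k :: 'a::metric_space set \<Rightarrow> ennreal)"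
proof -
  interpret sigma_algebra "UNIV :: 'a set" "Pow UNIV" by (rule sigma_algebra_Pow)
  let ?L = "lambda_system UNIV (Pow UNIV) (hausdorff_outer k :: 'a set \<Rightarrow> ennreal)"
  have "measure_space UNIV ?L (hausdorff_outer k)"
    by (rule caratheodory_lemma[OF outer_measure_space_hausdorff])
  then have "sigma_algebra UNIV ?L" by (simp add: measure_space_def)
  moreover have "Collect closed \<subseteq> ?L"
  proof safe
    fix F :: "'a set" assume "closed F"
    then have "hausdorff_outer k (X \<inter> F) + hausdorff_outer k (X - F) = hausdorff_outer k X" for X
      using hausdorff_outer_Un[of k "X \<inter> F" "X - F"]
      by (intro antisym hausdorff_outer_closed_split) (auto simp: Int_Diff_Un)
    then show "F \<in> ?L" unfolding lambda_system_eq by simp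
  qed
  ultimately have "sigma_sets UNIV (Collect closed) \<subseteq> ?L"
    by (rule sigma_algebra.sigma_sets_subset)
  then show ?thesis
    by (simp add: borel_eq_closed)
qed

lemma sets_hausdorff_measure [simp, measurable_cong]: "sets (hausdorff_measure k) = sets borel"
  using sets.sigma_sets_eq[of borel] by (simp add: hausdorff_measure_def sets_measure_of_conv)

lemma space_hausdorff_measure [simp]: "space (hausdorff_measure k) = UNIV"
  by (simp add: hausdorff_measure_def space_measure_of_conv)

text \<open>\<open>measure_of\<close> takes the values of the outer measure only once that is
  countably additive on the Borel sets; Caratheodory's theorem provides this, since the Borel sets
  lie in the \<open>lambda_system\<close>.\<close>

lemma emeasure_hausdorff_measure:
  fixes A :: "'a::metric_space set"
  assumes "A \<in> sets borel"
  shows "emeasure (hausdorff_measure k) A = hausdorff_outer k A"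
proof -
  interpret sigma_algebra "UNIV :: 'a set" "Pow UNIV" by (rule sigma_algebra_Pow)
  let ?L = "lambda_system UNIV (Pow UNIV) (hausdorff_outer k :: 'a set \<Rightarrow> ennreal)"
  have ms: "measure_space UNIV ?L (hausdorff_outer k)"
    by (rule caratheodory_lemma[OF outer_measure_space_hausdorff])
  then have "countably_additive (sets borel) (hausdorff_outer k :: 'a set \<Rightarrow> ennreal)"
    using borel_subset_hausdorff_lambda[of k]
    unfolding measure_space_def countably_additive_def by blast
  then show ?thesis
    using assms by (intro emeasure_measure_of[OF hausdorff_measure_def]) (auto simp: positive_def)
qed

lemma hausdorff_outer_lipschitz_image:
  fixes f :: "'a::metric_space \<Rightarrow> 'b::metric_space"
  assumes L: "0 < L" and lip: "\<And>x y. x \<in> A \<Longrightarrow> y \<in> A \<Longrightarrow> dist (f x) (f y) \<le> L * dist x y"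
  shows "hausdorff_outer k (f ` A) \<le> ennreal (L ^ k) * hausdorff_outer k A"
proof (rule hausdorff_outer_least)
  fix \<delta> :: real assume \<delta>: "0 < \<delta>"
  have c: "0 < ennreal (L ^ k)" using L by simp
  \<comment> \<open>With the constant on the left, the bound can be checked cover by cover below the
    infimum; it is multiplied back at the end.\<close>
  have "hausdorff_pre k \<delta> (f ` A) / ennreal (L ^ k) \<le> hausdorff_pre k (\<delta> / L) A"
    unfolding hausdorff_pre_def[of k "\<delta> / L"]
  proof (rule INF_greatest, rule divide_le_posI_ennreal[OF c], clarify)
    fix C :: "nat \<Rightarrow> 'a set"
    assume A: "A \<subseteq> (\<Union>i. C i)" and C: "\<forall>i. bounded (C i) \<and> diameter (C i) \<le> \<delta> / L"
    \<comment> \<open>Only the part inside \<open>A\<close> is mapped, since nothing is known about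
      \<open>f\<close> elsewhere.\<close>
    define D where "D i = f ` (C i \<inter> A)" for i
    have lipD: "dist x y \<le> L * diameter (C i)" if xy: "x \<in> D i" "y \<in> D i" for x y i
    proof -
      obtain x' y' where *: "x' \<in> C i \<inter> A" "y' \<in> C i \<inter> A" "x = f x'" "y = f y'"
        using xy by (auto simp: D_def)
      then have "dist x' y' \<le> diameter (C i)"
        using C by (intro diameter_bounded_bound) auto
      then have "L * dist x' y' \<le> L * diameter (C i)" using L by simp
      then show ?thesis using lip[of x' y'] * by force
    qed
    have bdd: "bounded (D i)" for i
      using lipD[of _ i] unfolding bounded_two_points by blast
    have diam: "diameter (D i) \<le> L * diameter (C i)" for i
      using C L diameter_ge_0[of "C i"] lipD[of _ i]
      by (auto simp: diameter_def[of "D i"] intro!: cSUP_least)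
    have "hausdorff_pre k \<delta> (f ` A) \<le> (\<Sum>i. hausdorff_weight k (D i))"
    proof (rule hausdorff_pre_le[OF _ bdd])
      show "diameter (D i) \<le> \<delta>" for i
      proof -
        have "L * diameter (C i) \<le> L * (\<delta> / L)" using C L by (intro mult_left_mono) auto
        then show ?thesis using diam[of i] L by simp
      qed
    qed (use A in \<open>fastforce simp: D_def\<close>)
    also have "\<dots> \<le> (\<Sum>i. ennreal (L ^ k) * hausdorff_weight k (C i))"
    proof (rule suminf_le[OF _ summableI summableI])
      fix i
      have "ennreal (unit_ball_vol k * (diameter (D i) / 2) ^ k)
          \<le> ennreal (L ^ k * (unit_ball_vol k * (diameter (C i) / 2) ^ k))"
      proof (rule ennreal_leI)
        have "(diameter (D i) / 2) ^ k \<le> (L * (diameter (C i) / 2)) ^ k"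
          using diam[of i] bdd[of i] by (intro power_mono) (auto simp: diameter_ge_0)
        then have "unit_ball_vol k * (diameter (D i) / 2) ^ k
            \<le> unit_ball_vol k * (L * (diameter (C i) / 2)) ^ k"
          by (intro mult_left_mono) auto
        then show "unit_ball_vol k * (diameter (D i) / 2) ^ k
            \<le> L ^ k * (unit_ball_vol k * (diameter (C i) / 2) ^ k)"
          by (metis (no_types) power_mult_distrib mult.left_commute)
      qed
      also have "\<dots> = ennreal (L ^ k) * ennreal (unit_ball_vol k * (diameter (C i) / 2) ^ k)"
        using C L by (intro ennreal_mult) (auto simp: diameter_ge_0)
      finally show "hausdorff_weight k (D i) \<le> ennreal (L ^ k) * hausdorff_weight k (C i)"
        by (auto simp: hausdorff_weight_def D_def)
    qed
    finally show "hausdorff_pre k \<delta> (f ` A) \<le> ennreal (L ^ k) * (\<Sum>i. hausdorff_weight k (C i))"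
      by simp
  qed
  also have "\<dots> \<le> hausdorff_outer k A"
    using \<delta> L by (intro hausdorff_pre_le_outer) auto
  finally have "ennreal (L ^ k) * (hausdorff_pre k \<delta> (f ` A) / ennreal (L ^ k))
      \<le> ennreal (L ^ k) * hausdorff_outer k A"
    by (rule mult_left_mono) simp
  then show "hausdorff_pre k \<delta> (f ` A) \<le> ennreal (L ^ k) * hausdorff_outer k A"
    using ennreal_mult_divide_eq[of "ennreal (L ^ k)" "hausdorff_pre k \<delta> (f ` A)"] c
    by (simp add: ennreal_times_divide mult.commute[of "ennreal (L ^ k)"])
qed

subsection \<open>Integration along parallel lines\<close>

definition slab :: "'a::euclidean_space \<Rightarrow> 'a set" where
  "slab e = {x. 0 \<le> x \<bullet> e \<and> x \<bullet> e \<le> 1}"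

lemma closed_slab: "closed (slab e)"
  unfolding slab_def by (intro closed_Collect_conj closed_Collect_le continuous_intros)

lemma slab_borel [measurable]: "slab e \<in> sets borel"
  using closed_slab by (rule borel_closed)

text \<open>Tonelli and translation invariance give integration over the lines parallel to \<open>e\<close> without
  choosing coordinates: the cylinder \<open>slab e\<close> over the hyperplane orthogonal to \<open>e\<close> takes the place of
  $(d-1)$-dimensional Lebesgue measure on that hyperplane.\<close>

lemma nn_integral_fibre:
  fixes f :: "'a::euclidean_space \<Rightarrow> ennreal"
  assumes f[measurable]: "f \<in> borel_measurable borel" and e: "norm e = 1"
  shows "(\<integral>\<^sup>+x. indicator (slab e) x * (\<integral>\<^sup>+t. f (x + t *\<^sub>R e) \<partial>lborel) \<partial>lborel) = (\<integral>\<^sup>+x. f x \<partial>lborel)"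
proof -
  have ee: "e \<bullet> e = 1" using e by (simp add: dot_square_norm)
  have "(\<integral>\<^sup>+x. indicator (slab e) x * (\<integral>\<^sup>+t. f (x + t *\<^sub>R e) \<partial>lborel) \<partial>lborel)
      = (\<integral>\<^sup>+x. (\<integral>\<^sup>+t. indicator (slab e) x * f (x + t *\<^sub>R e) \<partial>lborel) \<partial>lborel)"
    by (intro nn_integral_cong nn_integral_cmult[symmetric]) measurable
  also have "\<dots> = (\<integral>\<^sup>+t. (\<integral>\<^sup>+x. indicator (slab e) x * f (x + t *\<^sub>R e) \<partial>lborel) \<partial>lborel)"
    by (rule lborel_pair.Fubini'[symmetric]) measurable
  also have "\<dots> = (\<integral>\<^sup>+t. (\<integral>\<^sup>+x. indicator (slab e) (x - t *\<^sub>R e) * f x \<partial>lborel) \<partial>lborel)"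
  proof (rule nn_integral_cong)
    fix t :: real
    have "(\<integral>\<^sup>+x. indicator (slab e) (x - t *\<^sub>R e) * f x \<partial>lborel)
        = (\<integral>\<^sup>+x. indicator (slab e) (x - t *\<^sub>R e) * f x \<partial>distr lborel borel ((+) (t *\<^sub>R e)))"
      by (simp add: lborel_distr_plus)
    also have "\<dots> = (\<integral>\<^sup>+x. indicator (slab e) x * f (x + t *\<^sub>R e) \<partial>lborel)"
      by (subst nn_integral_distr) (auto simp: add.commute)
    finally show "(\<integral>\<^sup>+x. indicator (slab e) x * f (x + t *\<^sub>R e) \<partial>lborel)
        = (\<integral>\<^sup>+x. indicator (slab e) (x - t *\<^sub>R e) * f x \<partial>lborel)" ..
  qed
  also have "\<dots> = (\<integral>\<^sup>+x. (\<integral>\<^sup>+t. indicator (slab e) (x - t *\<^sub>R e) * f x \<partial>lborel) \<partial>lborel)"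
    by (rule lborel_pair.Fubini') measurable
  also have "\<dots> = (\<integral>\<^sup>+x. f x \<partial>lborel)"
  proof (rule nn_integral_cong)
    fix x :: 'a
    \<comment> \<open>For fixed \<open>x\<close> the admissible \<open>t\<close> form an interval of
      length 1, the thickness of the slab.\<close>
    have "(\<integral>\<^sup>+t. indicator (slab e) (x - t *\<^sub>R e) * f x \<partial>lborel)
        = (\<integral>\<^sup>+t. f x * indicator {x \<bullet> e - 1 .. x \<bullet> e} t \<partial>lborel)"
      using ee by (intro nn_integral_cong) (auto simp: slab_def indicator_def inner_diff_left)
    also have "\<dots> = f x"
      by (subst nn_integral_cmult_indicator) auto
    finally show "(\<integral>\<^sup>+t. indicator (slab e) (x - t *\<^sub>R e) * f x \<partial>lborel) = f x" .
  qed
  finally show ?thesis .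
qed

text \<open>Cavalieri's principle for the lines parallel to \<open>e\<close>.\<close>

lemma emeasure_eq_fibre:
  fixes A B :: "'a::euclidean_space set"
  assumes [measurable]: "A \<in> sets borel" "B \<in> sets borel" and e: "norm e = 1"
    and eq: "\<And>x. emeasure lborel {t. x + t *\<^sub>R e \<in> A} = emeasure lborel {t. x + t *\<^sub>R e \<in> B}"
  shows "emeasure lborel A = emeasure lborel B"
proof -
  have *: "(\<integral>\<^sup>+t. indicator X (x + t *\<^sub>R e) \<partial>lborel) = emeasure lborel {t. x + t *\<^sub>R e \<in> X}"
    if [measurable]: "X \<in> sets borel" for X and x :: 'a
  proof -
    have "(\<integral>\<^sup>+t. indicator X (x + t *\<^sub>R e) \<partial>lborel)
        = (\<integral>\<^sup>+t. indicator {t. x + t *\<^sub>R e \<in> X} t \<partial>lborel)"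
      by (intro nn_integral_cong) (auto simp: indicator_def)
    then show ?thesis by simp
  qed
  have "emeasure lborel X = (\<integral>\<^sup>+x. indicator (slab e) x * emeasure lborel {t. x + t *\<^sub>R e \<in> X} \<partial>lborel)"
    if [measurable]: "X \<in> sets borel" for X
    using nn_integral_fibre[of "indicator X" e] e by (simp add: *)
  then show ?thesis by (simp add: eq)
qed

subsection \<open>The isodiametric inequality\<close>

definition reflect_along :: "'a::euclidean_space \<Rightarrow> 'a \<Rightarrow> 'a" where
  "reflect_along b x = x - (2 * (x \<bullet> b)) *\<^sub>R b"

text \<open>The witness is the closure of the Steiner symmetral; this avoids showing that the symmetral
  itself is closed.\<close>

lemma steiner_symmetrization:
  fixes C :: "'a::euclidean_space set"
  assumes C: "compact C" and b: "b \<in> Basis"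
  obtains S where "compact S" "emeasure lborel C \<le> emeasure lborel S" "diameter S \<le> diameter C"
    "reflect_along b ` S \<subseteq> S"
    "\<And>b'. b' \<in> Basis \<Longrightarrow> b' \<noteq> b \<Longrightarrow> reflect_along b' ` C \<subseteq> C \<Longrightarrow> reflect_along b' ` S \<subseteq> S"
proof -
  have bb [simp]: "b \<bullet> b = 1" and nb: "norm b = 1" using b by auto
  define P where "P x = x - (x \<bullet> b) *\<^sub>R b" for x
  have Pb [simp]: "P x \<bullet> b = 0" for x by (simp add: P_def inner_diff_left)
  have P_add [simp]: "P (x + t *\<^sub>R b) = P x" for x t by (simp add: P_def inner_add_left algebra_simps)
  have P_P [simp]: "P (P x) = P x" for x using Pb[of x] by (simp add: P_def[of "P x"])
  have PP: "x = P x + (x \<bullet> b) *\<^sub>R b" for x by (simp add: P_def)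
  have contP: "continuous_on A P" for A unfolding P_def by (intro continuous_intros)
  define T where "T x = {t. P x + t *\<^sub>R b \<in> C}" for x
  have T_add [simp]: "T (x + t *\<^sub>R b) = T x" for x t by (simp add: T_def)
  have Cb [measurable]: "C \<in> sets borel" using C by (simp add: borel_closed compact_imp_closed)
  have compT: "compact (T x)" for x
  proof -
    obtain B where B: "\<And>y. y \<in> C \<Longrightarrow> norm y \<le> B" using C by (meson bounded_iff compact_imp_bounded)
    have "\<bar>t\<bar> \<le> B" if "t \<in> T x" for t
    proof -
      have "\<bar>(P x + t *\<^sub>R b) \<bullet> b\<bar> \<le> norm (P x + t *\<^sub>R b)" using b by (rule Basis_le_norm)
      then show ?thesis using B that by (force simp: T_def inner_add_left)
    qed
    then have "bounded (T x)" by (auto simp: bounded_iff)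
    moreover have "closed (T x)"
    proof -
      have "T x = (\<lambda>t. P x + t *\<^sub>R b) -` C" by (auto simp: T_def)
      then show ?thesis
        by (simp only:) (intro closed_vimage continuous_intros compact_imp_closed[OF C])
    qed
    ultimately show ?thesis by (simp add: compact_eq_bounded_closed)
  qed
  then have [measurable]: "T x \<in> sets borel" for x by (simp add: borel_closed compact_imp_closed)
  have finT: "emeasure lborel (T x) < top" for x
    using emeasure_bounded_finite[OF compact_imp_bounded[OF compT]] by (simp add: less_top)
  define l where "l x = measure lborel (T x)" for x
  have eT: "emeasure lborel (T x) = ennreal (l x)" for x
    using finT[of x] by (simp add: l_def emeasure_eq_ennreal_measure less_top)
  have l0: "0 \<le> l x" for x by (simp add: l_def)
  have l_add [simp]: "l (x + t *\<^sub>R b) = l x" for x t by (simp add: l_def)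
  have [measurable]: "P \<in> borel_measurable borel"
    by (rule borel_measurable_continuous_onI[OF contP])
  have "(\<lambda>x. emeasure lborel (T x)) \<in> borel_measurable borel"
  proof -
    have "{z \<in> space (borel \<Otimes>\<^sub>M lborel). P (fst z) + snd z *\<^sub>R b \<in> C} \<in> sets (borel \<Otimes>\<^sub>M lborel)"
      by measurable
    from lborel.measurable_emeasure_Pair[OF this] show ?thesis
      by (simp add: T_def vimage_def space_pair_measure)
  qed
  then have [measurable]: "l \<in> borel_measurable borel"
    unfolding l_def measure_def by measurable
  \<comment> \<open>Each section becomes a centred closed interval of the same length. A section of
    length 0 may be a nonempty null set or empty; the first conjunct keeps out the lines that miss
    \<open>C\<close>.\<close>
  define S where "S = {x. T x \<noteq> {} \<and> 2 * \<bar>x \<bullet> b\<bar> \<le> l x}"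
  have "{x. T x \<noteq> {}} = P -` (P ` C)"
  proof -
    have "P x \<in> P ` C" if "t \<in> T x" for x t
    proof -
      have "P x = P (P x + t *\<^sub>R b)" by simp
      then show ?thesis using that unfolding T_def mem_Collect_eq by (rule image_eqI)
    qed
    moreover have "y \<bullet> b \<in> T x" if "P x = P y" "y \<in> C" for x y
      using that PP[of y] by (simp add: T_def)
    ultimately show ?thesis by blast
  qed
  moreover have "closed (P ` C)" using C contP by (intro compact_imp_closed compact_continuous_image)
  ultimately have "closed {x. T x \<noteq> {}}"
    using contP by (simp add: closed_vimage)
  then have ne_meas: "{x. T x \<noteq> {}} \<in> sets borel" by (rule borel_closed)
  have Sb [measurable]: "S \<in> sets borel"
  proof -
    have "S = {x. T x \<noteq> {}} \<inter> {x. 2 * \<bar>x \<bullet> b\<bar> \<le> l x}" by (auto simp: S_def)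
    also have "{x. 2 * \<bar>x \<bullet> b\<bar> \<le> l x} \<in> sets borel" by measurable
    then have "{x. T x \<noteq> {}} \<inter> {x. 2 * \<bar>x \<bullet> b\<bar> \<le> l x} \<in> sets borel" by (rule sets.Int[OF ne_meas])
    finally show ?thesis .
  qed
  have vol: "emeasure lborel C = emeasure lborel S"
  proof (rule emeasure_eq_fibre[OF Cb Sb nb])
    fix x
    let ?s = "x \<bullet> b"
    have "x + t *\<^sub>R b = P x + (?s + t) *\<^sub>R b" for t by (simp add: P_def algebra_simps)
    then have "{t. x + t *\<^sub>R b \<in> C} = (+) ?s -` T x" by (auto simp: T_def)
    then have "emeasure lborel {t. x + t *\<^sub>R b \<in> C} = emeasure (distr lborel borel ((+) ?s)) (T x)"
      by (simp add: emeasure_distr)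
    then have 1: "emeasure lborel {t. x + t *\<^sub>R b \<in> C} = ennreal (l x)"
      by (simp add: lborel_distr_plus eT)
    have iv: "2 * \<bar>?s + t\<bar> \<le> l x \<longleftrightarrow> - l x / 2 - ?s \<le> t \<and> t \<le> l x / 2 - ?s" for t
      by (smt (verit) field_sum_of_halves minus_divide_left)
    have "{t. x + t *\<^sub>R b \<in> S} = (if T x = {} then {} else {- l x / 2 - ?s .. l x / 2 - ?s})"
      by (auto simp: S_def inner_add_left iv)
    then have 2: "emeasure lborel {t. x + t *\<^sub>R b \<in> S} = ennreal (l x)"
      using l0[of x] eT[of x] by (auto)
    show "emeasure lborel {t. x + t *\<^sub>R b \<in> C} = emeasure lborel {t. x + t *\<^sub>R b \<in> S}"
      by (simp add: 1 2)
  qed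
  have dP: "(norm (x - y))\<^sup>2 = (norm (P x - P y))\<^sup>2 + (x \<bullet> b - y \<bullet> b)\<^sup>2" for x y
  proof -
    have "x - y = (P x - P y) + (x \<bullet> b - y \<bullet> b) *\<^sub>R b" by (simp add: P_def algebra_simps)
    moreover have "orthogonal (P x - P y) ((x \<bullet> b - y \<bullet> b) *\<^sub>R b)"
      by (simp add: orthogonal_def inner_diff_left)
    ultimately show ?thesis using nb by (simp add: norm_add_Pythagorean)
  qed
  have PPt: "P (P x + t *\<^sub>R b) = P x" for x t by simp
  have dist_le: "norm (x - y) \<le> diameter C" if x: "x \<in> S" and y: "y \<in> S" for x y
  proof -
    have ex: "\<exists>a c. a \<in> T z \<and> c \<in> T z \<and> 2 * \<bar>z \<bullet> b\<bar> \<le> c - a" if "z \<in> S" for z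
    proof -
      have ne: "T z \<noteq> {}" and le: "2 * \<bar>z \<bullet> b\<bar> \<le> l z" using that by (auto simp: S_def)
      obtain a where a: "a \<in> T z" "\<And>t. t \<in> T z \<Longrightarrow> a \<le> t" using compact_attains_inf[OF compT ne] by blast
      obtain c where c: "c \<in> T z" "\<And>t. t \<in> T z \<Longrightarrow> t \<le> c" using compact_attains_sup[OF compT ne] by blast
      have "emeasure lborel (T z) \<le> emeasure lborel {a..c}" using a c by (intro emeasure_mono) auto
      then have "l z \<le> c - a" using a c by (simp add: eT)
      then show ?thesis using a c le by (intro exI[of _ a] exI[of _ c]) auto
    qed
    obtain a c where ac: "a \<in> T x" "c \<in> T x" "2 * \<bar>x \<bullet> b\<bar> \<le> c - a" using ex[OF x] by blast
    obtain a' c' where ac': "a' \<in> T y" "c' \<in> T y" "2 * \<bar>y \<bullet> b\<bar> \<le> c' - a'" using ex[OF y] by blast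
    \<comment> \<open>Compare the top of each section with the bottom of the other: (c - a') + (c' -
      a) is at least twice the sum of the two absolute heights, so one of the two distances is at
      least the difference of the heights of \<open>x\<close> and \<open>y\<close>.\<close>
    have "\<exists>t\<in>T x. \<exists>t'\<in>T y. \<bar>x \<bullet> b - y \<bullet> b\<bar> \<le> \<bar>t - t'\<bar>"
    proof (rule ccontr)
      assume "\<not> ?thesis"
      then have "\<bar>c - a'\<bar> < \<bar>x \<bullet> b - y \<bullet> b\<bar>" "\<bar>a - c'\<bar> < \<bar>x \<bullet> b - y \<bullet> b\<bar>" using ac ac' by force+
      then show False using ac ac' by linarith
    qed
    then obtain t t' where t: "t \<in> T x" "t' \<in> T y" "\<bar>x \<bullet> b - y \<bullet> b\<bar> \<le> \<bar>t - t'\<bar>" by blast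
    let ?u = "P x + t *\<^sub>R b" and ?v = "P y + t' *\<^sub>R b"
    have "(norm (x - y))\<^sup>2 \<le> (norm (P x - P y))\<^sup>2 + (t - t')\<^sup>2"
      unfolding dP[of x y] using t(3) by (simp add: abs_le_square_iff)
    also have "\<dots> = (norm (?u - ?v))\<^sup>2"
      unfolding dP[of ?u ?v] by (simp add: PPt inner_add_left)
    finally have "norm (x - y) \<le> norm (?u - ?v)" by (simp add: norm_le_square power2_le_imp_le)
    also have "\<dots> \<le> diameter C"
      using t C diameter_bounded_bound[of C ?u ?v] by (simp add: T_def dist_norm compact_imp_bounded)
    finally show ?thesis .
  qed
  have bddS: "bounded S" using dist_le unfolding bounded_two_points dist_norm by blast
  have diam: "diameter S \<le> diameter C"
    using dist_le C by (intro diameter_le) (auto simp: compact_imp_bounded diameter_ge_0)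
  have cont_r: "continuous_on A (reflect_along b')" for A and b' :: 'a
    unfolding reflect_along_def by (intro continuous_intros)
  have r_closure: "reflect_along b' ` closure S \<subseteq> closure S" if "reflect_along b' ` S \<subseteq> S" for b'
    using image_closure_subset[OF cont_r closed_closure, of b' S S] that closure_subset by blast
  show ?thesis
  proof (rule that[of "closure S"])
    show "compact (closure S)" using bddS by simp
    show "emeasure lborel C \<le> emeasure lborel (closure S)"
      unfolding vol by (intro emeasure_mono closure_subset) auto
    show "diameter (closure S) \<le> diameter C" using diam bddS by (simp add: diameter_closure)
    have "reflect_along b x = x + (- 2 * (x \<bullet> b)) *\<^sub>R b" for x by (simp add: reflect_along_def)
    then have "T (reflect_along b x) = T x" "l (reflect_along b x) = l x" 
        "reflect_along b x \<bullet> b = - (x \<bullet> b)" for x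
      by (metis T_add, metis l_add, simp add: reflect_along_def inner_diff_left)
    then show "reflect_along b ` closure S \<subseteq> closure S"
      by (intro r_closure) (auto simp: S_def)
    fix b' assume b': "b' \<in> Basis" "b' \<noteq> b" "reflect_along b' ` C \<subseteq> C"
    have ob: "b \<bullet> b' = 0" "b' \<bullet> b = 0" "b' \<bullet> b' = 1" using b b' by (auto simp: inner_Basis)
    have rr: "reflect_along b' (reflect_along b' x) = x" for x
      using ob by (simp add: reflect_along_def inner_diff_left)
    \<comment> \<open>Reflection along a different basis vector acts within the hyperplanes
      orthogonal to \<open>b\<close>. It carries the section over \<open>x\<close> to the section
      over the mirror image, so earlier symmetries survive.\<close>
    have rP: "P (reflect_along b' x) + t *\<^sub>R b = reflect_along b' (P x + t *\<^sub>R b)" for x t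
      using ob by (simp add: P_def reflect_along_def inner_diff_left inner_add_left algebra_simps)
    have "reflect_along b' z \<in> C \<longleftrightarrow> z \<in> C" for z using b'(3) rr by (metis image_subset_iff)
    then have "T (reflect_along b' x) = T x" for x by (simp add: T_def rP)
    moreover have "reflect_along b' x \<bullet> b = x \<bullet> b" for x
      using ob by (simp add: reflect_along_def inner_diff_left)
    ultimately show "reflect_along b' ` closure S \<subseteq> closure S"
      by (intro r_closure) (auto simp: S_def l_def)
  qed
qed

text \<open>Symmetrising along all basis vectors does not decrease the volume and does not increase
  the diameter, and it yields a set symmetric about the origin. There \<open>x\<close> and
  \<open>- x\<close> are at distance at most the diameter, so the set lies in a ball of half that
  radius. Without the symmetry no such ball need exist.\<close>

lemma isodiametric_compact:
  fixes C :: "'a::euclidean_space set"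
  assumes C: "compact C"
  shows "emeasure lborel C \<le> ennreal (unit_ball_vol DIM('a) * (diameter C / 2) ^ DIM('a))"
proof -
  have "\<exists>S. compact S \<and> emeasure lborel C \<le> emeasure lborel S \<and> diameter S \<le> diameter C \<and>
      (\<forall>b\<in>B. reflect_along b ` S \<subseteq> S)" if "B \<subseteq> (Basis :: 'a set)" for B
    using finite_subset[OF that finite_Basis] that
  proof (induction B)
    case empty then show ?case using C by auto
  next
    case (insert b B)
    then obtain S where S: "compact S" "emeasure lborel C \<le> emeasure lborel S" "diameter S \<le> diameter C"
      "\<And>b. b \<in> B \<Longrightarrow> reflect_along b ` S \<subseteq> S" by auto
    obtain S' where S': "compact S'" "emeasure lborel S \<le> emeasure lborel S'" "diameter S' \<le> diameter S"
      "reflect_along b ` S' \<subseteq> S'"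
      "\<And>b'. b' \<in> Basis \<Longrightarrow> b' \<noteq> b \<Longrightarrow> reflect_along b' ` S \<subseteq> S \<Longrightarrow> reflect_along b' ` S' \<subseteq> S'"
      using steiner_symmetrization[OF S(1), of b] insert.prems by blast
    have "reflect_along b' ` S' \<subseteq> S'" if "b' \<in> insert b B" for b'
      using S'(4) S'(5)[of b'] S(4)[of b'] insert.prems that by blast
    then show ?case
      using S'(1) order_trans[OF S(2) S'(2)] order_trans[OF S'(3) S(3)] by blast
  qed
  from this[OF order_refl] obtain S :: "'a set" where S: "compact S" "emeasure lborel C \<le> emeasure lborel S"
      "diameter S \<le> diameter C" and "\<forall>b\<in>Basis. reflect_along b ` S \<subseteq> S" by blast
  then have r: "\<And>b x. b \<in> Basis \<Longrightarrow> x \<in> S \<Longrightarrow> reflect_along b x \<in> S" by blast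
  have "S \<subseteq> cball 0 (diameter C / 2)"
  proof
    fix x assume x: "x \<in> S"
    \<comment> \<open>One reflection for each element of \<open>B\<close>; with all of
      \<open>Basis\<close> the point becomes \<open>- x\<close>.\<close>
    have "x - (\<Sum>b\<in>B. (2 * (x \<bullet> b)) *\<^sub>R b) \<in> S" if "B \<subseteq> Basis" for B
      using finite_subset[OF that finite_Basis] that
    proof (induction B)
      case (insert b B)
      have "(\<Sum>b\<in>B. (2 * (x \<bullet> b)) *\<^sub>R b) \<bullet> b = 0"
        using insert by (auto simp: inner_sum_left inner_Basis intro!: sum.neutral)
      then have "x - (\<Sum>b\<in>insert b B. (2 * (x \<bullet> b)) *\<^sub>R b)
          = reflect_along b (x - (\<Sum>b\<in>B. (2 * (x \<bullet> b)) *\<^sub>R b))"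
        using insert by (simp add: reflect_along_def inner_diff_left algebra_simps)
      then show ?case using r insert by simp
    qed (use x in auto)
    moreover have "(\<Sum>b\<in>Basis. (2 * (x \<bullet> b)) *\<^sub>R b) = 2 *\<^sub>R (\<Sum>b\<in>Basis. (x \<bullet> b) *\<^sub>R b)"
      by (simp only: scaleR_sum_right scaleR_scaleR)
    ultimately have "x - 2 *\<^sub>R x \<in> S"
      by (metis euclidean_representation order_refl)
    then have "dist x (x - 2 *\<^sub>R x) \<le> diameter S"
      using x S by (intro diameter_bounded_bound) (auto simp: compact_imp_bounded)
    then show "x \<in> cball 0 (diameter C / 2)" using S by (simp add: dist_norm)
  qed
  then have "emeasure lborel S \<le> emeasure lborel (cball (0::'a) (diameter C / 2))"
    by (intro emeasure_mono) auto
  also have "\<dots> = ennreal (unit_ball_vol DIM('a) * (diameter C / 2) ^ DIM('a))"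
    using C by (intro emeasure_cball) (simp add: diameter_ge_0 compact_imp_bounded)
  finally show ?thesis using S by simp
qed

subsection \<open>Hausdorff measure in top dimension\<close>

text \<open>Vitali's theorems deliver families over countable, possibly finite, index sets, while
  the definition asks for sequences. Spare indices get the empty set, whose weight is 0 by the
  special clause of \<open>hausdorff_weight\<close>.\<close>

lemma hausdorff_pre_le_countable:
  assumes I: "countable I" and A: "A \<subseteq> (\<Union>i\<in>I. C i)"
    and C: "\<And>i. i \<in> I \<Longrightarrow> bounded (C i)" "\<And>i. i \<in> I \<Longrightarrow> diameter (C i) \<le> \<delta>" and \<delta>: "0 \<le> \<delta>"
  shows "hausdorff_pre k \<delta> A \<le> (\<integral>\<^sup>+i. hausdorff_weight k (C i) \<partial>count_space I)"
proof -
  define D where "D n = (if n \<in> to_nat_on I ` I then C (from_nat_into I n) else {})" for n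
  have "hausdorff_pre k \<delta> A \<le> (\<Sum>n. hausdorff_weight k (D n))"
  proof (rule hausdorff_pre_le)
    show "A \<subseteq> (\<Union>n. D n)"
    proof
      fix x assume "x \<in> A"
      then obtain i where "i \<in> I" "x \<in> C i" using A by blast
      then have "x \<in> D (to_nat_on I i)" using I by (simp add: D_def)
      then show "x \<in> (\<Union>n. D n)" by blast
    qed
  qed (use C \<delta> I in \<open>auto simp: D_def\<close>)
  also have "\<dots> = (\<integral>\<^sup>+n. hausdorff_weight k (D n) \<partial>count_space UNIV)"
    by (simp add: nn_integral_count_space_nat)
  also have "\<dots> = (\<integral>\<^sup>+n. hausdorff_weight k (D n) \<partial>count_space (to_nat_on I ` I))"
    by (subst nn_integral_count_space_indicator[of "to_nat_on I ` I"])
       (auto intro!: nn_integral_cong simp: D_def indicator_def)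
  also have "\<dots> = (\<integral>\<^sup>+i. hausdorff_weight k (D (to_nat_on I i)) \<partial>count_space I)"
    using I by (intro nn_integral_bij_count_space[symmetric]) (simp add: bij_betw_def inj_on_to_nat_on)
  also have "\<dots> = (\<integral>\<^sup>+i. hausdorff_weight k (C i) \<partial>count_space I)"
    using I by (intro nn_integral_cong) (auto simp: D_def)
  finally show ?thesis .
qed

lemma hausdorff_weight_cball:
  fixes a :: "'a::euclidean_space"
  assumes "0 \<le> r"
  shows "hausdorff_weight DIM('a) (cball a r) = emeasure lborel (cball a r)"
  using assms by (auto simp: hausdorff_weight_def emeasure_cball diameter_cball)

lemma hausdorff_weight_ball:
  fixes a :: "'a::euclidean_space"
  assumes "0 < r"
  shows "hausdorff_weight DIM('a) (ball a r) = emeasure lborel (ball a r)"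
  using assms by (auto simp: hausdorff_weight_def emeasure_ball diameter_ball)

text \<open>By the isodiametric inequality the weight of each covering set bounds the volume of its
  closure, which is measurable and has the same diameter. This works at every scale, so the scale 1
  suffices.\<close>

lemma emeasure_le_hausdorff_outer:
  fixes A :: "'a::euclidean_space set"
  assumes [measurable]: "A \<in> sets borel"
  shows "emeasure lborel A \<le> hausdorff_outer DIM('a) A"
proof -
  have "emeasure lborel A \<le> hausdorff_pre DIM('a) 1 A"
    unfolding hausdorff_pre_def
  proof (rule INF_greatest, clarify)
    fix C :: "nat \<Rightarrow> 'a set"
    assume A: "A \<subseteq> (\<Union>i. C i)" and C: "\<forall>i. bounded (C i) \<and> diameter (C i) \<le> 1"
    have "emeasure lborel A \<le> emeasure lborel (\<Union>i. closure (C i))"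
      using A closure_subset by (intro emeasure_mono) (blast, measurable)
    also have "\<dots> \<le> (\<Sum>i. emeasure lborel (closure (C i)))"
      by (intro emeasure_subadditive_countably) auto
    also have "\<dots> \<le> (\<Sum>i. hausdorff_weight DIM('a) (C i))"
    proof (rule suminf_le[OF _ summableI summableI])
      fix i
      show "emeasure lborel (closure (C i)) \<le> hausdorff_weight DIM('a) (C i)"
        using isodiametric_compact[of "closure (C i)"] C
        by (auto simp: hausdorff_weight_def diameter_closure)
    qed
    finally show "emeasure lborel A \<le> (\<Sum>i. hausdorff_weight DIM('a) (C i))" .
  qed
  then show ?thesis
    using hausdorff_pre_le_outer[of 1 "DIM('a)" A] by (rule order_trans) simp
qed

text \<open>The enlarged balls of the Vitali covering lemma suffice for null sets; the constant $5^d$ does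
  not matter there.\<close>

lemma hausdorff_pre_negligible:
  fixes N :: "'a::euclidean_space set"
  assumes N: "negligible N" and \<delta>: "0 < \<delta>"
  shows "hausdorff_pre DIM('a) \<delta> N = 0"
proof -
  let ?k = "DIM('a)"
  have "hausdorff_pre ?k \<delta> N \<le> 0 + ennreal \<eta>" if \<eta>: "0 < \<eta>" for \<eta>
  proof -
    have "0 < \<eta> / 5 ^ ?k" using \<eta> by simp
    then obtain U where U: "open U" "N \<subseteq> U" "emeasure lebesgue (U - N) < \<eta> / 5 ^ ?k"
      using sets_lebesgue_outer_open[OF negligible_imp_sets[OF N]] by metis
    have "emeasure lebesgue U = emeasure lebesgue (U - N)"
      using N U by (intro emeasure_Diff_null_set[symmetric]) (auto simp: negligible_iff_null_sets)
    then have eU: "emeasure lborel U < \<eta> / 5 ^ ?k" using U by simp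
    \<comment> \<open>The fivefold enlarged balls must still have diameter at most \<delta>.\<close>
    have "\<exists>r. 0 < r \<and> r \<le> \<delta> / 10 \<and> cball x r \<subseteq> U" if "x \<in> N" for x
    proof -
      have "x \<in> U" using U(2) that by (rule subsetD)
      then obtain e where e: "0 < e" "cball x e \<subseteq> U" using U(1) unfolding open_contains_cball by blast
      have "cball x (min e (\<delta>/10)) \<subseteq> cball x e" by (rule subset_cball) simp
      then have "cball x (min e (\<delta>/10)) \<subseteq> U" using e(2) by (rule subset_trans)
      then show ?thesis using \<delta> e(1) by (intro exI[of _ "min e (\<delta>/10)"] conjI) simp_all
    qed
    then have "\<exists>r. \<forall>x\<in>N. 0 < r x \<and> r x \<le> \<delta> / 10 \<and> cball x (r x) \<subseteq> U" by (intro bchoice) blast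
    then obtain r where r: "\<And>x. x \<in> N \<Longrightarrow> 0 < r x \<and> r x \<le> \<delta> / 10" "\<And>x. x \<in> N \<Longrightarrow> cball x (r x) \<subseteq> U"
      by blast
    have "N \<subseteq> (\<Union>i\<in>N. cball i (r i))" using r(1) by (auto intro!: bexI simp: less_imp_le)
    then obtain C where C: "countable C" "C \<subseteq> N"
      "pairwise (\<lambda>i j. disjnt (cball i (r i)) (cball j (r j))) C" "N \<subseteq> (\<Union>i\<in>C. cball i (5 * r i))"
      by (rule Vitali_covering_lemma_cballs[where a = "\<lambda>x. x" and r = r, OF _ r(1)])
    have "hausdorff_pre ?k \<delta> N \<le> (\<integral>\<^sup>+i. hausdorff_weight ?k (cball i (5 * r i)) \<partial>count_space C)"
    proof (rule hausdorff_pre_le_countable[OF C(1) C(4)])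
      show "diameter (cball i (5 * r i)) \<le> \<delta>" if "i \<in> C" for i
        using r(1)[of i] C that by (auto simp: diameter_cball)
    qed (use \<delta> in auto)
    also have "\<dots> = (\<integral>\<^sup>+i. ennreal (5 ^ ?k) * emeasure lborel (cball i (r i)) \<partial>count_space C)"
    proof (rule nn_integral_cong)
      fix i assume "i \<in> space (count_space C)"
      then have "0 < r i" using r C by auto
      then show "hausdorff_weight ?k (cball i (5 * r i)) = ennreal (5 ^ ?k) * emeasure lborel (cball i (r i))"
        by (simp add: hausdorff_weight_cball emeasure_cball ennreal_mult[symmetric] power_mult_distrib ac_simps)
    qed
    also have "\<dots> = ennreal (5 ^ ?k) * (\<integral>\<^sup>+i. emeasure lborel (cball i (r i)) \<partial>count_space C)"
      by (rule nn_integral_cmult) simp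
    also have "(\<integral>\<^sup>+i. emeasure lborel (cball i (r i)) \<partial>count_space C)
        = emeasure lborel (\<Union>i\<in>C. cball i (r i))"
      using C by (intro emeasure_UN_countable[symmetric])
         (auto simp: disjoint_family_on_def pairwise_def disjnt_def)
    also have "\<dots> \<le> emeasure lborel U"
      using r C U by (intro emeasure_mono) auto
    also have "\<dots> \<le> ennreal (\<eta> / 5 ^ ?k)" using eU by simp
    also have "ennreal (5 ^ ?k) * ennreal (\<eta> / 5 ^ ?k) = ennreal \<eta>"
      using \<eta> by (subst ennreal_mult[symmetric]) auto
    finally show ?thesis by (simp add: mult_left_mono)
  qed
  then have "hausdorff_pre ?k \<delta> N \<le> 0" by (rule ennreal_le_epsilon)
  then show ?thesis by simp
qed

text \<open>For balls the weight equals the volume. Disjoint small balls inside an open superset of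
  almost the same measure cover \<open>A\<close> up to a null set, and null sets cost
  nothing.\<close>

lemma hausdorff_outer_le_emeasure:
  fixes A :: "'a::euclidean_space set"
  assumes [measurable]: "A \<in> sets borel"
  shows "hausdorff_outer DIM('a) A \<le> emeasure lborel A"
proof (rule hausdorff_outer_least, rule ennreal_le_epsilon)
  let ?k = "DIM('a)"
  fix \<delta> \<eta> :: real assume \<delta>: "0 < \<delta>" and \<eta>: "0 < \<eta>"
  obtain U where U: "open U" "A \<subseteq> U" "emeasure lebesgue (U - A) < \<eta>"
    using sets_lebesgue_outer_open[of A \<eta>] \<eta> by auto
  have "emeasure lborel U = emeasure lborel (A \<union> (U - A))" using U by (simp add: Un_absorb1)
  also have "\<dots> = emeasure lborel A + emeasure lborel (U - A)"
    using U by (intro plus_emeasure[symmetric]) auto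
  also have "\<dots> \<le> emeasure lborel A + \<eta>"
    using U by (intro add_left_mono) (auto)
  finally have eU: "emeasure lborel U \<le> emeasure lborel A + \<eta>" .
  define K where "K = {(x, r). x \<in> A \<and> 0 < r \<and> r \<le> \<delta> / 2 \<and> ball x r \<subseteq> U}"
  have cov: "\<exists>i. i \<in> K \<and> x \<in> ball (fst i) (snd i) \<and> snd i < d" if "x \<in> A" "0 < d" for x d
  proof -
    have "x \<in> U" using U(2) that(1) by (rule subsetD)
    then obtain e where e: "0 < e" "ball x e \<subseteq> U" using U(1) unfolding open_contains_ball by blast
    let ?r = "min (min e (\<delta> / 2)) (d / 2)"
    have "ball x ?r \<subseteq> ball x e" by (rule subset_ball) simp
    then have "ball x ?r \<subseteq> U" using e(2) by (rule subset_trans)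
    then have "(x, ?r) \<in> K" using e(1) \<delta> that unfolding K_def by simp
    then show ?thesis using that e(1) \<delta> by (intro exI[of _ "(x, ?r)"]) simp
  qed
  obtain C where C: "countable C" "C \<subseteq> K"
     "pairwise (\<lambda>i j. disjnt (ball (fst i) (snd i)) (ball (fst j) (snd j))) C"
     "negligible (A - (\<Union>i \<in> C. ball (fst i) (snd i)))"
    by (rule Vitali_covering_theorem_balls[OF cov])
  let ?B = "\<lambda>i. ball (fst i) (snd i)"
  have "hausdorff_pre ?k \<delta> A \<le> hausdorff_pre ?k \<delta> ((\<Union>i\<in>C. ?B i) \<union> (A - (\<Union>i\<in>C. ?B i)))"
    by (rule hausdorff_pre_mono) auto
  also have "\<dots> \<le> hausdorff_pre ?k \<delta> (\<Union>i\<in>C. ?B i) + hausdorff_pre ?k \<delta> (A - (\<Union>i\<in>C. ?B i))"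
    using \<delta> by (intro hausdorff_pre_Un) simp
  also have "hausdorff_pre ?k \<delta> (A - (\<Union>i\<in>C. ?B i)) = 0"
    using C \<delta> by (intro hausdorff_pre_negligible) auto
  also have "hausdorff_pre ?k \<delta> (\<Union>i\<in>C. ?B i) \<le> (\<integral>\<^sup>+i. hausdorff_weight ?k (?B i) \<partial>count_space C)"
  proof (rule hausdorff_pre_le_countable[OF C(1) order_refl])
    show "diameter (?B i) \<le> \<delta>" if "i \<in> C" for i
      using C(2) that \<delta> by (auto simp: diameter_ball K_def)
  qed (use \<delta> in auto)
  also have "\<dots> = (\<integral>\<^sup>+i. emeasure lborel (?B i) \<partial>count_space C)"
    using C(2) by (intro nn_integral_cong hausdorff_weight_ball) (auto simp: K_def)
  also have "\<dots> = emeasure lborel (\<Union>i\<in>C. ?B i)"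
    using C by (intro emeasure_UN_countable[symmetric])
       (auto simp: disjoint_family_on_def pairwise_def disjnt_def)
  also have "\<dots> \<le> emeasure lborel U"
  proof (rule emeasure_mono)
    have "?B i \<subseteq> U" if "i \<in> C" for i using subsetD[OF C(2) that] unfolding K_def by (simp add: case_prod_beta)
    then show "(\<Union>i\<in>C. ?B i) \<subseteq> U" by blast
  qed (use U in simp)
  also note eU
  finally show "hausdorff_pre ?k \<delta> A \<le> emeasure lborel A + \<eta>" by simp
qed

theorem hausdorff_outer_top_dimension:
  fixes A :: "'a::euclidean_space set"
  assumes "A \<in> sets borel"
  shows "hausdorff_outer DIM('a) A = emeasure lborel A"
  using assms by (intro antisym hausdorff_outer_le_emeasure emeasure_le_hausdorff_outer)

subsection \<open>Hausdorff measure on hyperplanes\<close>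

definition proj_perp :: "'a::euclidean_space \<Rightarrow> 'a \<Rightarrow> 'a" where
  "proj_perp e x = x - (x \<bullet> e) *\<^sub>R e"

definition cylinder :: "'a::euclidean_space \<Rightarrow> 'a set \<Rightarrow> 'a set" where
  "cylinder e B = {x \<in> slab e. proj_perp e x \<in> B}"

lemma continuous_proj_perp [continuous_intros]:
  "continuous_on A f \<Longrightarrow> continuous_on A (\<lambda>x. proj_perp e (f x))"
  unfolding proj_perp_def by (intro continuous_intros)

lemma proj_perp_measurable [measurable]: "proj_perp e \<in> borel_measurable borel"
  by (intro borel_measurable_continuous_onI continuous_intros)

lemma cylinder_borel [measurable]:
  assumes [measurable]: "B \<in> sets borel"
  shows "cylinder e B \<in> sets borel"
  unfolding cylinder_def by measurable

lemma hausdorff_outer_isometry: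
  assumes "\<And>x y. x \<in> A \<Longrightarrow> y \<in> A \<Longrightarrow> dist (f x) (f y) = dist x y"
  shows "hausdorff_outer k (f ` A) = hausdorff_outer k A"
proof (rule antisym)
  show "hausdorff_outer k (f ` A) \<le> hausdorff_outer k A"
    using hausdorff_outer_lipschitz_image[of 1 A f k] assms by simp
  have inj: "inj_on f A" using assms by (metis inj_onI dist_eq_0_iff)
  have "hausdorff_outer k (the_inv_into A f ` f ` A) \<le> ennreal (1 ^ k) * hausdorff_outer k (f ` A)"
    by (rule hausdorff_outer_lipschitz_image) (auto simp: the_inv_into_f_f inj assms)
  then show "hausdorff_outer k A \<le> hausdorff_outer k (f ` A)"
    using inj by simp
qed

text \<open>Hausdorff measure sees only the metric and agrees with Lebesgue measure on both sides.
  This compares Lebesgue measures on two different types of equal dimension, for maps that are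
  isometric merely on \<open>A\<close>.\<close>

lemma emeasure_lborel_isometry:
  fixes f :: "'a::euclidean_space \<Rightarrow> 'b::euclidean_space"
  assumes "DIM('a) = DIM('b)" "\<And>x y. x \<in> A \<Longrightarrow> y \<in> A \<Longrightarrow> dist (f x) (f y) = dist x y"
    "A \<in> sets borel" "f ` A \<in> sets borel"
  shows "emeasure lborel (f ` A) = emeasure lborel A"
  using hausdorff_outer_isometry[of A f "DIM('a)"] assms by (simp flip: hausdorff_outer_top_dimension)

text \<open>For d = 1, where the hyperplane is a single point.\<close>

lemma hausdorff_outer_0_singleton: "hausdorff_outer 0 {x} = 1"
proof (rule antisym)
  show "hausdorff_outer 0 {x} \<le> 1"
  proof (rule hausdorff_outer_least)
    fix \<delta> :: real assume "0 < \<delta>"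
    then have "hausdorff_pre 0 \<delta> {x} \<le> (\<Sum>i. hausdorff_weight 0 (if i = (0::nat) then {x} else {}))"
      by (intro hausdorff_pre_le) auto
    also have "\<dots> = 1" by (subst suminf_finite[of "{0}"]) (auto simp: hausdorff_weight_def)
    finally show "hausdorff_pre 0 \<delta> {x} \<le> 1" .
  qed
  have "1 \<le> hausdorff_pre 0 1 {x}"
    unfolding hausdorff_pre_def
  proof (rule INF_greatest, clarify)
    fix C :: "nat \<Rightarrow> 'a set" assume "{x} \<subseteq> (\<Union>i. C i)"
    then obtain i where "C i \<noteq> {}" by blast
    then have "1 = (\<Sum>i\<in>{i}. hausdorff_weight 0 (C i))" by (simp add: hausdorff_weight_def)
    also have "\<dots> \<le> (\<Sum>i. hausdorff_weight 0 (C i))" by (intro sum_le_suminf) auto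
    finally show "1 \<le> (\<Sum>i. hausdorff_weight 0 (C i))" .
  qed
  then show "1 \<le> hausdorff_outer 0 {x}"
    using hausdorff_pre_le_outer[of 1 0 "{x}"] by (rule order_trans) simp
qed

text \<open>The type \<open>'a\<close> is a model of the hyperplane: \<open>j\<close> embeds it
  isometrically, and \<open>\<iota>\<close> adds the coordinate along \<open>e\<close>. The measure
  of \<open>B\<close> is then that of a set \<open>B'\<close> in \<open>'a\<close>, hence of
  \<open>B'\<close> times the unit interval, hence of the cylinder.\<close>

lemma hausdorff_outer_hyperplane_aux:
  fixes e :: "'b::euclidean_space"
  assumes dim: "DIM('b) = DIM('a::euclidean_space) + 1" and e: "norm e = 1"
    and B: "B \<subseteq> {x. x \<bullet> e = 0}" "B \<in> sets borel"
  shows "hausdorff_outer (DIM('b) - 1) B = emeasure lborel (cylinder e B)"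
proof -
  have ee: "e \<bullet> e = 1" using e by (simp add: dot_square_norm)
  have "dim {x. e \<bullet> x = 0} = DIM('a)" using e dim by (subst dim_hyperplane) auto
  then have "dim (UNIV :: 'a set) = dim {x. e \<bullet> x = 0}" by simp
  then obtain j :: "'a \<Rightarrow> 'b" where j: "linear j" "j ` UNIV = {x. e \<bullet> x = 0}" "\<And>x. norm (j x) = norm x"
    by (rule isometries_subspaces[OF subspace_UNIV subspace_hyperplane]) auto
  have dj: "dist (j x) (j y) = dist x y" for x y
    using j(3)[of "x - y"] by (simp add: dist_norm linear_diff[OF j(1)])
  have je: "j x \<bullet> e = 0" for x using j(2) by (auto simp: inner_commute)
  have [measurable]: "j \<in> borel_measurable borel"
    using j(1) by (intro borel_measurable_continuous_onI linear_continuous_on) (simp add: linear_conv_bounded_linear)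
  define B' where "B' = j -` B"
  have B'[measurable]: "B' \<in> sets borel" 
    unfolding B'_def using measurable_sets[of j borel borel B] B(2) by simp
  have jB: "j ` B' = B" using B(1) j(2) by (fastforce simp: B'_def inner_commute)
  define \<iota> where "\<iota> p = j (fst p) + snd p *\<^sub>R e" for p :: "'a \<times> real"
  have "norm (\<iota> p) = norm p" for p
  proof -
    have "(norm (\<iota> p))\<^sup>2 = (norm (j (fst p)))\<^sup>2 + (norm (snd p *\<^sub>R e))\<^sup>2"
      unfolding \<iota>_def by (rule norm_add_Pythagorean) (simp add: orthogonal_def je)
    then show ?thesis using e j(3) by (simp add: norm_prod_def real_sqrt_unique)
  qed
  moreover have "\<iota> p - \<iota> q = \<iota> (p - q)" for p q
    by (simp add: \<iota>_def linear_diff[OF j(1)] algebra_simps)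
  ultimately have d\<iota>: "dist (\<iota> p) (\<iota> q) = dist p q" for p q by (simp add: dist_norm)
  have img: "\<iota> ` (B' \<times> {0..1}) = cylinder e B"
  proof (intro equalityI subsetI)
    fix x assume "x \<in> \<iota> ` (B' \<times> {0..1})"
    then show "x \<in> cylinder e B"
      by (auto simp: \<iota>_def cylinder_def slab_def proj_perp_def je ee inner_add_left B'_def)
  next
    fix x assume x: "x \<in> cylinder e B"
    then obtain w where "w \<in> B'" "proj_perp e x = j w" using jB by (auto simp: cylinder_def)
    then have "x = \<iota> (w, x \<bullet> e)" by (simp add: \<iota>_def proj_perp_def) (metis diff_add_cancel)
    then show "x \<in> \<iota> ` (B' \<times> {0..1})" using x \<open>w \<in> B'\<close> by (auto simp: cylinder_def slab_def)
  qed
  have "hausdorff_outer (DIM('b) - 1) B = emeasure lborel B'"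
    using hausdorff_outer_isometry[of B' j "DIM('a)"] dj dim by (simp add: jB hausdorff_outer_top_dimension)
  also have "\<dots> = emeasure (lborel \<Otimes>\<^sub>M lborel) (B' \<times> {0..1::real})"
    by (subst lborel.emeasure_pair_measure_Times) auto
  also have "\<dots> = emeasure lborel (B' \<times> {0..1::real})" by (simp add: lborel_prod)
  also have "\<dots> = emeasure lborel (\<iota> ` (B' \<times> {0..1}))"
  proof (rule emeasure_lborel_isometry[symmetric])
    show "\<iota> ` (B' \<times> {0..1}) \<in> sets borel" unfolding img using B(2) by measurable
    show "B' \<times> {0..1::real} \<in> sets borel" using B' by (auto simp: borel_prod[symmetric])
  qed (simp_all add: dim d\<iota>)
  finally show ?thesis by (simp add: img)
qed

text \<open>The hyperplane is {0}, and the cylinder over it is a segment of length 1, in agreement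
  with counting measure.\<close>

lemma hausdorff_outer_hyperplane_1:
  fixes e :: "'b::euclidean_space"
  assumes dim: "DIM('b) = 1" and e: "norm e = 1" and B: "B \<subseteq> {x. x \<bullet> e = 0}"
  shows "hausdorff_outer (DIM('b) - 1) B = emeasure lborel (cylinder e B)"
proof -
  have ee: "e \<bullet> e = 1" using e by (simp add: dot_square_norm)
  have "dim {x. e \<bullet> x = 0} = 0" using e dim by (subst dim_hyperplane) auto
  then have 0: "{x. x \<bullet> e = 0} \<subseteq> {0}" by (simp add: inner_commute)
  have P0: "proj_perp e x = 0" for x
  proof -
    have "proj_perp e x \<bullet> e = 0" using ee by (simp add: proj_perp_def inner_diff_left)
    then show ?thesis using 0 by blast
  qed
  show ?thesis
  proof (cases "B = {}")
    case True then show ?thesis by (simp add: cylinder_def)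
  next
    case False
    then have B0: "B = {0}" using B 0 by blast
    have "cylinder e B = (\<lambda>t. t *\<^sub>R e) ` {0..1}"
    proof (intro equalityI subsetI)
      fix x assume "x \<in> cylinder e B"
      moreover have "x = (x \<bullet> e) *\<^sub>R e" using P0[of x] by (simp add: proj_perp_def)
      ultimately show "x \<in> (\<lambda>t. t *\<^sub>R e) ` {0..1}" by (auto simp: cylinder_def slab_def)
    qed (auto simp: cylinder_def slab_def ee B0 P0)
    moreover have "emeasure lborel ((\<lambda>t. t *\<^sub>R e) ` {0..1}) = emeasure lborel {0..1::real}"
    proof (rule emeasure_lborel_isometry)
      show "(\<lambda>t. t *\<^sub>R e) ` {0..1} \<in> sets borel"
        by (intro borel_compact compact_continuous_image continuous_intros) auto
      show "dist (x *\<^sub>R e) (y *\<^sub>R e) = dist x y" for x y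
        using e by (simp add: dist_norm scaleR_diff_left[symmetric])
    qed (simp_all add: dim)
    ultimately show ?thesis by (simp add: B0 dim hausdorff_outer_0_singleton)
  qed
qed

text \<open>An index type with one element less, so that $\mathbb{R}^{d-1}$ is a Euclidean space type
  whenever $d \geq 2$.\<close>

typedef ('d::finite) pred = "if CARD('d) = 1 then UNIV else UNIV - {undefined :: 'd}"
proof -
  \<comment> \<open>For a single index, removing it would leave an empty type; the branch
    \<open>UNIV\<close> is a placeholder.\<close>
  have "UNIV - {undefined :: 'd} \<noteq> {}" if "CARD('d) \<noteq> 1"
  proof
    assume "UNIV - {undefined :: 'd} = {}"
    then have "(UNIV :: 'd set) = {undefined}" by auto
    then have "CARD('d) = card {undefined :: 'd}" by (rule arg_cong)
    then show False using that by simp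
  qed
  then show ?thesis by auto
qed

instance pred :: (finite) finite
proof
  have "range (Rep_pred :: 'a pred \<Rightarrow> 'a) \<subseteq> UNIV" "inj (Rep_pred :: 'a pred \<Rightarrow> 'a)"
    by (auto simp: inj_def Rep_pred_inject)
  then show "finite (UNIV :: 'a pred set)" by (metis finite_code finite_imageD)
qed

lemma card_pred: "CARD('d::finite) \<noteq> 1 \<Longrightarrow> CARD('d) = CARD('d pred) + 1"
proof -
  assume "CARD('d) \<noteq> 1"
  moreover have "CARD('d pred) = card (if CARD('d) = 1 then UNIV else UNIV - {undefined :: 'd})"
    by (rule type_definition.card[OF type_definition_pred])
  moreover have "0 < CARD('d)" by (rule zero_less_card_finite)
  ultimately show ?thesis by (simp add: card_Diff_singleton)
qed

theorem hausdorff_outer_hyperplane: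
  fixes e :: "real ^ 'd"
  assumes e: "norm e = 1" and B: "B \<subseteq> {x. x \<bullet> e = 0}" "B \<in> sets borel"
  shows "hausdorff_outer (CARD('d) - 1) B = emeasure lborel (cylinder e B)"
proof (cases "CARD('d) = 1")
  case True
  then show ?thesis using hausdorff_outer_hyperplane_1[OF _ e B(1)] by simp
next
  case False
  then show ?thesis
    using hausdorff_outer_hyperplane_aux[where 'a = "real ^ 'd pred", OF _ e B] card_pred[where 'd = 'd] by simp
qed

subsection \<open>The area formula for graphs\<close>

text \<open>The Sherman-Morrison formula for the inverse of I + u v^T. Written as a preimage, the
  image of a Borel set is visibly Borel.\<close>

lemma rank_one_update_inverse:
  fixes u v :: "'a::euclidean_space"
  assumes "1 + u \<bullet> v \<noteq> 0"
  shows "(\<lambda>x. x + (v \<bullet> x) *\<^sub>R u) ` S = {y. y - ((v \<bullet> y) / (1 + u \<bullet> v)) *\<^sub>R u \<in> S}"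
proof (intro equalityI subsetI)
  fix y assume "y \<in> (\<lambda>x. x + (v \<bullet> x) *\<^sub>R u) ` S"
  then obtain x where x: "x \<in> S" "y = x + (v \<bullet> x) *\<^sub>R u" by blast
  have "v \<bullet> y = (1 + u \<bullet> v) * (v \<bullet> x)"
    by (simp add: x inner_add_right inner_commute[of v u] algebra_simps)
  then show "y \<in> {y. y - ((v \<bullet> y) / (1 + u \<bullet> v)) *\<^sub>R u \<in> S}"
    using x assms by simp
next
  fix y assume y: "y \<in> {y. y - ((v \<bullet> y) / (1 + u \<bullet> v)) *\<^sub>R u \<in> S}"
  define x where "x = y - ((v \<bullet> y) / (1 + u \<bullet> v)) *\<^sub>R u"
  have "v \<bullet> x = (v \<bullet> y) / (1 + u \<bullet> v)"
    using assms by (simp add: x_def inner_diff_right inner_commute[of v u] field_simps)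
  then have "y = x + (v \<bullet> x) *\<^sub>R u" by (simp add: x_def)
  moreover have "x \<in> S" using y by (simp add: x_def)
  ultimately show "y \<in> (\<lambda>x. x + (v \<bullet> x) *\<^sub>R u) ` S" by (rule image_eqI)
qed

text \<open>The matrix determinant lemma det(I + u v^T) = 1 + u.v, proved without determinants: the
  map moves points only along \<open>u\<close>, and on each line in that direction it is affine with
  slope 1 + u.v.\<close>

lemma emeasure_rank_one_update:
  fixes u v :: "'a::euclidean_space"
  assumes c: "1 + u \<bullet> v \<noteq> 0" and S[measurable]: "S \<in> sets borel"
  shows "emeasure lborel ((\<lambda>x. x + (v \<bullet> x) *\<^sub>R u) ` S) = ennreal \<bar>1 + u \<bullet> v\<bar> * emeasure lborel S"
proof (cases "u = 0")
  case False
  let ?T = "\<lambda>x. x + (v \<bullet> x) *\<^sub>R u" and ?c = "1 + u \<bullet> v"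
  have TS[measurable]: "?T ` S \<in> sets borel"
    unfolding rank_one_update_inverse[OF c] by measurable
  define e where "e = (1 / norm u) *\<^sub>R u"
  have e: "norm e = 1" using False by (simp add: e_def)
  have ue: "u = norm u *\<^sub>R e" using False by (simp add: e_def)
  have line: "?T (x + t *\<^sub>R e) = x + ((v \<bullet> x) * norm u + ?c * t) *\<^sub>R e" for x t
  proof -
    have "(v \<bullet> e) * norm u = u \<bullet> v" using False by (simp add: e_def inner_commute)
    then have "(v \<bullet> (x + t *\<^sub>R e)) * norm u = (v \<bullet> x) * norm u + t * (u \<bullet> v)"
      by (simp add: inner_add_right algebra_simps)
    then have "(v \<bullet> (x + t *\<^sub>R e)) *\<^sub>R u = ((v \<bullet> x) * norm u + t * (u \<bullet> v)) *\<^sub>R e"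
      by (metis ue scaleR_scaleR)
    then show ?thesis by (simp add: algebra_simps)
  qed
  have inj: "inj ?T"
  proof (rule injI)
    fix x y assume "?T x = ?T y"
    then have "?T x \<in> ?T ` {y}" by blast
    moreover have "?T x \<in> ?T ` {x}" by blast
    ultimately show "x = y" unfolding rank_one_update_inverse[OF c] by simp
  qed
  have mem: "indicator (?T ` S) (?T z) = indicator S z" for z
    unfolding indicator_def inj_image_mem_iff[OF inj] ..
  have "emeasure lborel (?T ` S) = (\<integral>\<^sup>+x. indicator (?T ` S) x \<partial>lborel)" by simp
  also have "\<dots> = (\<integral>\<^sup>+x. indicator (slab e) x * (\<integral>\<^sup>+t. indicator (?T ` S) (x + t *\<^sub>R e) \<partial>lborel) \<partial>lborel)"
    by (rule nn_integral_fibre[symmetric, OF _ e]) measurable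
  also have "\<dots> = (\<integral>\<^sup>+x. ennreal \<bar>?c\<bar> * (indicator (slab e) x * (\<integral>\<^sup>+t. indicator S (x + t *\<^sub>R e) \<partial>lborel)) \<partial>lborel)"
  proof (rule nn_integral_cong)
    fix x :: 'a
    have "(\<integral>\<^sup>+t. indicator (?T ` S) (x + t *\<^sub>R e) \<partial>lborel)
        = ennreal \<bar>?c\<bar> * (\<integral>\<^sup>+t. indicator (?T ` S) (x + ((v \<bullet> x) * norm u + ?c * t) *\<^sub>R e) \<partial>lborel)"
      using c by (intro nn_integral_real_affine) measurable
    also have "(\<integral>\<^sup>+t. indicator (?T ` S) (x + ((v \<bullet> x) * norm u + ?c * t) *\<^sub>R e) \<partial>lborel)
        = (\<integral>\<^sup>+t. indicator S (x + t *\<^sub>R e) \<partial>lborel)"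
      unfolding line[symmetric] mem ..
    finally show "indicator (slab e) x * (\<integral>\<^sup>+t. indicator (?T ` S) (x + t *\<^sub>R e) \<partial>lborel)
        = ennreal \<bar>?c\<bar> * (indicator (slab e) x * (\<integral>\<^sup>+t. indicator S (x + t *\<^sub>R e) \<partial>lborel))"
      by (simp add: mult.left_commute)
  qed
  also have "\<dots> = ennreal \<bar>?c\<bar> * (\<integral>\<^sup>+x. indicator S x \<partial>lborel)"
    by (subst nn_integral_cmult) (auto simp: nn_integral_fibre[OF _ e])
  finally show ?thesis by simp
qed simp

lemma ennreal_le_of_scaled:
  fixes x y :: ennreal
  assumes "\<And>\<eta>. 0 < \<eta> \<Longrightarrow> x \<le> ennreal ((1 + \<eta>) ^ n) * y"
  shows "x \<le> y"
proof (cases "y = top")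
  case False
  then obtain s where s: "0 \<le> s" "y = ennreal s" by (cases y) auto
  have le: "x \<le> ennreal ((1 + \<eta>) ^ n * s)" if "0 < \<eta>" for \<eta>
    using assms[OF that] that s by (simp add: ennreal_mult)
  then have "x \<noteq> top" using le[of 1] by (auto simp: top_unique)
  then obtain r where r: "0 \<le> r" "x = ennreal r" by (cases x) auto
  have ev: "\<forall>\<^sub>F \<eta> in at_right 0. r \<le> (1 + \<eta>) ^ n * s"
    using le r s by (auto simp: eventually_at_right_field intro!: exI[of _ 1])
  have "((\<lambda>\<eta>::real. (1 + \<eta>) ^ n * s) \<longlongrightarrow> (1 + 0) ^ n * s) (at_right 0)"
    by (intro tendsto_intros)
  then have "r \<le> (1 + 0) ^ n * s" using ev by (intro tendsto_lowerbound) auto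
  then show ?thesis using r s by (simp add: ennreal_leI)
qed simp

text \<open>The graph of \<open>g\<close> over the hyperplane orthogonal to \<open>e\<close>, where \<open>g\<close> is extended to the whole
  space as a function that is constant along \<open>e\<close>.\<close>

locale C1_graph =
  fixes e :: "real ^ 'd" and g :: "real ^ 'd \<Rightarrow> real" and a :: "real ^ 'd \<Rightarrow> real ^ 'd"
  assumes norm_e: "norm e = 1"
    and deriv_g: "\<And>x. (g has_derivative (\<lambda>v. a x \<bullet> v)) (at x)"
    and cont_a: "continuous_on UNIV a"
    and g_along: "\<And>x t. g (x + t *\<^sub>R e) = g x"
begin

lemma ee [simp]: "e \<bullet> e = 1" using norm_e by (simp add: dot_square_norm)

lemma cont_g: "continuous_on A g"
  using deriv_g has_derivative_continuous by (blast intro: continuous_at_imp_continuous_on)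

lemma a_e [simp]: "a x \<bullet> e = 0" "e \<bullet> a x = 0"
proof -
  have "((\<lambda>t. g (x + t *\<^sub>R e)) has_derivative (\<lambda>t. a x \<bullet> (t *\<^sub>R e))) (at 0)"
    by (rule has_derivative_compose[where g = g, OF _ has_derivative_eq_rhs[OF deriv_g]])
       (auto intro!: derivative_eq_intros)
  moreover have "((\<lambda>t. g (x + t *\<^sub>R e)) has_derivative (\<lambda>t::real. 0)) (at 0)"
    by (simp add: g_along)
  ultimately have "(\<lambda>t. a x \<bullet> (t *\<^sub>R e)) = (\<lambda>t::real. 0)" by (rule has_derivative_unique)
  from fun_cong[OF this, of 1] show "a x \<bullet> e = 0" by simp
  then show "e \<bullet> a x = 0" by (simp add: inner_commute)
qed

lemma a_along: "a (x + t *\<^sub>R e) = a x"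
proof -
  have "((\<lambda>y. g (y + t *\<^sub>R e)) has_derivative (\<lambda>v. a (x + t *\<^sub>R e) \<bullet> v)) (at x)"
    by (rule has_derivative_compose[where g = g, OF _ deriv_g]) (auto intro!: derivative_eq_intros)
  then have "(g has_derivative (\<lambda>v. a (x + t *\<^sub>R e) \<bullet> v)) (at x)" by (simp add: g_along)
  then have "(\<lambda>v. a (x + t *\<^sub>R e) \<bullet> v) = (\<lambda>v. a x \<bullet> v)"
    using deriv_g by (rule has_derivative_unique)
  then show ?thesis by (metis vector_eq_rdot inner_commute)
qed

definition graph_of :: "(real ^ 'd) set" where
  "graph_of = {x. x \<bullet> e = g x}"

definition lift_graph :: "real ^ 'd \<Rightarrow> real ^ 'd" where
  "lift_graph x = proj_perp e x + g x *\<^sub>R e"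

text \<open>The surface element of the graph, \<open>a\<close> being the gradient of
  \<open>g\<close>.\<close>

definition area_factor :: "real ^ 'd \<Rightarrow> real" where
  "area_factor x = sqrt (1 + (norm (a x))\<^sup>2)"

text \<open>The surface measure in graph coordinates. The slab may replace the hyperplane because
  \<open>lift_graph\<close> and \<open>area_factor\<close> are constant along \<open>e\<close>, so
  the additional direction contributes the factor 1.\<close>

definition graph_measure :: "(real ^ 'd) measure" where
  "graph_measure = distr (density lborel (\<lambda>x. indicator (slab e) x * ennreal (area_factor x))) borel lift_graph"

lemma proj_e [simp]: "proj_perp e x \<bullet> e = 0"
  by (simp add: proj_perp_def inner_diff_left)

lemma g_proj [simp]: "g (proj_perp e x) = g x" and a_proj [simp]: "a (proj_perp e x) = a x"
  using g_along[of x "- (x \<bullet> e)"] a_along[of x "- (x \<bullet> e)"] by (simp_all add: proj_perp_def)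

lemma proj_add [simp]: "proj_perp e (x + t *\<^sub>R e) = proj_perp e x"
  by (simp add: proj_perp_def inner_add_left algebra_simps)

lemma proj_proj [simp]: "proj_perp e (proj_perp e x) = proj_perp e x"
  using proj_e[of x] by (simp add: proj_perp_def[of e "proj_perp e x"])

lemma proj_id: "x \<bullet> e = 0 \<Longrightarrow> proj_perp e x = x"
  by (simp add: proj_perp_def)

lemma area_proj [simp]: "area_factor (proj_perp e x) = area_factor x"
  by (simp add: area_factor_def)

lemma area_pos: "0 < area_factor x" by (simp add: area_factor_def add_pos_nonneg)

lemma lift_proj [simp]: "lift_graph (proj_perp e x) = lift_graph x"
  and proj_lift [simp]: "proj_perp e (lift_graph x) = proj_perp e x"
  by (simp_all add: lift_graph_def)

lemma lift_e [simp]: "lift_graph x \<bullet> e = g x"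
  by (simp add: lift_graph_def inner_add_left)

lemma g_lift [simp]: "g (lift_graph x) = g x" and a_lift [simp]: "a (lift_graph x) = a x"
  by (simp_all add: lift_graph_def g_along a_along)

lemma lift_in_graph: "lift_graph x \<in> graph_of" by (simp add: graph_of_def)

lemma lift_id: "x \<in> graph_of \<Longrightarrow> lift_graph x = x"
  by (simp add: graph_of_def lift_graph_def proj_perp_def)

lemma cont_lift: "continuous_on A lift_graph"
  unfolding lift_graph_def by (intro continuous_intros cont_g)

lemma cont_area: "continuous_on A area_factor"
  unfolding area_factor_def by (intro continuous_intros continuous_on_subset[OF cont_a] subset_UNIV)

lemma lift_measurable [measurable]: "lift_graph \<in> borel_measurable borel"
  by (rule borel_measurable_continuous_onI[OF cont_lift])

lemma area_measurable [measurable]: "area_factor \<in> borel_measurable borel"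
  by (rule borel_measurable_continuous_onI[OF cont_area])

lemma closed_graph: "closed graph_of"
  unfolding graph_of_def by (intro closed_Collect_eq continuous_intros cont_g)

lemma graph_borel [measurable]: "graph_of \<in> sets borel" using closed_graph by (rule borel_closed)

lemma emeasure_graph_measure:
  assumes [measurable]: "A \<in> sets borel"
  shows "emeasure graph_measure A
    = (\<integral>\<^sup>+x. indicator (slab e) x * ennreal (area_factor x) * indicator A (lift_graph x) \<partial>lborel)"
proof -
  have "emeasure graph_measure A = (\<integral>\<^sup>+x. indicator A x \<partial>graph_measure)"
    by (subst nn_integral_indicator) (auto simp: graph_measure_def)
  also have "\<dots> = (\<integral>\<^sup>+x. indicator A (lift_graph x)
      \<partial>density lborel (\<lambda>x. indicator (slab e) x * ennreal (area_factor x)))"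
    unfolding graph_measure_def by (rule nn_integral_distr) measurable
  also have "\<dots> = (\<integral>\<^sup>+x. indicator (slab e) x * ennreal (area_factor x) * indicator A (lift_graph x) \<partial>lborel)"
    by (rule nn_integral_density) measurable
  finally show ?thesis .
qed

text \<open>Near \<open>p\<close>, the vertical projection of the graph to its tangent hyperplane is almost an isometry,
  and it factors the lift through a linear map \<open>L\<close>.\<close>

lemma local_area:
  assumes \<eta>: "0 < \<eta>"
  obtains \<rho> where "0 < \<rho>"
    "\<And>A. A \<in> sets borel \<Longrightarrow> A \<subseteq> graph_of \<Longrightarrow> proj_perp e ` A \<subseteq> ball p \<rho> \<Longrightarrow>
      hausdorff_outer (CARD('d) - 1) A \<le> ennreal ((1 + \<eta>) ^ CARD('d)) * emeasure graph_measure A \<and>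
      emeasure graph_measure A \<le> ennreal ((1 + \<eta>) ^ CARD('d)) * hausdorff_outer (CARD('d) - 1) A"
proof -
  let ?k = "CARD('d) - 1"
  have cd: "CARD('d) = Suc ?k" by simp
  define J where "J = area_factor p"
  have J0: "0 < J" by (simp add: J_def area_pos)
  have contJ: "isCont area_factor p" and conta: "isCont a p"
    using cont_area[of UNIV] cont_a by (auto simp only: continuous_on_eq_continuous_at open_UNIV)
  have "\<forall>\<^sub>F x in nhds p. dist (a x) (a p) < \<eta> \<and> area_factor x < (1 + \<eta>) * J \<and> J / (1 + \<eta>) < area_factor x"
  proof (intro eventually_conj)
    show "\<forall>\<^sub>F x in nhds p. dist (a x) (a p) < \<eta>"
      using conta \<eta> by (simp add: continuous_within tendsto_at_iff_tendsto_nhds tendstoD)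
    have t: "(area_factor \<longlongrightarrow> J) (nhds p)"
      using contJ by (simp add: J_def continuous_within tendsto_at_iff_tendsto_nhds)
    show "\<forall>\<^sub>F x in nhds p. area_factor x < (1 + \<eta>) * J"
      by (rule order_tendstoD(2)[OF t]) (use \<eta> J0 in \<open>auto simp: field_simps\<close>)
    show "\<forall>\<^sub>F x in nhds p. J / (1 + \<eta>) < area_factor x"
      by (rule order_tendstoD(1)[OF t]) (use \<eta> J0 in \<open>auto simp: field_simps\<close>)
  qed
  then obtain \<rho> where \<rho>: "0 < \<rho>" "\<And>x. x \<in> ball p \<rho> \<Longrightarrow> dist (a x) (a p) < \<eta>"
    "\<And>x. x \<in> ball p \<rho> \<Longrightarrow> area_factor x < (1 + \<eta>) * J"
    "\<And>x. x \<in> ball p \<rho> \<Longrightarrow> J / (1 + \<eta>) < area_factor x"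
    unfolding eventually_nhds_metric by (auto simp: dist_commute)
  \<comment> \<open>The mean value inequality for \<open>g\<close> minus its linearisation at
    \<open>p\<close>; on the ball the gradient varies by less than \<eta>.\<close>
  have lin_g: "\<bar>g x - g y - a p \<bullet> (x - y)\<bar> \<le> \<eta> * norm (x - y)" if "x \<in> ball p \<rho>" "y \<in> ball p \<rho>" for x y
  proof -
    have "norm ((g x - a p \<bullet> x) - (g y - a p \<bullet> y)) \<le> \<eta> * norm (x - y)"
    proof (rule differentiable_bound[where f' = "\<lambda>z v. (a z - a p) \<bullet> v"])
      show "convex (ball p \<rho>)" by simp
      show "((\<lambda>z. g z - a p \<bullet> z) has_derivative (\<lambda>v. (a z - a p) \<bullet> v)) (at z within ball p \<rho>)" for z
        by (rule has_derivative_eq_rhs[OF has_derivative_diff[OF has_derivative_at_withinI[OF deriv_g]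
              has_derivative_inner_right[OF has_derivative_ident]]]) (simp add: inner_diff_left fun_eq_iff)
      show "onorm (\<lambda>v. (a z - a p) \<bullet> v) \<le> \<eta>" if "z \<in> ball p \<rho>" for z
      proof (rule onorm_le)
        fix v
        have "\<bar>(a z - a p) \<bullet> v\<bar> \<le> norm (a z - a p) * norm v" by (rule Cauchy_Schwarz_ineq2)
        also have "\<dots> \<le> \<eta> * norm v" using \<rho>(2)[OF that] by (intro mult_right_mono) (auto simp: dist_norm)
        finally show "norm ((a z - a p) \<bullet> v) \<le> \<eta> * norm v" by simp
      qed
    qed (use that in auto)
    then show ?thesis by (simp add: inner_diff_right algebra_simps)
  qed
  \<comment> \<open>Unit normal of the tangent hyperplane; the length of the vector normalised here
    is exactly the area factor at \<open>p\<close>.\<close>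
  define \<nu> where "\<nu> = (1 / J) *\<^sub>R (a p - e)"
  have nu2: "(norm (a p - e))\<^sup>2 = J\<^sup>2"
    by (simp add: J_def area_factor_def power2_norm_eq_inner inner_diff_left inner_diff_right)
  then have "norm (a p - e) = J" using J0 by (simp add: power2_eq_iff_nonneg)
  then have n\<nu>: "norm \<nu> = 1" using J0 by (simp add: \<nu>_def)
  have \<nu>\<nu>: "\<nu> \<bullet> \<nu> = 1" using n\<nu> by (simp add: dot_square_norm)
  have \<nu>e: "\<nu> \<bullet> e = - 1 / J" by (simp add: \<nu>_def inner_diff_left)
  \<comment> \<open>Vertical motion from the hyperplane orthogonal to \<open>e\<close> onto the one
    orthogonal to \<nu>.\<close>
  define L where "L x = x + (a p \<bullet> x) *\<^sub>R e" for x
  have L_diff: "L x - L y = L (x - y)" for x y by (simp add: L_def inner_diff_right algebra_simps)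
  have L\<nu>: "L x \<bullet> \<nu> = 0" if "x \<bullet> e = 0" for x
    using that by (simp add: L_def \<nu>_def inner_add_left inner_add_right inner_diff_right inner_diff_left inner_commute)
  have projL: "proj_perp e (L x) = proj_perp e x" for x by (simp add: L_def)
  \<comment> \<open>\<open>L\<close> on the hyperplane, extended by sending \<open>e\<close> to
    \<nu>, so that unit cylinders go to unit cylinders. As a product of two rank-one updates with
    factors 1 and - J it scales volume by J.\<close>
  define M where "M x = L (proj_perp e x) + (x \<bullet> e) *\<^sub>R \<nu>" for x
  have M_eq: "M = (\<lambda>y. y + ((- J *\<^sub>R \<nu>) \<bullet> y) *\<^sub>R (\<nu> - e)) \<circ> (\<lambda>x. x + (a p \<bullet> x) *\<^sub>R e)"
  proof
    fix x
    have "(a p - e) \<bullet> (x + (a p \<bullet> x) *\<^sub>R e) = - (x \<bullet> e)"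
      by (simp add: inner_add_right inner_diff_left inner_commute[of e x])
    then have "\<nu> \<bullet> (x + (a p \<bullet> x) *\<^sub>R e) = - (x \<bullet> e) / J"
      by (simp add: \<nu>_def)
    then have h: "(- J *\<^sub>R \<nu>) \<bullet> (x + (a p \<bullet> x) *\<^sub>R e) = x \<bullet> e"
      using J0 by (simp only: inner_scaleR_left) simp
    have "M x = (x + (a p \<bullet> x) *\<^sub>R e) + (x \<bullet> e) *\<^sub>R (\<nu> - e)"
      by (simp add: M_def L_def proj_perp_def inner_diff_right algebra_simps)
    then show "M x = ((\<lambda>y. y + ((- J *\<^sub>R \<nu>) \<bullet> y) *\<^sub>R (\<nu> - e)) \<circ> (\<lambda>x. x + (a p \<bullet> x) *\<^sub>R e)) x"
      by (simp only: o_def h)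
  qed
  have volM: "emeasure lborel (M ` S) = ennreal J * emeasure lborel S" if [measurable]: "S \<in> sets borel" for S
  proof -
    let ?S = "(\<lambda>x. x + (a p \<bullet> x) *\<^sub>R e) ` S"
    have 1: "1 + e \<bullet> a p \<noteq> 0" by simp
    have c2: "1 + (\<nu> - e) \<bullet> (- J *\<^sub>R \<nu>) = - J"
      using J0 \<nu>e \<nu>\<nu> by (simp add: inner_diff_left inner_commute[of e \<nu>] algebra_simps)
    then have 2: "1 + (\<nu> - e) \<bullet> (- J *\<^sub>R \<nu>) \<noteq> 0" using J0 by simp
    have [measurable]: "?S \<in> sets borel" unfolding rank_one_update_inverse[OF 1] by measurable
    have "M ` S = (\<lambda>y. y + ((- J *\<^sub>R \<nu>) \<bullet> y) *\<^sub>R (\<nu> - e)) ` ?S" unfolding M_eq image_comp ..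
    then have "emeasure lborel (M ` S) = ennreal \<bar>- J\<bar> * emeasure lborel ?S"
      using emeasure_rank_one_update[OF 2, of ?S] unfolding c2 by simp
    also have "emeasure lborel ?S = emeasure lborel S"
      using emeasure_rank_one_update[OF 1, of S] by simp
    finally show ?thesis using J0 by simp
  qed
  show thesis
  proof (rule that[OF \<rho>(1)])
    fix A assume A[measurable]: "A \<in> sets borel" and Ag: "A \<subseteq> graph_of" and Ap: "proj_perp e ` A \<subseteq> ball p \<rho>"
    let ?c = "ennreal ((1 + \<eta>) ^ ?k)"
    define W where "W = proj_perp e ` A"
    have W_eq: "W = {w. w \<bullet> e = 0 \<and> lift_graph w \<in> A}"
      using Ag lift_id by (auto simp: W_def image_iff) (metis proj_id proj_lift)
    have W[measurable]: "W \<in> sets borel" unfolding W_eq by measurable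
    have We: "\<And>w. w \<in> W \<Longrightarrow> w \<bullet> e = 0" by (auto simp: W_def)
    have Wp: "W \<subseteq> ball p \<rho>" using Ap by (simp add: W_def)
    have AW: "A = lift_graph ` W" using Ag lift_id by (force simp: W_def image_image)
    have LW_eq: "L ` W = {y. y \<bullet> \<nu> = 0 \<and> proj_perp e y \<in> W}"
    proof (intro equalityI subsetI)
      fix y assume "y \<in> L ` W"
      then show "y \<in> {y. y \<bullet> \<nu> = 0 \<and> proj_perp e y \<in> W}"
        using L\<nu> We projL proj_id by auto
    next
      fix y assume "y \<in> {y. y \<bullet> \<nu> = 0 \<and> proj_perp e y \<in> W}"
      then have y: "y \<bullet> \<nu> = 0" "proj_perp e y \<in> W" by auto
      then have "a p \<bullet> y = y \<bullet> e" using J0 by (simp add: \<nu>_def inner_diff_right inner_commute)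
      then have "y = L (proj_perp e y)" by (simp add: L_def proj_perp_def inner_diff_right)
      then show "y \<in> L ` W" using y(2) by blast
    qed
    have LW[measurable]: "L ` W \<in> sets borel" unfolding LW_eq by measurable
    have near: "norm (lift_graph x - lift_graph y - L (x - y)) \<le> \<eta> * norm (x - y)" if "x \<in> W" "y \<in> W" for x y
    proof -
      have "lift_graph x - lift_graph y - L (x - y) = (g x - g y - a p \<bullet> (x - y)) *\<^sub>R e"
        using We that by (simp add: lift_graph_def proj_id L_def algebra_simps)
      moreover have "x \<in> ball p \<rho>" "y \<in> ball p \<rho>" using that Wp by blast+
      ultimately show ?thesis using lin_g[of x y] norm_e by (simp del: mem_ball)
    qed
    \<comment> \<open>Vertical motion cannot shorten horizontal vectors. Hence the error, which is
      measured against the horizontal distance, is also small against distances on the graph and on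
      the tangent hyperplane.\<close>
    have normz: "norm z \<le> norm (z + s *\<^sub>R e)" if "z \<bullet> e = 0" for z s
    proof -
      have "(norm z)\<^sup>2 \<le> (norm (z + s *\<^sub>R e))\<^sup>2"
        using that by (simp add: power2_norm_eq_inner inner_add_left inner_add_right inner_commute)
      then show ?thesis by (rule power2_le_imp_le) simp
    qed
    have lip1: "dist (lift_graph x) (lift_graph y) \<le> (1 + \<eta>) * dist (L x) (L y)" if "x \<in> W" "y \<in> W" for x y
    proof -
      have "norm (lift_graph x - lift_graph y) \<le> norm (L (x - y)) + \<eta> * norm (x - y)"
        using near[OF that] norm_triangle_ineq2[of "lift_graph x - lift_graph y" "L (x - y)"] by linarith
      also have "norm (x - y) \<le> norm (L (x - y))"
        unfolding L_def using We that by (intro normz) (simp add: inner_diff_left)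
      finally show ?thesis using \<eta> by (simp add: dist_norm L_diff algebra_simps)
    qed
    have lip2: "dist (L x) (L y) \<le> (1 + \<eta>) * dist (lift_graph x) (lift_graph y)" if "x \<in> W" "y \<in> W" for x y
    proof -
      have "norm (L (x - y)) \<le> norm (lift_graph x - lift_graph y) + \<eta> * norm (x - y)"
        using near[OF that] norm_triangle_ineq3[of "lift_graph x - lift_graph y" "L (x - y)"] by linarith
      also have "norm (x - y) \<le> norm (lift_graph x - lift_graph y)"
      proof -
        have "lift_graph x - lift_graph y = (x - y) + (g x - g y) *\<^sub>R e"
          using We that by (simp add: lift_graph_def proj_id algebra_simps)
        then show ?thesis using We that normz[of "x - y" "g x - g y"] by (simp add: inner_diff_left)
      qed
      finally show ?thesis using \<eta> by (simp add: dist_norm L_diff algebra_simps)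
    qed
    have "A = (\<lambda>y. lift_graph (proj_perp e y)) ` L ` W"
      unfolding AW image_image projL unfolding lift_proj ..
    moreover have liftL: "lift_graph (L x) = lift_graph x" for x by (metis lift_proj projL)
    have "hausdorff_outer ?k ((\<lambda>y. lift_graph (proj_perp e y)) ` L ` W) \<le> ?c * hausdorff_outer ?k (L ` W)"
      by (rule hausdorff_outer_lipschitz_image) (use \<eta> lip1 in \<open>auto simp: liftL\<close>)
    ultimately have le1: "hausdorff_outer ?k A \<le> ?c * hausdorff_outer ?k (L ` W)" by simp
    have "L ` W = (\<lambda>y. L (proj_perp e y)) ` A"
      unfolding AW image_image using We by (auto simp: proj_id)
    moreover have "hausdorff_outer ?k ((\<lambda>y. L (proj_perp e y)) ` A) \<le> ?c * hausdorff_outer ?k A"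
      by (rule hausdorff_outer_lipschitz_image) (use \<eta> lip2 We proj_id in \<open>auto simp: AW\<close>)
    ultimately have le2: "hausdorff_outer ?k (L ` W) \<le> ?c * hausdorff_outer ?k A" by simp
    have cylM: "cylinder \<nu> (L ` W) = M ` cylinder e W"
    proof (intro equalityI subsetI)
      fix y assume "y \<in> M ` cylinder e W"
      then obtain x where x: "x \<in> slab e" "proj_perp e x \<in> W" "y = M x" by (auto simp: cylinder_def)
      have "y \<bullet> \<nu> = x \<bullet> e" using x L\<nu>[of "proj_perp e x"] \<nu>\<nu> by (simp add: M_def inner_add_left)
      moreover from this have "proj_perp \<nu> y = L (proj_perp e x)" by (simp add: proj_perp_def[of \<nu>] x M_def)
      ultimately show "y \<in> cylinder \<nu> (L ` W)" using x by (auto simp: cylinder_def slab_def)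
    next
      fix y assume "y \<in> cylinder \<nu> (L ` W)"
      then obtain w where w: "w \<in> W" "proj_perp \<nu> y = L w" "y \<in> slab \<nu>" by (auto simp: cylinder_def)
      let ?x = "w + (y \<bullet> \<nu>) *\<^sub>R e"
      have "y = M ?x"
        using w We[OF w(1)] by (simp add: M_def proj_id inner_add_left) (simp add: proj_perp_def algebra_simps)
      moreover have "?x \<in> cylinder e W"
        using w We[OF w(1)] by (simp add: cylinder_def slab_def proj_id inner_add_left)
      ultimately show "y \<in> M ` cylinder e W" by blast
    qed
    have LWm: "hausdorff_outer ?k (L ` W) = ennreal J * emeasure lborel (cylinder e W)"
    proof -
      have "hausdorff_outer ?k (L ` W) = emeasure lborel (cylinder \<nu> (L ` W))"
        using hausdorff_outer_hyperplane[OF n\<nu> _ LW] L\<nu> We by auto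
      then show ?thesis by (simp add: cylM volM)
    qed
    have gm: "emeasure graph_measure A = (\<integral>\<^sup>+x. ennreal (area_factor x) * indicator (cylinder e W) x \<partial>lborel)"
      unfolding emeasure_graph_measure[OF A]
    proof (rule nn_integral_cong)
      fix x
      have "lift_graph x \<in> A \<longleftrightarrow> proj_perp e x \<in> W" by (simp add: W_eq)
      then show "indicator (slab e) x * ennreal (area_factor x) * indicator A (lift_graph x)
          = ennreal (area_factor x) * indicator (cylinder e W) x"
        by (auto simp: cylinder_def indicator_def)
    qed
    have area_cyl: "area_factor x < (1 + \<eta>) * J" "J / (1 + \<eta>) < area_factor x" if "x \<in> cylinder e W" for x
      using \<rho>(3,4)[of "proj_perp e x"] that Wp by (auto simp: cylinder_def)
    have gm1: "emeasure graph_measure A \<le> ennreal ((1 + \<eta>) * J) * emeasure lborel (cylinder e W)"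
    proof -
      have "emeasure graph_measure A \<le> (\<integral>\<^sup>+x. ennreal ((1 + \<eta>) * J) * indicator (cylinder e W) x \<partial>lborel)"
        unfolding gm using area_cyl(1)
        by (intro nn_integral_mono) (auto simp: indicator_def less_imp_le intro!: ennreal_leI)
      then show ?thesis by (simp add: nn_integral_cmult_indicator)
    qed
    have gm2: "ennreal J * emeasure lborel (cylinder e W) \<le> ennreal (1 + \<eta>) * emeasure graph_measure A"
    proof -
      have "ennreal J * emeasure lborel (cylinder e W) = (\<integral>\<^sup>+x. ennreal J * indicator (cylinder e W) x \<partial>lborel)"
        by (simp add: nn_integral_cmult_indicator)
      also have "\<dots> \<le> (\<integral>\<^sup>+x. ennreal (1 + \<eta>) * (ennreal (area_factor x) * indicator (cylinder e W) x) \<partial>lborel)"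
      proof (rule nn_integral_mono)
        fix x
        have "ennreal J \<le> ennreal (1 + \<eta>) * ennreal (area_factor x)" if "x \<in> cylinder e W"
        proof -
          have "J \<le> (1 + \<eta>) * area_factor x"
            using area_cyl(2)[OF that] \<eta> by (simp add: field_simps)
          then have "ennreal J \<le> ennreal ((1 + \<eta>) * area_factor x)" by (rule ennreal_leI)
          also have "\<dots> = ennreal (1 + \<eta>) * ennreal (area_factor x)"
            using \<eta> area_pos[of x] by (intro ennreal_mult) auto
          finally show ?thesis .
        qed
        then show "ennreal J * indicator (cylinder e W) x
            \<le> ennreal (1 + \<eta>) * (ennreal (area_factor x) * indicator (cylinder e W) x)"
          by (simp add: indicator_def)
      qed
      also have "\<dots> = ennreal (1 + \<eta>) * emeasure graph_measure A"
        unfolding gm by (rule nn_integral_cmult) measurable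
      finally show ?thesis .
    qed
    \<comment> \<open>The power d - 1 comes from the Lipschitz constants in dimension d - 1, the
      last factor from the variation of the area factor.\<close>
    have c1: "?c * ennreal (1 + \<eta>) = ennreal ((1 + \<eta>) ^ CARD('d))"
    proof -
      have "(1 + \<eta>) ^ CARD('d) = (1 + \<eta>) ^ ?k * (1 + \<eta>)" by (metis cd power_Suc2)
      then show ?thesis using \<eta> by (simp only: ennreal_mult[symmetric] zero_le_power)
    qed
    have "hausdorff_outer ?k A \<le> ?c * (ennreal (1 + \<eta>) * emeasure graph_measure A)"
      using le1 gm2 unfolding LWm by (meson mult_left_mono order_trans zero_le)
    then have 1: "hausdorff_outer ?k A \<le> ennreal ((1 + \<eta>) ^ CARD('d)) * emeasure graph_measure A"
      by (simp only: c1 mult.assoc[symmetric])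
    have "emeasure graph_measure A \<le> ennreal (1 + \<eta>) * (ennreal J * emeasure lborel (cylinder e W))"
      using gm1 J0 \<eta> ennreal_mult[of "1 + \<eta>" J] by (simp only: mult.assoc[symmetric])
    also have "\<dots> \<le> ennreal (1 + \<eta>) * (?c * hausdorff_outer ?k A)"
      using le2 unfolding LWm by (rule mult_left_mono) simp
    also have "\<dots> = ennreal ((1 + \<eta>) ^ CARD('d)) * hausdorff_outer ?k A"
      by (simp only: c1[symmetric] mult.assoc mult.left_commute)
    finally show "hausdorff_outer ?k A \<le> ennreal ((1 + \<eta>) ^ CARD('d)) * emeasure graph_measure A \<and>
        emeasure graph_measure A \<le> ennreal ((1 + \<eta>) ^ CARD('d)) * hausdorff_outer ?k A"
      using 1 by blast
  qed
qed

lemma sets_graph_measure [simp, measurable_cong]: "sets graph_measure = sets borel"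
  by (simp add: graph_measure_def)

text \<open>By Lindelof countably many of the balls of \<open>local_area\<close> suffice. They cut
  the graph into disjoint pieces on which the two measures agree up to (1 + \<eta>)^d; this factor
  survives summation, and \<eta> tends to 0.\<close>

lemma area_formula:
  assumes A[measurable]: "A \<in> sets borel"
  shows "emeasure (hausdorff_measure (CARD('d) - 1)) (A \<inter> graph_of) = emeasure graph_measure A"
proof -
  let ?k = "CARD('d) - 1" and ?H = "hausdorff_measure (CARD('d) - 1) :: (real ^ 'd) measure"
  have both: "emeasure ?H (A \<inter> graph_of) \<le> ennreal ((1 + \<eta>) ^ CARD('d)) * emeasure graph_measure (A \<inter> graph_of)
    \<and> emeasure graph_measure (A \<inter> graph_of) \<le> ennreal ((1 + \<eta>) ^ CARD('d)) * emeasure ?H (A \<inter> graph_of)"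
    if \<eta>: "0 < \<eta>" for \<eta>
  proof -
    let ?P = "\<lambda>p \<rho>. 0 < \<rho> \<and> (\<forall>A. A \<in> sets borel \<longrightarrow> A \<subseteq> graph_of \<longrightarrow> proj_perp e ` A \<subseteq> ball p \<rho> \<longrightarrow>
      hausdorff_outer ?k A \<le> ennreal ((1 + \<eta>) ^ CARD('d)) * emeasure graph_measure A \<and>
      emeasure graph_measure A \<le> ennreal ((1 + \<eta>) ^ CARD('d)) * hausdorff_outer ?k A)"
    have "\<exists>\<rho>. ?P p \<rho>" for p by (rule local_area[OF \<eta>, of p]) blast
    then obtain \<rho> where \<rho>: "\<And>p. ?P p (\<rho> p)" by metis
    obtain F' where F': "F' \<subseteq> range (\<lambda>p. ball p (\<rho> p))" "countable F'" "\<Union>F' = \<Union>(range (\<lambda>p. ball p (\<rho> p)))"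
      using Lindelof[of "range (\<lambda>p. ball p (\<rho> p))"] by auto
    have cov: "\<Union>F' = UNIV" unfolding F'(3) using \<rho> by (auto intro!: exI centre_in_ball[THEN iffD2])
    then have ne: "F' \<noteq> {}" by auto
    define U where "U = from_nat_into F'"
    have U: "U n \<in> F'" for n by (simp add: U_def from_nat_into ne)
    have rU: "range U = F'" using F'(2) ne by (simp add: U_def)
    have [measurable]: "U n \<in> sets borel" for n using U[of n] F'(1) by auto
    have [measurable]: "disjointed U n \<in> sets borel" for n
    proof -
      have "range U \<subseteq> sets borel" by auto
      from sets.range_disjointed_sets[OF this] show ?thesis by blast
    qed
    define D where "D n = {x \<in> A \<inter> graph_of. proj_perp e x \<in> disjointed U n}" for n
    have [measurable]: "D n \<in> sets borel" for n unfolding D_def by measurable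
    have disj: "disjoint_family D"
      using disjoint_family_disjointed[of U] by (fastforce simp: disjoint_family_on_def D_def)
    have UD: "(\<Union>n. D n) = A \<inter> graph_of"
    proof -
      have "(\<Union>n. disjointed U n) = UNIV" unfolding UN_disjointed_eq using rU cov by simp
      then show ?thesis by (auto simp: D_def)
    qed
    have each: "emeasure ?H (D n) \<le> ennreal ((1 + \<eta>) ^ CARD('d)) * emeasure graph_measure (D n) \<and>
        emeasure graph_measure (D n) \<le> ennreal ((1 + \<eta>) ^ CARD('d)) * emeasure ?H (D n)" for n
    proof -
      obtain p where p: "U n = ball p (\<rho> p)" using U[of n] F'(1) by auto
      have "proj_perp e ` D n \<subseteq> ball p (\<rho> p)"
        using disjointed_subset[of U n] p by (auto simp: D_def)
      moreover have "D n \<subseteq> graph_of" by (auto simp: D_def)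
      ultimately show ?thesis using \<rho>[of p] by (simp add: emeasure_hausdorff_measure)
    qed
    have s1: "(\<Sum>n. emeasure ?H (D n)) = emeasure ?H (A \<inter> graph_of)"
      unfolding UD[symmetric] by (rule suminf_emeasure) (auto simp: disj)
    have s2: "(\<Sum>n. emeasure graph_measure (D n)) = emeasure graph_measure (A \<inter> graph_of)"
      unfolding UD[symmetric] by (rule suminf_emeasure) (auto simp: disj)
    show ?thesis
      unfolding s1[symmetric] s2[symmetric] ennreal_suminf_cmult[symmetric]
      using each by (intro conjI suminf_le summableI) auto
  qed
  have "emeasure ?H (A \<inter> graph_of) = emeasure graph_measure (A \<inter> graph_of)"
  proof (rule antisym)
    show "emeasure ?H (A \<inter> graph_of) \<le> emeasure graph_measure (A \<inter> graph_of)"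
      by (rule ennreal_le_of_scaled) (rule both[THEN conjunct1])
    show "emeasure graph_measure (A \<inter> graph_of) \<le> emeasure ?H (A \<inter> graph_of)"
      by (rule ennreal_le_of_scaled) (rule both[THEN conjunct2])
  qed
  also have "\<dots> = emeasure graph_measure A"
  proof -
    have "indicator (A \<inter> graph_of) (lift_graph x) = (indicator A (lift_graph x) :: ennreal)" for x
      by (simp add: indicator_def lift_in_graph)
    moreover have "A \<inter> graph_of \<in> sets borel" by measurable
    ultimately show ?thesis by (simp only: emeasure_graph_measure A)
  qed
  finally show ?thesis .
qed

lemma integral_graph:
  fixes f :: "real ^ 'd \<Rightarrow> real"
  assumes [measurable]: "f \<in> borel_measurable borel"
  shows "integrable (hausdorff_measure (CARD('d) - 1)) (\<lambda>x. indicator graph_of x * f x) \<longleftrightarrow>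
      integrable lborel (\<lambda>x. indicator (slab e) x * (area_factor x * f (lift_graph x)))"
    and "(LINT x|hausdorff_measure (CARD('d) - 1). indicator graph_of x * f x) =
      (LINT x|lborel. indicator (slab e) x * (area_factor x * f (lift_graph x)))"
proof -
  let ?H = "hausdorff_measure (CARD('d) - 1) :: (real ^ 'd) measure"
  have eq: "density ?H (indicator graph_of) = graph_measure"
  proof (rule measure_eqI)
    fix A assume "A \<in> sets (density ?H (indicator graph_of))"
    then have [measurable]: "A \<in> sets borel" by simp
    have "emeasure (density ?H (indicator graph_of)) A = emeasure ?H (A \<inter> graph_of)"
      by (subst emeasure_density) (auto simp: Int_commute simp flip: indicator_inter_arith)
    also have "\<dots> = emeasure graph_measure A" by (rule area_formula) measurable
    finally show "emeasure (density ?H (indicator graph_of)) A = emeasure graph_measure A" .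
  qed simp
  have d1: "density ?H (indicator graph_of) = density ?H (\<lambda>x. ennreal (indicator graph_of x))"
    by (simp add: ennreal_indicator)
  have d2: "density lborel (\<lambda>x. indicator (slab e) x * ennreal (area_factor x))
      = density lborel (\<lambda>x. ennreal (indicator (slab e) x * area_factor x))"
    by (simp add: ennreal_mult' ennreal_indicator)
  have "integrable ?H (\<lambda>x. indicator graph_of x * f x) \<longleftrightarrow> integrable graph_measure f"
    unfolding eq[symmetric] d1 by (subst integrable_density) auto
  also have "\<dots> \<longleftrightarrow> integrable lborel (\<lambda>x. indicator (slab e) x * (area_factor x * f (lift_graph x)))"
    unfolding graph_measure_def d2
    by (subst integrable_distr_eq, simp, simp, subst integrable_density)
       (auto simp: area_pos less_imp_le mult.assoc)
  finally show "integrable ?H (\<lambda>x. indicator graph_of x * f x) \<longleftrightarrow>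
      integrable lborel (\<lambda>x. indicator (slab e) x * (area_factor x * f (lift_graph x)))" .
  have "(LINT x|?H. indicator graph_of x * f x) = (LINT x|graph_measure. f x)"
    unfolding eq[symmetric] d1 by (subst integral_density) auto
  also have "\<dots> = (LINT x|lborel. indicator (slab e) x * (area_factor x * f (lift_graph x)))"
    unfolding graph_measure_def d2
    by (subst integral_distr, simp, simp, subst integral_density)
       (auto simp: area_pos less_imp_le mult.assoc)
  finally show "(LINT x|?H. indicator graph_of x * f x) =
      (LINT x|lborel. indicator (slab e) x * (area_factor x * f (lift_graph x)))" .
qed

end

subsection \<open>The divergence theorem above a graph\<close>

lemma integrable_compact_support:
  fixes f :: "'a::euclidean_space \<Rightarrow> real"
  assumes "continuous_on UNIV f" "compact K" "\<And>x. x \<notin> K \<Longrightarrow> f x = 0"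
  shows "integrable lborel f"
proof -
  have "integrable lborel (\<lambda>x. indicator K x *\<^sub>R f x)"
    using assms by (intro borel_integrable_compact continuous_on_subset[OF assms(1)]) auto
  moreover have "(\<lambda>x. indicator K x *\<^sub>R f x) = f" using assms(3) by (auto simp: indicator_def fun_eq_iff)
  ultimately show ?thesis by simp
qed

lemma bounded_compact_support:
  fixes f :: "'a::euclidean_space \<Rightarrow> real"
  assumes "continuous_on UNIV f" "compact K" "\<And>x. x \<notin> K \<Longrightarrow> f x = 0"
  obtains B where "0 \<le> B" "\<And>x. \<bar>f x\<bar> \<le> B"
proof -
  have "compact (f ` K)"
    using assms by (intro compact_continuous_image continuous_on_subset[OF assms(1)]) auto
  then obtain B where "\<And>y. y \<in> f ` K \<Longrightarrow> \<bar>y\<bar> \<le> B"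
    by (meson bounded_real compact_imp_bounded)
  then have "\<bar>f x\<bar> \<le> max B 0" for x using assms(3)[of x] by (cases "x \<in> K") force+
  then show ?thesis using that[of "max B 0"] by simp
qed

section \<open>Derivatives along parallel lines and their integrals\<close>

lemma line_derivative_shift:
  fixes f :: "'a::real_normed_vector \<Rightarrow> real"
  assumes "\<And>x. ((\<lambda>t. f (x + t *\<^sub>R b)) has_real_derivative d x) (at 0)"
  shows "((\<lambda>t. f (x + t *\<^sub>R b)) has_real_derivative d (x + s *\<^sub>R b)) (at s)"
proof -
  have "((\<lambda>t. f ((x + s *\<^sub>R b) + t *\<^sub>R b)) has_real_derivative d (x + s *\<^sub>R b)) (at 0)"
    by (rule assms)
  also have "(\<lambda>t. f ((x + s *\<^sub>R b) + t *\<^sub>R b)) = (\<lambda>t. f (x + (t + s) *\<^sub>R b))"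
    by (simp add: algebra_simps)
  finally show ?thesis using DERIV_shift[of "\<lambda>t. f (x + t *\<^sub>R b)" _ 0 s] by simp
qed

lemma line_derivative_support:
  fixes f :: "'a::real_normed_vector \<Rightarrow> real"
  assumes d: "((\<lambda>t. f (x + t *\<^sub>R b)) has_real_derivative d) (at 0)"
    and K: "closed K" "\<And>x. x \<notin> K \<Longrightarrow> f x = 0" and x: "x \<notin> K"
  shows "d = 0"
proof -
  have "open ((\<lambda>t. x + t *\<^sub>R b) -` (- K))"
    using K(1) by (intro open_vimage continuous_intros) auto
  then have "((\<lambda>t::real. 0) has_real_derivative d) (at 0)"
    by (rule has_field_derivative_transform_within_open[OF d]) (use x K(2) in auto)
  then show ?thesis using DERIV_unique[OF _ DERIV_const] by blast
qed

text \<open>The difference quotients have integral zero by translation invariance.\<close>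

lemma integral_line_derivative_0:
  fixes f :: "'a::euclidean_space \<Rightarrow> real"
  assumes f: "continuous_on UNIV f" and d: "continuous_on UNIV d"
    and deriv: "\<And>x. ((\<lambda>t. f (x + t *\<^sub>R b)) has_real_derivative d x) (at 0)"
    and K: "compact K" "\<And>x. x \<notin> K \<Longrightarrow> f x = 0"
  shows "(LINT x|lborel. d x) = 0"
proof -
  have d0: "d x = 0" if "x \<notin> K" for x
    using line_derivative_support[OF deriv compact_imp_closed[OF K(1)] K(2) that] by simp
  obtain B where B: "0 \<le> B" "\<And>x. \<bar>d x\<bar> \<le> B" using bounded_compact_support[OF d K(1)] d0 by metis
  obtain R where R: "\<And>x. x \<in> K \<Longrightarrow> norm x \<le> R" using K(1) by (meson bounded_iff compact_imp_bounded)
  define h where "h n = inverse (real (Suc n))" for n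
  have h: "0 < h n" "h n \<le> 1" for n by (auto simp: h_def field_simps)
  define q where "q n x = (f (x + h n *\<^sub>R b) - f x) / h n" for n x
  have fm[measurable]: "f \<in> borel_measurable borel" "d \<in> borel_measurable borel"
    using f d by (auto intro: borel_measurable_continuous_onI)
  have fi: "integrable lborel f" by (rule integrable_compact_support[OF f K])
  have ti: "integrable lborel (\<lambda>x. f (x + c)) \<and> (LINT x|lborel. f (x + c)) = (LINT x|lborel. f x)" for c
  proof -
    have "integrable (distr lborel borel ((+) c)) f" using fi by (simp add: lborel_distr_plus)
    then have "integrable lborel (\<lambda>x. f (x + c))" by (subst (asm) integrable_distr_eq) (auto simp: add.commute)
    moreover have "(LINT x|distr lborel borel ((+) c). f x) = (LINT x|lborel. f (x + c))"
      by (subst integral_distr) (auto simp: add.commute)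
    ultimately show ?thesis by (simp add: lborel_distr_plus)
  qed
  have q0: "(LINT x|lborel. q n x) = 0" for n
    unfolding q_def using ti[of "h n *\<^sub>R b"] fi by simp
  have "(\<lambda>n. LINT x|lborel. q n x) \<longlonglongrightarrow> (LINT x|lborel. d x)"
  \<comment> \<open>By the mean value theorem \<open>B\<close> bounds all difference quotients.
    Since the steps are at most 1, they vanish outside the ball enlarged by
    \<open>norm b\<close>.\<close>
  proof (rule integral_dominated_convergence[where w = "\<lambda>x. B * indicator (cball 0 (R + norm b)) x"])
    show "integrable lborel (\<lambda>x. B * indicator (cball 0 (R + norm b)) x)"
      by (intro integrable_mult_right integrable_real_indicator) (auto simp: emeasure_compact_finite[unfolded infinity_ennreal_def] top.not_eq_extremum)
    show "AE x in lborel. (\<lambda>n. q n x) \<longlonglongrightarrow> d x"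
    proof (rule AE_I2)
      fix x
      have "((\<lambda>t. (f (x + t *\<^sub>R b) - f x) / t) \<longlongrightarrow> d x) (at 0)"
        using deriv[of x] by (simp add: has_field_derivative_def[symmetric] DERIV_def)
      moreover have "filterlim h (at 0) sequentially"
      proof (unfold filterlim_at, intro conjI)
        show "\<forall>\<^sub>F n in sequentially. h n \<in> UNIV \<and> h n \<noteq> 0" using h(1) by (auto simp: less_imp_neq[symmetric])
        show "h \<longlonglongrightarrow> 0" unfolding h_def by (rule LIMSEQ_inverse_real_of_nat)
      qed
      ultimately show "(\<lambda>n. q n x) \<longlonglongrightarrow> d x"
        unfolding q_def by (rule filterlim_compose)
    qed
    show "AE x in lborel. norm (q n x) \<le> B * indicator (cball 0 (R + norm b)) x" for n
    proof (rule AE_I2)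
      fix x
      obtain z where z: "0 < z" "z < h n" "f (x + h n *\<^sub>R b) - f (x + 0 *\<^sub>R b) = (h n - 0) * d (x + z *\<^sub>R b)"
        using MVT2[OF h(1)[of n], of "\<lambda>t. f (x + t *\<^sub>R b)" "\<lambda>t. d (x + t *\<^sub>R b)"]
          line_derivative_shift[OF deriv] by blast
      then have le: "\<bar>q n x\<bar> \<le> B" using B(2)[of "x + z *\<^sub>R b"] h[of n] by (simp add: q_def)
      show "norm (q n x) \<le> B * indicator (cball 0 (R + norm b)) x"
      proof (cases "x \<in> cball 0 (R + norm b)")
        case False
        have "norm (h n *\<^sub>R b) \<le> 1 * norm b" unfolding norm_scaleR using h[of n] by (intro mult_right_mono) auto
        moreover have "norm x - norm (h n *\<^sub>R b) \<le> norm (x + h n *\<^sub>R b)" by (metis norm_diff_ineq)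
        moreover have "R + norm b < norm x" using False by simp
        ultimately have "R < norm (x + h n *\<^sub>R b)" "R < norm x" using norm_ge_zero[of b] by linarith+
        then have "f x = 0" "f (x + h n *\<^sub>R b) = 0" using R K(2) by (meson not_le)+
        then show ?thesis by (simp add: q_def B)
      qed (use le in simp)
    qed
  qed (auto simp: q_def)
  then show ?thesis by (simp add: q0 LIMSEQ_const_iff)
qed

text \<open>The version for nonnegative functions says that Lebesgue measure is the image of the
  measure \<open>N\<close> on slab times line under addition. Signed integrands then follow by
  change of measure and Fubini.\<close>

lemma integral_fibre:
  fixes f :: "'a::euclidean_space \<Rightarrow> real"
  assumes f: "integrable lborel f" and e: "norm e = 1"
  shows "(LINT x|lborel. indicator (slab e) x * (LINT t|lborel. f (x + t *\<^sub>R e))) = (LINT x|lborel. f x)"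
proof -
  have fm[measurable]: "f \<in> borel_measurable borel" using f by simp
  define N where "N = density (lborel \<Otimes>\<^sub>M (lborel :: real measure)) (\<lambda>p. indicator (slab e) (fst p))"
  have sN: "sets N = sets (borel \<Otimes>\<^sub>M borel)" by (simp add: N_def)
  have mN: "measurable N M = measurable (borel \<Otimes>\<^sub>M borel) M" for M :: "'b measure"
    by (rule measurable_cong_sets[OF sN refl])
  have eq: "distr N borel (\<lambda>p. fst p + snd p *\<^sub>R e) = lborel"
  proof (rule measure_eqI)
    fix A assume "A \<in> sets (distr N borel (\<lambda>p. fst p + snd p *\<^sub>R e))"
    then have [measurable]: "A \<in> sets borel" by simp
    have "emeasure (distr N borel (\<lambda>p. fst p + snd p *\<^sub>R e)) A
        = (\<integral>\<^sup>+x. indicator A x \<partial>distr N borel (\<lambda>p. fst p + snd p *\<^sub>R e))"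
      by (subst nn_integral_indicator) auto
    also have "\<dots> = (\<integral>\<^sup>+p. indicator A (fst p + snd p *\<^sub>R e) \<partial>N)"
      by (rule nn_integral_distr) (simp_all add: mN)
    also have "\<dots> = (\<integral>\<^sup>+p. indicator (slab e) (fst p) * indicator A (fst p + snd p *\<^sub>R e) \<partial>(lborel \<Otimes>\<^sub>M lborel))"
      unfolding N_def by (rule nn_integral_density) measurable
    also have "\<dots> = (\<integral>\<^sup>+x. \<integral>\<^sup>+t. indicator (slab e) x * indicator A (x + t *\<^sub>R e) \<partial>lborel \<partial>lborel)"
      by (subst lborel.nn_integral_fst[symmetric]) auto
    also have "\<dots> = (\<integral>\<^sup>+x. indicator (slab e) x * (\<integral>\<^sup>+t. indicator A (x + t *\<^sub>R e) \<partial>lborel) \<partial>lborel)"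
      by (intro nn_integral_cong nn_integral_cmult) measurable
    also have "\<dots> = emeasure lborel A"
      by (subst nn_integral_fibre[OF _ e]) auto
    finally show "emeasure (distr N borel (\<lambda>p. fst p + snd p *\<^sub>R e)) A = emeasure lborel A" .
  qed simp
  have N_eq: "N = density (lborel \<Otimes>\<^sub>M lborel) (\<lambda>p. ennreal (indicator (slab e) (fst p)))"
    by (simp add: N_def ennreal_indicator)
  have "integrable N (\<lambda>p. f (fst p + snd p *\<^sub>R e))"
    using f unfolding eq[symmetric] by (subst (asm) integrable_distr_eq) (simp_all add: mN)
  then have int: "integrable (lborel \<Otimes>\<^sub>M lborel) (\<lambda>p. indicator (slab e) (fst p) *\<^sub>R f (fst p + snd p *\<^sub>R e))"
    unfolding N_eq by (subst (asm) integrable_density) auto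
  have "(LINT x|lborel. f x) = (LINT p|N. f (fst p + snd p *\<^sub>R e))"
    by (subst eq[symmetric], subst integral_distr) (simp_all add: mN)
  also have "\<dots> = (LINT p|(lborel \<Otimes>\<^sub>M lborel). indicator (slab e) (fst p) *\<^sub>R f (fst p + snd p *\<^sub>R e))"
    unfolding N_eq by (subst integral_density) auto
  also have "\<dots> = (LINT x|lborel. LINT t|lborel. indicator (slab e) x *\<^sub>R f (x + t *\<^sub>R e))"
    using lborel_pair.integral_fst'[OF int] by simp
  finally show ?thesis by simp
qed

section \<open>A C1 step function\<close>

lemma max_0_square_deriv: "((\<lambda>s::real. (max 0 s)\<^sup>2) has_real_derivative 2 * max 0 s) (at s)"
proof -
  consider "s < 0" | "s = 0" | "0 < s" by linarith
  then show ?thesis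
  proof cases
    case 1
    have "((\<lambda>s::real. 0) has_real_derivative 2 * max 0 s) (at s)" using 1 by simp
    then show ?thesis
      by (rule has_field_derivative_transform_within_open[where S = "{..<0}"]) (use 1 in auto)
  next
    case 2
    have "((\<lambda>h::real. (max 0 h)\<^sup>2 / h) \<longlongrightarrow> 0) (at 0)"
    proof (rule Lim_null_comparison)
      show "\<forall>\<^sub>F h::real in at 0. norm ((max 0 h)\<^sup>2 / h) \<le> \<bar>h\<bar>"
        by (rule always_eventually) (auto simp: max_def power2_eq_square)
      show "((\<lambda>h::real. \<bar>h\<bar>) \<longlongrightarrow> 0) (at 0)" by (intro tendsto_rabs_zero tendsto_ident_at)
    qed
    then show ?thesis using 2 by (simp add: DERIV_def)
  next
    case 3
    have "((\<lambda>s::real. s\<^sup>2) has_real_derivative 2 * max 0 s) (at s)"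
      using 3 by (auto intro!: derivative_eq_intros)
    then show ?thesis
      by (rule has_field_derivative_transform_within_open[where S = "{0<..}"]) (use 3 in auto)
  qed
qed

text \<open>The quadratic spline that is 0 up to 0, 2 s^2 up to 1/2, 1 - 2 (1 - s)^2 up to 1, and 1
  from there on. Its derivative is a hat function of integral 1.\<close>

definition ramp :: "real \<Rightarrow> real" where
  "ramp s = 2 * ((max 0 s)\<^sup>2 - 2 * (max 0 (s - 1/2))\<^sup>2 + (max 0 (s - 1))\<^sup>2)"

definition ramp' :: "real \<Rightarrow> real" where
  "ramp' s = 4 * (max 0 s - 2 * max 0 (s - 1/2) + max 0 (s - 1))"

lemma ramp_deriv: "(ramp has_real_derivative ramp' s) (at s)"
proof -
  have *: "((\<lambda>s. (max 0 (s - c))\<^sup>2) has_real_derivative 2 * max 0 (s - c)) (at s)" for c :: real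
    using max_0_square_deriv[of "s - c"] DERIV_shift[of "\<lambda>s. (max 0 s)\<^sup>2" _ s "- c"] by simp
  show ?thesis
    unfolding ramp_def ramp'_def
    by (rule DERIV_cong[OF DERIV_cmult[OF DERIV_add[OF DERIV_diff[OF max_0_square_deriv DERIV_cmult[OF *]] *]]])
      simp
qed

lemma ramp_le_0: "s \<le> 0 \<Longrightarrow> ramp s = 0" by (simp add: ramp_def)

lemma ramp_ge_1: "1 \<le> s \<Longrightarrow> ramp s = 1"
  by (simp add: ramp_def max_def power2_eq_square algebra_simps)

lemma ramp'_outside: "s \<le> 0 \<or> 1 \<le> s \<Longrightarrow> ramp' s = 0" by (auto simp: ramp'_def max_def)

lemma ramp'_nonneg: "0 \<le> ramp' s" by (auto simp: ramp'_def max_def)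

lemma ramp_bounds: "0 \<le> ramp s" "ramp s \<le> 1"
proof -
  have mono: "ramp s \<le> ramp t" if "s \<le> t" for s t
    by (rule DERIV_nonneg_imp_nondecreasing[OF that]) (rule exI, rule conjI, rule ramp_deriv, rule ramp'_nonneg)
  show "0 \<le> ramp s" using mono[of "min 0 s" s] ramp_le_0[of "min 0 s"] by simp
  show "ramp s \<le> 1" using mono[of s "max 1 s"] ramp_ge_1[of "max 1 s"] by simp
qed

lemma cont_ramp: "continuous_on A ramp"
  using DERIV_continuous[OF ramp_deriv] by (blast intro: continuous_at_imp_continuous_on)

lemma cont_ramp': "continuous_on A ramp'"
  unfolding ramp'_def by (intro continuous_intros)

lemma ramp'_integrable: "integrable lborel ramp'"
  by (rule integrable_compact_support[OF cont_ramp', of "{0..1}"]) (auto intro!: ramp'_outside)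

lemma ramp'_integral: "(LINT s|lborel. ramp' s) = 1"
proof -
  have "(LINT s|lborel. ramp' s) = (LINT s|lborel. indicator {0..1} s *\<^sub>R ramp' s)"
    by (intro Bochner_Integration.integral_cong) (auto simp: indicator_def intro!: ramp'_outside)
  also have "\<dots> = ramp 1 - ramp 0"
    by (rule integral_FTC_Icc[OF _ _ cont_ramp'])
       (auto simp: has_real_derivative_iff_has_vector_derivative[symmetric] intro!: has_field_derivative_at_within ramp_deriv)
  finally show ?thesis by (simp add: ramp_le_0 ramp_ge_1)
qed

context C1_graph
begin

lemma height_deriv:
  "((\<lambda>t. (x + t *\<^sub>R b) \<bullet> e - g (x + t *\<^sub>R b)) has_real_derivative (e - a x) \<bullet> b) (at 0)"
proof -
  have "((\<lambda>t. g (x + t *\<^sub>R b)) has_derivative (\<lambda>t. a x \<bullet> (t *\<^sub>R b))) (at 0)"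
    by (rule has_derivative_compose[where g = g, OF _ has_derivative_eq_rhs[OF deriv_g]])
       (auto intro!: derivative_eq_intros)
  then have "((\<lambda>t. g (x + t *\<^sub>R b)) has_real_derivative a x \<bullet> b) (at 0)"
    unfolding has_field_derivative_def by (rule has_derivative_eq_rhs) (simp add: fun_eq_iff)
  moreover have "((\<lambda>t. (x + t *\<^sub>R b) \<bullet> e) has_real_derivative e \<bullet> b) (at 0)"
    unfolding inner_add_left inner_scaleR_left
    by (auto intro!: derivative_eq_intros simp: inner_commute)
  ultimately show ?thesis
    by (auto intro!: derivative_eq_intros simp: inner_diff_left)
qed

text \<open>The derivative of \<open>cut n * f\<close> integrates to 0, which turns the integral of
  \<open>cut n * d\<close> into one of \<open>f\<close> against the gradient of the cutoff. That
  gradient lives in a layer of thickness \<open>\<delta> n\<close> above the graph with total weight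
  1 on each vertical line, so in the limit only values on the graph remain.\<close>

lemma gauss_green_graph:
  fixes f :: "real ^ 'd \<Rightarrow> real"
  assumes f: "continuous_on UNIV f" and d: "continuous_on UNIV d"
    and deriv: "\<And>x. ((\<lambda>t. f (x + t *\<^sub>R b)) has_real_derivative d x) (at 0)"
    and K: "compact K" "\<And>x. x \<notin> K \<Longrightarrow> f x = 0"
  shows "(LINT x|lborel. indicator {x. g x < x \<bullet> e} x * d x)
    = (LINT x|lborel. indicator (slab e) x * (f (lift_graph x) * ((a x - e) \<bullet> b)))"
proof -
  define u where "u x = x \<bullet> e - g x" for x
  have cu: "continuous_on A u" for A unfolding u_def by (intro continuous_intros cont_g)
  define h where "h x = f x * ((a x - e) \<bullet> b)" for x
  have ch: "continuous_on UNIV h" unfolding h_def by (intro continuous_intros f cont_a)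
  have h0: "x \<notin> K \<Longrightarrow> h x = 0" for x using K(2) by (simp add: h_def)
  have [measurable]: "u \<in> borel_measurable borel" "h \<in> borel_measurable borel" "d \<in> borel_measurable borel"
    "ramp \<in> borel_measurable borel" "ramp' \<in> borel_measurable borel" "f \<in> borel_measurable borel"
    using cu ch d f cont_ramp cont_ramp' by (auto intro: borel_measurable_continuous_onI)
  have d0: "d x = 0" if "x \<notin> K" for x
    using line_derivative_support[OF deriv compact_imp_closed[OF K(1)] K(2) that] by simp
  have di: "integrable lborel d" by (rule integrable_compact_support[OF d K(1) d0])
  obtain B where B: "0 \<le> B" "\<And>x. \<bar>h x\<bar> \<le> B" using bounded_compact_support[OF ch K(1)] h0 by metis
  obtain R where R: "\<And>x. x \<in> K \<Longrightarrow> norm x \<le> R" using K(1) by (meson bounded_iff compact_imp_bounded)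
  define \<delta> where "\<delta> n = inverse (real (Suc n))" for n
  have \<delta>: "0 < \<delta> n" for n by (simp add: \<delta>_def)
  have \<delta>0: "\<delta> \<longlonglongrightarrow> 0" unfolding \<delta>_def by (rule LIMSEQ_inverse_real_of_nat)
  define cut where "cut n x = ramp (u x / \<delta> n)" for n x
  \<comment> \<open>Minus \<open>f\<close> times the derivative of \<open>cut n\<close> along
    \<open>b\<close>; the sign is already inside \<open>h\<close>, through
    \<open>a x - e\<close>.\<close>
  define \<phi> where "\<phi> n x = h x * (ramp' (u x / \<delta> n) / \<delta> n)" for n x
  have ccut: "continuous_on UNIV (cut n)" and c\<phi>: "continuous_on UNIV (\<phi> n)" for n
    unfolding cut_def \<phi>_def using \<delta>[of n]
    by (auto intro!: continuous_intros ch cu continuous_on_compose2[OF cont_ramp[of UNIV]] continuous_on_compose2[OF cont_ramp'[of UNIV]])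
  have \<phi>i: "integrable lborel (\<phi> n)" for n
    by (rule integrable_compact_support[OF c\<phi> K(1)]) (simp add: \<phi>_def h0)
  have eq: "(LINT x|lborel. cut n x * d x) = (LINT x|lborel. \<phi> n x)" for n
  proof -
    have "((\<lambda>t. cut n (x + t *\<^sub>R b) * f (x + t *\<^sub>R b)) has_real_derivative (cut n x * d x - \<phi> n x)) (at 0)" for x
    proof -
      have "((\<lambda>t. u (x + t *\<^sub>R b) / \<delta> n) has_real_derivative ((e - a x) \<bullet> b) / \<delta> n) (at 0)"
        using DERIV_cdivide[OF height_deriv[of x b], of "\<delta> n"] by (simp add: u_def)
      then have "((\<lambda>t. cut n (x + t *\<^sub>R b)) has_real_derivative ramp' (u x / \<delta> n) * (((e - a x) \<bullet> b) / \<delta> n)) (at 0)"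
        unfolding cut_def
        by (rule DERIV_chain2[where f = ramp, rotated]) (use ramp_deriv[of "u x / \<delta> n"] in simp)
      from DERIV_mult[OF this deriv[of x]] show ?thesis
        by (rule DERIV_cong) (simp add: \<phi>_def h_def inner_diff_left algebra_simps diff_divide_distrib)
    qed
    then have "(LINT x|lborel. cut n x * d x - \<phi> n x) = 0"
      by (intro integral_line_derivative_0[where f = "\<lambda>x. cut n x * f x" and K = K])
         (auto intro!: continuous_intros ccut c\<phi> f d K)
    moreover have "integrable lborel (\<lambda>x. cut n x * d x)"
      by (rule integrable_compact_support[OF _ K(1)]) (auto intro!: continuous_intros ccut d simp: d0)
    ultimately show ?thesis using \<phi>i[of n] by simp
  qed
  have lim1: "(\<lambda>n. LINT x|lborel. cut n x * d x) \<longlonglongrightarrow> (LINT x|lborel. indicator {x. g x < x \<bullet> e} x * d x)"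
  proof (rule integral_dominated_convergence[where w = "\<lambda>x. \<bar>d x\<bar>"])
    show "integrable lborel (\<lambda>x. \<bar>d x\<bar>)" using di by simp
    show "AE x in lborel. norm (cut n x * d x) \<le> \<bar>d x\<bar>" for n
      using ramp_bounds by (intro AE_I2) (simp add: cut_def abs_mult mult_left_le_one_le)
    show "AE x in lborel. (\<lambda>n. cut n x * d x) \<longlonglongrightarrow> indicator {x. g x < x \<bullet> e} x * d x"
    proof (rule AE_I2, rule tendsto_mult_right)
      fix x
      show "(\<lambda>n. cut n x) \<longlonglongrightarrow> indicator {x. g x < x \<bullet> e} x"
      proof (cases "0 < u x")
        case True
        have "\<forall>\<^sub>F n in sequentially. \<delta> n < u x" by (rule order_tendstoD(2)[OF \<delta>0 True])
        then have "\<forall>\<^sub>F n in sequentially. cut n x = 1"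
        proof eventually_elim
          case (elim n)
          then show ?case using \<delta>[of n] unfolding cut_def by (intro ramp_ge_1) (simp add: field_simps)
        qed
        then show ?thesis using True by (simp add: tendsto_eventually u_def)
      next
        case False
        then have "cut n x = 0" for n unfolding cut_def using \<delta>[of n] by (intro ramp_le_0) (simp add: divide_nonpos_pos)
        then show ?thesis using False by (simp add: u_def)
      qed
    qed
    show "(\<lambda>x. indicator {x. g x < x \<bullet> e} x * d x) \<in> borel_measurable lborel"
    proof -
      have "{x. g x < x \<bullet> e} = {x. 0 < u x}" by (auto simp: u_def)
      then show ?thesis by simp
    qed
  qed (auto simp: cut_def)
  define I where "I n x = (LINT s|lborel. h (lift_graph x + (\<delta> n * s) *\<^sub>R e) * ramp' s)" for n x
  have \<phi>I: "(LINT x|lborel. \<phi> n x) = (LINT x|lborel. indicator (slab e) x * I n x)" for n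
  proof -
    have "(LINT t|lborel. \<phi> n (x + t *\<^sub>R e)) = I n x" for x
    proof -
      \<comment> \<open>The new variable \<open>s\<close> is the height above the graph in units of
        \<open>\<delta> n\<close>; the Jacobian cancels the division by \<open>\<delta> n\<close> in
        \<open>\<phi>\<close>.\<close>
      have "(LINT t|lborel. \<phi> n (x + t *\<^sub>R e))
          = \<bar>\<delta> n\<bar> *\<^sub>R (LINT s|lborel. \<phi> n (x + ((g x - x \<bullet> e) + \<delta> n * s) *\<^sub>R e))"
        using \<delta>[of n] by (intro lborel_integral_real_affine) simp
      also have "\<dots> = (LINT s|lborel. \<delta> n * \<phi> n (x + ((g x - x \<bullet> e) + \<delta> n * s) *\<^sub>R e))"
        using \<delta>[of n] by simp
      also have "\<dots> = I n x"
        unfolding I_def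
      proof (intro Bochner_Integration.integral_cong refl)
        fix s
        have "x + ((g x - x \<bullet> e) + \<delta> n * s) *\<^sub>R e = lift_graph x + (\<delta> n * s) *\<^sub>R e"
          by (simp add: lift_graph_def proj_perp_def algebra_simps)
        moreover have "u (lift_graph x + (\<delta> n * s) *\<^sub>R e) = \<delta> n * s"
          by (simp add: u_def inner_add_left g_along)
        ultimately show "\<delta> n * \<phi> n (x + ((g x - x \<bullet> e) + \<delta> n * s) *\<^sub>R e) = h (lift_graph x + (\<delta> n * s) *\<^sub>R e) * ramp' s"
          using \<delta>[of n] by (simp add: \<phi>_def)
      qed
      finally show ?thesis .
    qed
    then show ?thesis using integral_fibre[OF \<phi>i norm_e, of n] by simp
  qed
  have [measurable]: "(\<lambda>x. I n x) \<in> borel_measurable borel" for n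
    unfolding I_def by measurable
  have Ii: "integrable lborel (\<lambda>s. h (lift_graph x + (\<delta> n * s) *\<^sub>R e) * ramp' s)" for n x
    by (rule Bochner_Integration.integrable_bound[OF integrable_mult_right[OF ramp'_integrable, of B]])
       (use B ramp'_nonneg in \<open>auto simp: abs_mult intro!: mult_right_mono\<close>)
  have bound: "\<bar>I n x\<bar> \<le> B" for n x
  proof -
    have "norm (I n x) \<le> (LINT s|lborel. norm (h (lift_graph x + (\<delta> n * s) *\<^sub>R e) * ramp' s))"
      unfolding I_def by (rule integral_norm_bound)
    also have "\<dots> \<le> (LINT s|lborel. B * ramp' s)"
      by (intro integral_mono integrable_norm[OF Ii] integrable_mult_right ramp'_integrable)
         (use B ramp'_nonneg in \<open>auto simp: abs_mult intro!: mult_right_mono\<close>)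
    finally show ?thesis using ramp'_integral by simp
  qed
  \<comment> \<open>Supplies a bounded support for domination: if the vertical line through
    \<open>x\<close> meets \<open>K\<close>, the projection of \<open>x\<close> has norm at most 2
    R, and inside the slab the component along \<open>e\<close> adds at most 1.\<close>
  have zero: "I n x = 0" if "\<not> norm x \<le> 2 * R + 1" "x \<in> slab e" for n x
  proof -
    have "h (lift_graph x + (\<delta> n * s) *\<^sub>R e) = 0" for s
    proof (rule h0)
      let ?z = "lift_graph x + (\<delta> n * s) *\<^sub>R e"
      show "?z \<notin> K"
      proof
        assume "?z \<in> K"
        then have z: "norm ?z \<le> R" by (rule R)
        have "proj_perp e x = ?z - (?z \<bullet> e) *\<^sub>R e"
          by (metis proj_add proj_lift proj_perp_def)
        then have "norm (proj_perp e x) \<le> norm ?z + \<bar>?z \<bullet> e\<bar>"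
          using norm_triangle_ineq4[of ?z "(?z \<bullet> e) *\<^sub>R e"] norm_e by simp
        also have "\<bar>?z \<bullet> e\<bar> \<le> norm ?z" using Cauchy_Schwarz_ineq2[of ?z e] norm_e by simp
        finally have "norm (proj_perp e x) \<le> 2 * R" using z by simp
        moreover have "norm x \<le> norm (proj_perp e x) + \<bar>x \<bullet> e\<bar>"
          using norm_triangle_ineq[of "proj_perp e x" "(x \<bullet> e) *\<^sub>R e"] norm_e by (simp add: proj_perp_def)
        ultimately show False using that by (auto simp: slab_def)
      qed
    qed
    then show ?thesis by (simp add: I_def)
  qed
  have lim2: "(\<lambda>n. LINT x|lborel. indicator (slab e) x * I n x) \<longlonglongrightarrow> (LINT x|lborel. indicator (slab e) x * h (lift_graph x))"
  proof (rule integral_dominated_convergence[where w = "\<lambda>x. B * indicator (cball 0 (2 * R + 1)) x"])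
    show "integrable lborel (\<lambda>x. B * indicator (cball 0 (2 * R + 1)) x)"
      by (intro integrable_mult_right integrable_real_indicator) (auto simp: emeasure_compact_finite[unfolded infinity_ennreal_def] top.not_eq_extremum)
    show "AE x in lborel. norm (indicator (slab e) x * I n x) \<le> B * indicator (cball 0 (2 * R + 1)) x" for n
      using bound B(1) zero by (intro AE_I2) (auto simp: indicator_def)
    show "AE x in lborel. (\<lambda>n. indicator (slab e) x * I n x) \<longlonglongrightarrow> indicator (slab e) x * h (lift_graph x)"
    proof (rule AE_I2, rule tendsto_mult_left)
      fix x
      have "(\<lambda>n. I n x) \<longlonglongrightarrow> (LINT s|lborel. h (lift_graph x) * ramp' s)"
        unfolding I_def
      proof (rule integral_dominated_convergence[where w = "\<lambda>s. B * ramp' s"])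
        show "integrable lborel (\<lambda>s. B * ramp' s)" using ramp'_integrable by simp
        show "AE s in lborel. norm (h (lift_graph x + (\<delta> n * s) *\<^sub>R e) * ramp' s) \<le> B * ramp' s" for n
          using B ramp'_nonneg by (auto simp: abs_mult intro!: mult_right_mono)
        show "AE s in lborel. (\<lambda>n. h (lift_graph x + (\<delta> n * s) *\<^sub>R e) * ramp' s) \<longlonglongrightarrow> h (lift_graph x) * ramp' s"
        proof (rule AE_I2, rule tendsto_mult_right)
          fix s
          have "(\<lambda>n. lift_graph x + (\<delta> n * s) *\<^sub>R e) \<longlonglongrightarrow> lift_graph x + (0 * s) *\<^sub>R e"
            by (intro tendsto_intros \<delta>0)
          then show "(\<lambda>n. h (lift_graph x + (\<delta> n * s) *\<^sub>R e)) \<longlonglongrightarrow> h (lift_graph x)"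
            using continuous_on_tendsto_compose[OF ch, of _ "lift_graph x"] by simp
        qed
      qed auto
      then show "(\<lambda>n. I n x) \<longlonglongrightarrow> h (lift_graph x)" by (simp add: ramp'_integral)
    qed
  qed auto
  have "(LINT x|lborel. indicator {x. g x < x \<bullet> e} x * d x) = (LINT x|lborel. indicator (slab e) x * h (lift_graph x))"
    using lim1 lim2 unfolding eq \<phi>I by (rule LIMSEQ_unique)
  then show ?thesis by (simp add: h_def)
qed

end

subsection \<open>Boundaries of \<open>C\<^sup>1\<close>-domains\<close>

text \<open>Composing \<gamma> with the projection makes it constant along \<open>e\<close> without
  changing its values in the definition of a C1 domain. The field \<open>a\<close> collects the
  partial derivatives of the composition.\<close>

lemma C1_domain_graph:
  fixes \<Omega> :: "(real ^ 'd) set"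
  assumes "C1_domain \<Omega>" "x0 \<in> frontier \<Omega>"
  obtains r e g a where "0 < r" "C1_graph e g a"
    "\<Omega> \<inter> ball x0 r = {x \<in> ball x0 r. g x < x \<bullet> e}"
proof -
  obtain r e and \<gamma> :: "real ^ 'd \<Rightarrow> real" where r: "0 < r" and e: "norm e = 1" and \<gamma>: "C1 \<gamma>"
    and eq: "\<Omega> \<inter> ball x0 r = {x \<in> ball x0 r. x \<bullet> e > \<gamma> (x - (x \<bullet> e) *\<^sub>R e)}"
  proof -
    have "\<exists>r>0. \<exists>e. \<exists>\<gamma> :: real ^ 'd \<Rightarrow> real. norm e = 1 \<and> C1 \<gamma> \<and>
        \<Omega> \<inter> ball x0 r = {x \<in> ball x0 r. x \<bullet> e > \<gamma> (x - (x \<bullet> e) *\<^sub>R e)}"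
      using assms(1)[unfolded C1_domain_def, THEN conjunct2] assms(2) by (rule bspec)
    then show thesis using that by (elim exE conjE)
  qed
  obtain \<gamma>' :: "real ^ 'd \<Rightarrow> (real ^ 'd) \<Rightarrow>\<^sub>L real" where c: "continuous_on UNIV \<gamma>'"
    and d: "\<And>x. (\<gamma> has_derivative blinfun_apply (\<gamma>' x)) (at x)"
    using \<gamma> unfolding C1_def by blast
  define g where "g x = \<gamma> (proj_perp e x)" for x
  define a where "a x = (\<Sum>b\<in>Basis. blinfun_apply (\<gamma>' (proj_perp e x)) (proj_perp e b) *\<^sub>R b)" for x
  have lin: "linear (proj_perp e)"
    by (rule linearI) (auto simp: proj_perp_def inner_add_left algebra_simps)
  have "C1_graph e g a"
  proof
    show "(g has_derivative (\<lambda>v. a x \<bullet> v)) (at x)" for x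
    proof -
      have "(proj_perp e has_derivative proj_perp e) (at x)"
        using lin by (simp add: linear_conv_bounded_linear bounded_linear_imp_has_derivative)
      then have "(g has_derivative (\<lambda>v. blinfun_apply (\<gamma>' (proj_perp e x)) (proj_perp e v))) (at x)"
        unfolding g_def by (rule has_derivative_compose[OF _ d])
      moreover have "blinfun_apply (\<gamma>' (proj_perp e x)) (proj_perp e v) = a x \<bullet> v" for v
      proof -
        define L where "L v = blinfun_apply (\<gamma>' (proj_perp e x)) (proj_perp e v)" for v
        have linL: "linear L"
          using linear_compose[OF lin, of "blinfun_apply (\<gamma>' (proj_perp e x))"]
          by (simp add: o_def L_def[abs_def] bounded_linear.linear[OF blinfun.bounded_linear_right])
        have "L (\<Sum>b\<in>Basis. (v \<bullet> b) *\<^sub>R b) = (\<Sum>b\<in>Basis. (v \<bullet> b) * L b)"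
          by (simp add: linear_sum[OF linL] linear_cmul[OF linL])
        then show ?thesis
          by (simp only: euclidean_representation)
             (simp add: a_def L_def inner_sum_left inner_commute[of v] mult.commute)
      qed
      ultimately show ?thesis by simp
    qed
    show "continuous_on UNIV a"
      unfolding a_def
      by (intro continuous_intros continuous_on_compose2[OF c] subset_UNIV)
    show "g (x + t *\<^sub>R e) = g x" for x t
    proof -
      have "proj_perp e (x + t *\<^sub>R e) = proj_perp e x"
        using e by (simp add: proj_perp_def inner_add_left dot_square_norm algebra_simps)
      then show ?thesis by (simp add: g_def)
    qed
  qed (rule e)
  moreover have "\<Omega> \<inter> ball x0 r = {x \<in> ball x0 r. g x < x \<bullet> e}"
    unfolding eq g_def proj_perp_def ..
  ultimately show thesis by (rule that[OF r])
qed

locale graph_boundary = C1_graph e g a for e :: "real ^ 'd" and g a +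
  fixes \<Omega> U :: "(real ^ 'd) set"
  assumes open_dom: "open \<Omega>" and open_U: "open U"
    and above: "\<Omega> \<inter> U = {x \<in> U. g x < x \<bullet> e}"
begin

lemma above_iff: "x \<in> U \<Longrightarrow> x \<in> \<Omega> \<longleftrightarrow> g x < x \<bullet> e"
  using above by blast

section \<open>Frontier, tangent vectors and normal in graph coordinates\<close>

lemma eventually_in_U:
  assumes "x \<in> U" "continuous (at 0) c" "c 0 = x"
  shows "\<forall>\<^sub>F t in at (0::real). c t \<in> U"
  using topological_tendstoD[OF assms(2)[unfolded continuous_within] open_U] assms by simp

lemma not_closure: "x \<in> U \<Longrightarrow> x \<bullet> e < g x \<Longrightarrow> x \<notin> closure \<Omega>"
proof -
  assume x: "x \<in> U" "x \<bullet> e < g x"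
  have "open (U \<inter> {x. x \<bullet> e < g x})"
    using open_U by (intro open_Int open_Collect_less continuous_intros cont_g) auto
  moreover have "\<Omega> \<inter> (U \<inter> {x. x \<bullet> e < g x}) = {}" by (auto simp: above_iff)
  ultimately have "closure \<Omega> \<inter> (U \<inter> {x. x \<bullet> e < g x}) = {}"
    by (metis Int_commute open_Int_closure_eq_empty)
  then show ?thesis using x by blast
qed

lemma frontier_iff: "x \<in> U \<Longrightarrow> x \<in> frontier \<Omega> \<longleftrightarrow> x \<in> graph_of"
proof
  assume x: "x \<in> U" and "x \<in> frontier \<Omega>"
  then have "x \<in> closure \<Omega>" "x \<notin> \<Omega>" using open_dom by (auto simp: frontier_def interior_open)
  then show "x \<in> graph_of" using x not_closure[OF x] above_iff[OF x] by (force simp: graph_of_def)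
next
  assume x: "x \<in> U" and xg: "x \<in> graph_of"
  have "continuous (at 0) (\<lambda>t. x + t *\<^sub>R e)" by (intro continuous_intros)
  then have "\<forall>\<^sub>F t in at 0. x + t *\<^sub>R e \<in> U" using x by (intro eventually_in_U) auto
  then have "\<forall>\<^sub>F t in at_right 0. x + t *\<^sub>R e \<in> U" by (simp add: eventually_at_split)
  then have ev: "\<forall>\<^sub>F t in at_right 0. x + t *\<^sub>R e \<in> \<Omega>"
    using eventually_at_right_less[of 0]
  proof eventually_elim
    case (elim t)
    then have "g (x + t *\<^sub>R e) < (x + t *\<^sub>R e) \<bullet> e" using xg by (simp add: g_along inner_add_left graph_of_def)
    then show ?case using elim above by blast
  qed
  have "((\<lambda>t. x + t *\<^sub>R e) \<longlongrightarrow> x + 0 *\<^sub>R e) (at_right 0)" by (intro tendsto_intros)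
  moreover have "\<forall>\<^sub>F t in at_right 0. x + t *\<^sub>R e \<in> closure \<Omega>"
    using ev closure_subset by (auto elim!: eventually_mono)
  ultimately have "x + 0 *\<^sub>R e \<in> closure \<Omega>"
    by (intro Lim_in_closed_set[OF closed_closure]) auto
  moreover have "x \<notin> \<Omega>" using x xg by (simp add: above_iff graph_of_def)
  ultimately show "x \<in> frontier \<Omega>" using open_dom by (simp add: frontier_def interior_open)
qed

text \<open>The negative gradient of the height x.e - g x, normalised. \<Omega> lies above the
  graph, so outward means downward.\<close>

definition graph_normal :: "real ^ 'd \<Rightarrow> real ^ 'd" where
  "graph_normal x = (1 / area_factor x) *\<^sub>R (a x - e)"

lemma norm_a_e: "norm (a x - e) = area_factor x"
proof -
  have "(norm (a x - e))\<^sup>2 = 1 + (norm (a x))\<^sup>2"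
    by (simp add: power2_norm_eq_inner inner_diff_left inner_diff_right)
  then show ?thesis by (simp add: area_factor_def real_sqrt_unique)
qed

lemma norm_graph_normal: "norm (graph_normal x) = 1"
  using area_pos[of x] by (simp add: graph_normal_def norm_a_e)

text \<open>Along the normal the height starts at 0 with slope - \<open>area_factor x\<close>, so it
  is negative just ahead of \<open>x\<close> and positive just behind.\<close>

lemma graph_normal_sides:
  assumes x: "x \<in> U" "x \<in> graph_of"
  shows "\<forall>\<^sub>F t in at_right 0. x + t *\<^sub>R graph_normal x \<notin> closure \<Omega> \<and> x - t *\<^sub>R graph_normal x \<in> \<Omega>"
proof -
  let ?n = "graph_normal x"
  define u where "u s b = (x + s *\<^sub>R b) \<bullet> e - g (x + s *\<^sub>R b)" for s b
  have u0: "u 0 b = 0" for b using x by (simp add: u_def graph_of_def)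
  have slope: "(e - a x) \<bullet> ?n = - area_factor x"
  proof -
    have "(a x - e) \<bullet> ?n = (norm (a x - e))\<^sup>2 / area_factor x"
      by (simp add: graph_normal_def power2_norm_eq_inner)
    then show ?thesis using area_pos[of x] by (simp add: norm_a_e power2_eq_square inner_diff_left)
  qed
  have d: "((\<lambda>t. u t b) has_real_derivative (e - a x) \<bullet> b) (at 0)" for b
    unfolding u_def by (rule height_deriv)
  have "\<exists>d>0. \<forall>h>0. h < d \<longrightarrow> u (0 + h) ?n < u 0 ?n"
    by (rule DERIV_neg_dec_right[OF d]) (simp add: slope area_pos)
  then have ev1: "\<forall>\<^sub>F t in at_right 0. u t ?n < 0"
    by (auto simp: u0 eventually_at_right_field)
  have "\<exists>d>0. \<forall>h>0. h < d \<longrightarrow> u 0 (- ?n) < u (0 + h) (- ?n)"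
    by (rule DERIV_pos_inc_right[OF d]) (simp add: slope area_pos)
  then have ev2: "\<forall>\<^sub>F t in at_right 0. 0 < u t (- ?n)"
    by (auto simp: u0 eventually_at_right_field)
  have inU: "\<forall>\<^sub>F t in at_right 0. x + t *\<^sub>R b \<in> U" for b
  proof -
    have "continuous (at 0) (\<lambda>t. x + t *\<^sub>R b)" by (intro continuous_intros)
    then have "\<forall>\<^sub>F t in at 0. x + t *\<^sub>R b \<in> U" using x by (intro eventually_in_U) auto
    then show ?thesis by (simp add: eventually_at_split)
  qed
  show ?thesis
    using ev1 ev2 inU[of ?n] inU[of "- ?n"]
  proof eventually_elim
    case (elim t)
    have "x + t *\<^sub>R ?n \<notin> closure \<Omega>" using elim by (intro not_closure) (auto simp: u_def)
    moreover have "x + t *\<^sub>R (- ?n) \<in> {x \<in> U. g x < x \<bullet> e}" using elim by (auto simp: u_def)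
    then have "x + t *\<^sub>R (- ?n) \<in> \<Omega>" unfolding above[symmetric] by blast
    ultimately show ?case by simp
  qed
qed

text \<open>The height vanishes along a curve in the frontier, hence so does its derivative.\<close>

lemma tangent_normal:
  assumes x: "x \<in> U" "x \<in> graph_of" and v: "tangent_vector (frontier \<Omega>) x v"
  shows "(a x - e) \<bullet> v = 0"
proof -
  obtain c where c: "c 0 = x" "\<forall>\<^sub>F t in at 0. c t \<in> frontier \<Omega>" "(c has_vector_derivative v) (at 0)"
    using v unfolding tangent_vector_def by blast
  have "continuous (at 0) c" using c(3) by (rule has_vector_derivative_continuous)
  then have "\<forall>\<^sub>F t in at 0. c t \<in> U" using c(1) x by (intro eventually_in_U) auto
  with c(2) have "\<forall>\<^sub>F t in at 0. c t \<bullet> e - g (c t) = 0"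
  proof eventually_elim
    case (elim t)
    then show ?case using frontier_iff[of "c t"] by (simp add: graph_of_def)
  qed
  then have ev: "\<forall>\<^sub>F t in nhds 0. c t \<bullet> e - g (c t) = 0"
    using x c(1) by (simp add: eventually_nhds_conv_at graph_of_def)
  have cd: "(c has_derivative (\<lambda>t. t *\<^sub>R v)) (at 0)" using c(3) by (simp add: has_vector_derivative_def)
  have "((\<lambda>t. c t \<bullet> e - g (c t)) has_derivative (\<lambda>t. (t *\<^sub>R v) \<bullet> e - a x \<bullet> (t *\<^sub>R v))) (at 0)"
    using has_derivative_diff[OF has_derivative_inner_left[OF cd, of e]
        has_derivative_compose[OF cd, of g "\<lambda>w. a x \<bullet> w"]] deriv_g[of x] c(1) by simp
  moreover have "((\<lambda>t. c t \<bullet> e - g (c t)) has_derivative (\<lambda>t. 0)) (at 0)"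
  proof (rule has_derivative_transform_eventually[OF has_derivative_const])
    show "\<forall>\<^sub>F t in at 0. 0 = c t \<bullet> e - g (c t)"
      using ev by (auto simp: eventually_nhds_conv_at elim: eventually_mono)
    show "0 = c 0 \<bullet> e - g (c 0)" using ev by (auto dest: eventually_nhds_x_imp_x)
  qed simp
  ultimately have "(\<lambda>t::real. (t *\<^sub>R v) \<bullet> e - a x \<bullet> (t *\<^sub>R v)) = (\<lambda>t. 0)"
    by (rule has_derivative_unique)
  from fun_cong[OF this, of 1] show ?thesis by (simp add: inner_diff_left inner_commute[of v e])
qed

text \<open>The lift of a straight line is a curve in the frontier. This produces enough tangent
  vectors to determine the normal up to a scalar.\<close>

lemma tangent_vector_graph:
  assumes x: "x \<in> U" "x \<in> graph_of"
  shows "tangent_vector (frontier \<Omega>) x (proj_perp e w + (a x \<bullet> w) *\<^sub>R e)"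
proof -
  define c where "c t = lift_graph (x + t *\<^sub>R w)" for t
  have c0: "c 0 = x" using x by (simp add: c_def lift_id)
  have cc: "continuous (at 0) c"
    unfolding c_def by (rule continuous_on_interior[of UNIV])
      (auto intro!: continuous_on_compose2[OF cont_lift[of UNIV]] continuous_intros)
  then have "\<forall>\<^sub>F t in at 0. c t \<in> U" using x c0 by (intro eventually_in_U)
  then have "\<forall>\<^sub>F t in at 0. c t \<in> frontier \<Omega>"
    by (rule eventually_mono) (simp add: frontier_iff c_def lift_in_graph)
  moreover have "(c has_vector_derivative (proj_perp e w + (a x \<bullet> w) *\<^sub>R e)) (at 0)"
  proof -
    have "((\<lambda>t. g (x + t *\<^sub>R w)) has_derivative (\<lambda>t. a x \<bullet> (t *\<^sub>R w))) (at 0)"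
      by (rule has_derivative_compose[where g = g, OF _ has_derivative_eq_rhs[OF deriv_g]])
         (auto intro!: derivative_eq_intros)
    then have gd: "((\<lambda>t. g (x + t *\<^sub>R w)) has_real_derivative a x \<bullet> w) (at 0)"
      unfolding has_field_derivative_def by (rule has_derivative_eq_rhs) (simp add: fun_eq_iff)
    have "c = (\<lambda>t. (proj_perp e x + t *\<^sub>R proj_perp e w) + g (x + t *\<^sub>R w) *\<^sub>R e)"
      by (auto simp: c_def lift_graph_def proj_perp_def inner_add_left algebra_simps)
    then show ?thesis
      using gd by (auto intro!: derivative_eq_intros simp: has_real_derivative_iff_has_vector_derivative)
  qed
  ultimately show ?thesis using c0 unfolding tangent_vector_def by blast
qed

text \<open>Orthogonality to all tangent vectors leaves only multiples of
  \<open>graph_normal x\<close>, the length leaves the factors 1 and -1, and the side condition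
  excludes -1. This makes the \<open>THE\<close> in \<open>outward_unit_normal\<close> well
  defined.\<close>

lemma is_outward_unit_normal_iff:
  assumes x: "x \<in> U" "x \<in> graph_of"
  shows "is_outward_unit_normal \<Omega> x \<nu> \<longleftrightarrow> \<nu> = graph_normal x"
proof
  assume "\<nu> = graph_normal x"
  moreover have "graph_normal x \<bullet> v = 0" if "tangent_vector (frontier \<Omega>) x v" for v
    using tangent_normal[OF x that] by (simp add: graph_normal_def)
  ultimately show "is_outward_unit_normal \<Omega> x \<nu>"
    using graph_normal_sides[OF x] norm_graph_normal by (simp add: is_outward_unit_normal_def)
next
  assume \<nu>: "is_outward_unit_normal \<Omega> x \<nu>"
  define s where "s = - (\<nu> \<bullet> e) * area_factor x"
  \<comment> \<open>Orthogonality to the tangent vector built from \<open>w\<close>, with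
    \<open>w\<close> moved to the right of one inner product; since \<open>w\<close> is arbitrary,
    the left vector is 0.\<close>
  have "(\<nu> + (\<nu> \<bullet> e) *\<^sub>R (a x - e)) \<bullet> w = 0" for w
  proof -
    have "\<nu> \<bullet> (proj_perp e w + (a x \<bullet> w) *\<^sub>R e) = 0"
      using \<nu> tangent_vector_graph[OF x] unfolding is_outward_unit_normal_def by blast
    then show ?thesis
      by (simp add: proj_perp_def inner_add_left inner_add_right inner_diff_left inner_diff_right inner_commute[of e w] algebra_simps)
  qed
  then have "\<nu> + (\<nu> \<bullet> e) *\<^sub>R (a x - e) = 0" by (metis inner_eq_zero_iff)
  then have \<nu>s: "\<nu> = s *\<^sub>R graph_normal x"
    using area_pos[of x] by (simp add: s_def graph_normal_def add_eq_0_iff)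
  have "\<bar>s\<bar> = 1" using \<nu> norm_graph_normal[of x] by (simp add: is_outward_unit_normal_def \<nu>s)
  moreover have "s \<noteq> -1"
  proof
    assume "s = -1"
    then have \<nu>m: "\<nu> = - graph_normal x" using \<nu>s by simp
    have "\<forall>\<^sub>F t in at_right 0. x + t *\<^sub>R \<nu> \<notin> closure \<Omega>"
      using \<nu> unfolding is_outward_unit_normal_def by (auto elim: eventually_mono)
    with graph_normal_sides[OF x] have "\<forall>\<^sub>F t::real in at_right 0. False"
    proof eventually_elim
      case (elim t)
      then show ?case using closure_subset[of \<Omega>] by (auto simp: \<nu>m)
    qed
    then show False by simp
  qed
  ultimately have "s = 1" by linarith
  then show "\<nu> = graph_normal x" using \<nu>s by simp
qed

lemma outward_unit_normal_graph:
  assumes "x \<in> U" "x \<in> graph_of"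
  shows "outward_unit_normal \<Omega> x = graph_normal x"
  unfolding outward_unit_normal_def is_outward_unit_normal_iff[OF assms] by simp

end

lemma C1_domain_graph_boundary:
  fixes \<Omega> :: "(real ^ 'd) set"
  assumes "C1_domain \<Omega>" "x0 \<in> frontier \<Omega>"
  obtains r e g a where "0 < r" "graph_boundary e g a \<Omega> (ball x0 r)"
proof -
  obtain r e g a where *: "0 < r" "C1_graph e g a" "\<Omega> \<inter> ball x0 r = {x \<in> ball x0 r. g x < x \<bullet> e}"
    by (rule C1_domain_graph[OF assms])
  moreover have "open \<Omega>" using assms(1) by (simp add: C1_domain_def domain_def)
  ultimately have "graph_boundary e g a \<Omega> (ball x0 r)"
    by (simp add: graph_boundary_def graph_boundary_axioms_def)
  then show thesis using that *(1) by blast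
qed

text \<open>Uniqueness comes from a local graph, so a normal that is guessed geometrically, as for
  the ball, only has to be checked against the definition.\<close>

lemma outward_unit_normal_eqI:
  fixes \<Omega> :: "(real ^ 'd) set"
  assumes "C1_domain \<Omega>" "x \<in> frontier \<Omega>" "is_outward_unit_normal \<Omega> x \<nu>"
  shows "outward_unit_normal \<Omega> x = \<nu>"
proof -
  obtain r e g a where r: "0 < r" and "graph_boundary e g a \<Omega> (ball x r)"
    by (rule C1_domain_graph_boundary[OF assms(1,2)])
  then interpret graph_boundary e g a \<Omega> "ball x r" by simp
  have "x \<in> ball x r" using r by simp
  then show ?thesis
    using assms(2,3) frontier_iff is_outward_unit_normal_iff outward_unit_normal_graph by metis
qed

subsection \<open>The divergence theorem\<close>

text \<open>Only the diagonal partial derivatives enter the divergence, so nothing more is required of the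
  field.\<close>

definition diagonal_partials :: "('a::euclidean_space \<Rightarrow> 'a) \<Rightarrow> ('a \<Rightarrow> 'a \<Rightarrow> real) \<Rightarrow> bool" where
  "diagonal_partials F d \<longleftrightarrow> continuous_on UNIV F \<and>
     (\<forall>b\<in>Basis. continuous_on UNIV (d b) \<and>
        (\<forall>x. ((\<lambda>t. F (x + t *\<^sub>R b) \<bullet> b) has_real_derivative d b x) (at 0)))"

definition divergence :: "('a::euclidean_space \<Rightarrow> 'a \<Rightarrow> real) \<Rightarrow> 'a \<Rightarrow> real" where
  "divergence d x = (\<Sum>b\<in>Basis. d b x)"

lemma diagonal_partialsD:
  assumes "diagonal_partials F d"
  shows "continuous_on A F"
    and "b \<in> Basis \<Longrightarrow> continuous_on A (d b)"
    and "b \<in> Basis \<Longrightarrow> ((\<lambda>t. F (x + t *\<^sub>R b) \<bullet> b) has_real_derivative d b x) (at 0)"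
  using assms by (auto simp: diagonal_partials_def intro: continuous_on_subset)

lemma continuous_divergence: "diagonal_partials F d \<Longrightarrow> continuous_on A (divergence d)"
  unfolding divergence_def by (intro continuous_intros diagonal_partialsD(2))

definition divergence_theorem_for :: "(real ^ 'd) set \<Rightarrow> (real ^ 'd \<Rightarrow> real ^ 'd) \<Rightarrow> (real ^ 'd \<Rightarrow> real ^ 'd \<Rightarrow> real) \<Rightarrow> bool" where
  "divergence_theorem_for \<Omega> F d \<longleftrightarrow>
     integrable (surface_measure \<Omega>) (\<lambda>x. F x \<bullet> outward_unit_normal \<Omega> x) \<and>
     (LINT x|lborel. indicator \<Omega> x * divergence d x) =
       (LINT x|surface_measure \<Omega>. F x \<bullet> outward_unit_normal \<Omega> x)"

lemma integral_surface_measure: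
  fixes f :: "real ^ 'd \<Rightarrow> real"
  shows "integrable (surface_measure \<Omega>) f \<longleftrightarrow>
      integrable (hausdorff_measure (CARD('d) - 1)) (\<lambda>x. indicator (frontier \<Omega>) x * f x)"
    and "(LINT x|surface_measure \<Omega>. f x) =
      (LINT x|hausdorff_measure (CARD('d) - 1). indicator (frontier \<Omega>) x * f x)"
  by (simp_all add: surface_measure_def integrable_restrict_space integral_restrict_space)

lemma space_surface_measure: "space (surface_measure \<Omega>) = frontier \<Omega>"
  by (simp add: surface_measure_def space_restrict_space)

lemma divergence_theorem_for_zero:
  assumes "\<And>x. x \<in> \<Omega> \<Longrightarrow> divergence d x = 0" "\<And>x. x \<in> frontier \<Omega> \<Longrightarrow> F x = 0"
  shows "divergence_theorem_for \<Omega> F d"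
proof -
  have 1: "(\<lambda>x. indicator \<Omega> x * divergence d x) = (\<lambda>x. 0)" using assms(1) by (auto simp: indicator_def)
  have "integrable (surface_measure \<Omega>) (\<lambda>x. F x \<bullet> outward_unit_normal \<Omega> x) \<longleftrightarrow>
      integrable (surface_measure \<Omega>) (\<lambda>x. 0 :: real)"
    by (intro Bochner_Integration.integrable_cong) (auto simp: space_surface_measure assms(2))
  moreover have "(LINT x|surface_measure \<Omega>. F x \<bullet> outward_unit_normal \<Omega> x) = (LINT x|surface_measure \<Omega>. 0)"
    by (intro Bochner_Integration.integral_cong) (auto simp: space_surface_measure assms(2))
  ultimately show ?thesis unfolding divergence_theorem_for_def 1 by simp
qed

context graph_boundary
begin

text \<open>Integrands in graph coordinates are controlled only through the lifted point, hence not
  along \<open>e\<close>. The slab restores a bounded support: the projection has norm at most 2 R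
  and the component along \<open>e\<close> adds at most 1.\<close>

lemma integrable_lift:
  fixes f :: "real ^ 'd \<Rightarrow> real"
  assumes f: "continuous_on UNIV f" and K: "compact K" "\<And>x. lift_graph x \<notin> K \<Longrightarrow> f x = 0"
  shows "integrable lborel (\<lambda>x. indicator (slab e) x * f x)"
proof -
  obtain R where R: "\<And>x. x \<in> K \<Longrightarrow> norm x \<le> R" using K(1) by (meson bounded_iff compact_imp_bounded)
  define C where "C = {x \<in> slab e. lift_graph x \<in> K}"
  have "norm x \<le> 2 * R + 1" if "x \<in> C" for x
  proof -
    have x: "x \<in> slab e" "norm (lift_graph x) \<le> R" using that R by (auto simp: C_def)
    have "proj_perp e x = lift_graph x - (lift_graph x \<bullet> e) *\<^sub>R e"
      by (metis proj_lift proj_perp_def)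
    then have "norm (proj_perp e x) \<le> norm (lift_graph x) + \<bar>lift_graph x \<bullet> e\<bar>"
      using norm_triangle_ineq4[of "lift_graph x" "(lift_graph x \<bullet> e) *\<^sub>R e"] norm_e
      by (simp del: lift_e)
    moreover have "\<bar>lift_graph x \<bullet> e\<bar> \<le> norm (lift_graph x)"
      using Cauchy_Schwarz_ineq2[of "lift_graph x" e] norm_e by simp
    moreover have "norm x \<le> norm (proj_perp e x) + \<bar>x \<bullet> e\<bar>"
      using norm_triangle_ineq[of "proj_perp e x" "(x \<bullet> e) *\<^sub>R e"] norm_e by (simp add: proj_perp_def)
    moreover have "\<bar>x \<bullet> e\<bar> \<le> 1" using x(1) by (simp add: slab_def)
    ultimately show ?thesis using x(2) by linarith
  qed
  then have "bounded C" by (auto simp: bounded_iff)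
  moreover have "closed C"
  proof -
    have "C = slab e \<inter> lift_graph -` K" by (auto simp: C_def)
    then show ?thesis
      using K(1) by (simp only:) (intro closed_Int closed_slab closed_vimage cont_lift compact_imp_closed)
  qed
  ultimately have "compact C" by (simp add: compact_eq_bounded_closed)
  then have "integrable lborel (\<lambda>x. indicator C x *\<^sub>R f x)"
    by (intro borel_integrable_compact continuous_on_subset[OF f]) auto
  moreover have "(\<lambda>x. indicator C x *\<^sub>R f x) = (\<lambda>x. indicator (slab e) x * f x)"
    using K(2) by (auto simp: C_def indicator_def fun_eq_iff)
  ultimately show ?thesis by simp
qed

text \<open>The one-directional formula above a graph is applied to each component of
  \<open>F\<close> along its own basis vector and summed. The area factor cancels the normalisation
  of the normal.\<close>

lemma local_divergence_theorem:
  assumes F: "diagonal_partials F d" and K: "compact K" "K \<subseteq> U" "\<And>x. x \<notin> K \<Longrightarrow> F x = 0"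
  shows "divergence_theorem_for \<Omega> F d"
proof -
  let ?H = "hausdorff_measure (CARD('d) - 1) :: (real ^ 'd) measure"
  define h where "h x = F x \<bullet> graph_normal x" for x
  have cF: "continuous_on A F" for A using F by (rule diagonal_partialsD)
  have cn: "continuous_on UNIV graph_normal"
    unfolding graph_normal_def using area_pos cont_a
    by (intro continuous_intros cont_area) (auto simp: less_imp_neq[symmetric])
  have ch: "continuous_on UNIV h" unfolding h_def by (intro continuous_intros cF cn)
  have hm: "h \<in> borel_measurable borel" by (rule borel_measurable_continuous_onI[OF ch])
  have cFl: "continuous_on UNIV (\<lambda>x. F (lift_graph x))"
    by (rule continuous_on_compose2[OF cF[of UNIV] cont_lift]) auto
  have Jh: "area_factor x * h (lift_graph x) = F (lift_graph x) \<bullet> (a x - e)" for x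
    using area_pos[of x] by (simp add: h_def graph_normal_def area_factor_def)
  have dom: "indicator (frontier \<Omega>) x * (F x \<bullet> outward_unit_normal \<Omega> x) = indicator graph_of x * h x" for x
  proof (cases "x \<in> U")
    case True
    then show ?thesis
      using frontier_iff[OF True] outward_unit_normal_graph[OF True] by (auto simp: indicator_def h_def)
  next
    case False
    then have "F x = 0" using K by blast
    then show ?thesis by (simp add: h_def)
  qed
  have "integrable lborel (\<lambda>x. indicator (slab e) x * (area_factor x * h (lift_graph x)))"
    unfolding Jh
    by (rule integrable_lift[OF _ K(1)]) (auto intro!: continuous_intros cFl cont_a simp: K(3))
  then have int: "integrable (surface_measure \<Omega>) (\<lambda>x. F x \<bullet> outward_unit_normal \<Omega> x)"
    unfolding integral_surface_measure dom integral_graph(1)[OF hm] .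
  have "(LINT x|surface_measure \<Omega>. F x \<bullet> outward_unit_normal \<Omega> x)
      = (LINT x|lborel. indicator (slab e) x * (F (lift_graph x) \<bullet> (a x - e)))"
    unfolding integral_surface_measure dom integral_graph(2)[OF hm] Jh ..
  also have "\<dots> = (LINT x|lborel. (\<Sum>b\<in>Basis. indicator (slab e) x * ((F (lift_graph x) \<bullet> b) * ((a x - e) \<bullet> b))))"
    by (subst euclidean_inner) (simp add: sum_distrib_left)
  also have "\<dots> = (\<Sum>b\<in>Basis. LINT x|lborel. indicator (slab e) x * ((F (lift_graph x) \<bullet> b) * ((a x - e) \<bullet> b)))"
  proof (rule Bochner_Integration.integral_sum)
    fix b :: "real ^ 'd" assume "b \<in> Basis"
    show "integrable lborel (\<lambda>x. indicator (slab e) x * ((F (lift_graph x) \<bullet> b) * ((a x - e) \<bullet> b)))"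
      by (rule integrable_lift[OF _ K(1)]) (auto intro!: continuous_intros cFl cont_a simp: K(3))
  qed
  also have "\<dots> = (\<Sum>b\<in>Basis. LINT x|lborel. indicator \<Omega> x * d b x)"
  proof (rule sum.cong[OF refl])
    fix b :: "real ^ 'd" assume b: "b \<in> Basis"
    have d0: "d b x = 0" if "x \<notin> K" for x
      using line_derivative_support[OF diagonal_partialsD(3)[OF F b] compact_imp_closed[OF K(1)] _ that] K(3) by simp
    have "(LINT x|lborel. indicator (slab e) x * ((F (lift_graph x) \<bullet> b) * ((a x - e) \<bullet> b)))
        = (LINT x|lborel. indicator {x. g x < x \<bullet> e} x * d b x)"
      by (rule gauss_green_graph[symmetric, OF _ diagonal_partialsD(2,3)[OF F b] K(1)])
         (auto intro!: continuous_intros cF simp: K(3))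
    \<comment> \<open>The region above the graph agrees with \<Omega> only within \<open>U\<close>,
      but \<open>d b\<close> vanishes outside \<open>K\<close>.\<close>
    also have "(\<lambda>x. indicator {x. g x < x \<bullet> e} x * d b x) = (\<lambda>x. indicator \<Omega> x * d b x)"
    proof
      fix x
      show "indicator {x. g x < x \<bullet> e} x * d b x = indicator \<Omega> x * d b x"
        using above_iff[of x] d0[of x] K(2) by (cases "x \<in> K") (auto simp: indicator_def)
    qed
    finally show "(LINT x|lborel. indicator (slab e) x * ((F (lift_graph x) \<bullet> b) * ((a x - e) \<bullet> b)))
        = (LINT x|lborel. indicator \<Omega> x * d b x)" .
  qed
  also have "\<dots> = (LINT x|lborel. (\<Sum>b\<in>Basis. indicator \<Omega> x * d b x))"
  proof (rule Bochner_Integration.integral_sum[symmetric])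
    fix b :: "real ^ 'd" assume b: "b \<in> Basis"
    have d0: "d b x = 0" if "x \<notin> K" for x
      using line_derivative_support[OF diagonal_partialsD(3)[OF F b] compact_imp_closed[OF K(1)] _ that] K(3) by simp
    have "integrable lborel (d b)"
      by (rule integrable_compact_support[OF diagonal_partialsD(2)[OF F b] K(1) d0])
    then have "integrable lborel (\<lambda>x. indicator \<Omega> x *\<^sub>R d b x)"
      using open_dom by (intro integrable_mult_indicator) auto
    then show "integrable lborel (\<lambda>x. indicator \<Omega> x * d b x)" by simp
  qed
  also have "\<dots> = (LINT x|lborel. indicator \<Omega> x * divergence d x)"
    by (simp add: divergence_def sum_distrib_left)
  finally show ?thesis unfolding divergence_theorem_for_def using int by simp
qed

end

text \<open>Both sides are 0: each partial derivative has integral 0 and \<open>F\<close> vanishes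
  on the frontier.\<close>

lemma divergence_theorem_inside:
  fixes F :: "real ^ 'd \<Rightarrow> real ^ 'd"
  assumes \<Omega>: "open \<Omega>" and F: "diagonal_partials F d"
    and K: "compact K" "K \<subseteq> \<Omega>" "\<And>x. x \<notin> K \<Longrightarrow> F x = 0"
  shows "divergence_theorem_for \<Omega> F d"
proof -
  have d0: "d b x = 0" if "x \<notin> K" "b \<in> Basis" for b x
    using line_derivative_support[OF diagonal_partialsD(3)[OF F that(2)] compact_imp_closed[OF K(1)] _ that(1)] K(3) by simp
  have int: "integrable lborel (d b)" if "b \<in> Basis" for b
    by (rule integrable_compact_support[OF diagonal_partialsD(2)[OF F that] K(1)]) (simp add: d0 that)
  have "(LINT x|lborel. indicator \<Omega> x * divergence d x) = (LINT x|lborel. (\<Sum>b\<in>Basis. d b x))"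
  proof (rule Bochner_Integration.integral_cong[OF refl])
    fix x
    show "indicator \<Omega> x * divergence d x = (\<Sum>b\<in>Basis. d b x)"
    proof (cases "x \<in> \<Omega>")
      case False
      then have "x \<notin> K" using K(2) by blast
      then show ?thesis using False by (simp add: d0)
    qed (simp add: divergence_def)
  qed
  also have "\<dots> = (\<Sum>b\<in>Basis. LINT x|lborel. d b x)"
    by (rule Bochner_Integration.integral_sum) (rule int)
  also have "\<dots> = 0"
  proof (rule sum.neutral, rule ballI)
    fix b :: "real ^ 'd" assume b: "b \<in> Basis"
    show "(LINT x|lborel. d b x) = 0"
      by (rule integral_line_derivative_0[OF _ diagonal_partialsD(2,3)[OF F b] K(1)])
         (auto intro!: continuous_intros diagonal_partialsD(1)[OF F] simp: K(3))
  qed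
  finally have 1: "(LINT x|lborel. indicator \<Omega> x * divergence d x) = 0" .
  have F0: "F x = 0" if "x \<in> frontier \<Omega>" for x
    using that \<Omega> K by (auto simp: frontier_def interior_open)
  \<comment> \<open>The partials are replaced by 0 only to extract the statement on the boundary
    integral, which does not mention them.\<close>
  have "divergence_theorem_for \<Omega> F (\<lambda>_ _. 0)"
    by (rule divergence_theorem_for_zero) (auto simp: divergence_def F0)
  then show ?thesis using 1 by (simp add: divergence_theorem_for_def divergence_def)
qed

text \<open>A \<open>ramp\<close> in the squared distance, which keeps it C1 at the centre. Here
  9/16 is (3/4)^2 and 5/16 is 9/16 - 1/4, so it falls from 1 at distance r/2 to 0 at distance
  3r/4.\<close>

definition cutoff :: "'a::euclidean_space \<Rightarrow> real \<Rightarrow> 'a \<Rightarrow> real" where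
  "cutoff p r x = ramp ((9/16 * r\<^sup>2 - (norm (x - p))\<^sup>2) / (5/16 * r\<^sup>2))"

definition cutoff_deriv :: "'a::euclidean_space \<Rightarrow> real \<Rightarrow> 'a \<Rightarrow> 'a \<Rightarrow> real" where
  "cutoff_deriv p r b x = ramp' ((9/16 * r\<^sup>2 - (norm (x - p))\<^sup>2) / (5/16 * r\<^sup>2)) * (- 2 * ((x - p) \<bullet> b) / (5/16 * r\<^sup>2))"

lemma cutoff_eq_1: "0 < r \<Longrightarrow> norm (x - p) \<le> r / 2 \<Longrightarrow> cutoff p r x = 1"
proof -
  assume r: "0 < r" and n: "norm (x - p) \<le> r / 2"
  have "(norm (x - p))\<^sup>2 \<le> (r / 2)\<^sup>2" using n by (intro power_mono) auto
  then have "5/16 * r\<^sup>2 \<le> 9/16 * r\<^sup>2 - (norm (x - p))\<^sup>2" by (simp add: power_divide)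
  then show ?thesis unfolding cutoff_def using r by (intro ramp_ge_1) simp
qed

lemma cutoff_eq_0: "0 < r \<Longrightarrow> 3 / 4 * r \<le> norm (x - p) \<Longrightarrow> cutoff p r x = 0"
proof -
  assume r: "0 < r" and n: "3 / 4 * r \<le> norm (x - p)"
  have "(3 / 4 * r)\<^sup>2 \<le> (norm (x - p))\<^sup>2" using n r by (intro power_mono) auto
  then have "9/16 * r\<^sup>2 - (norm (x - p))\<^sup>2 \<le> 0" by (simp add: power_mult_distrib power_divide)
  then show ?thesis unfolding cutoff_def using r by (intro ramp_le_0) (simp add: divide_nonpos_pos)
qed

lemma continuous_cutoff: "continuous_on A (cutoff p r)"
  unfolding cutoff_def divide_inverse
  by (intro continuous_on_compose2[OF cont_ramp[of UNIV]] continuous_intros) auto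

lemma continuous_cutoff_deriv: "continuous_on A (cutoff_deriv p r b)"
  unfolding cutoff_deriv_def divide_inverse
  by (intro continuous_intros continuous_on_compose2[OF cont_ramp'[of UNIV]]) auto

lemma norm_square_line_deriv:
  "((\<lambda>t. (norm (x + t *\<^sub>R b))\<^sup>2) has_real_derivative 2 * (x \<bullet> b)) (at 0)"
proof -
  have "(\<lambda>t. (norm (x + t *\<^sub>R b))\<^sup>2) = (\<lambda>t. x \<bullet> x + 2 * t * (x \<bullet> b) + t\<^sup>2 * (b \<bullet> b))"
    unfolding power2_norm_eq_inner
    by (simp add: fun_eq_iff inner_add_left inner_add_right inner_commute power2_eq_square algebra_simps)
  then show ?thesis by (auto intro!: derivative_eq_intros)
qed

lemma cutoff_line_deriv:
  "((\<lambda>t. cutoff p r (x + t *\<^sub>R b)) has_real_derivative cutoff_deriv p r b x) (at 0)"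
proof -
  have "((\<lambda>t. (9/16 * r\<^sup>2 - (norm ((x - p) + t *\<^sub>R b))\<^sup>2) / (5/16 * r\<^sup>2)) has_real_derivative
      (0 - 2 * ((x - p) \<bullet> b)) / (5/16 * r\<^sup>2)) (at 0)"
    by (intro DERIV_cdivide DERIV_diff DERIV_const norm_square_line_deriv)
  then have "((\<lambda>t. (9/16 * r\<^sup>2 - (norm (x + t *\<^sub>R b - p))\<^sup>2) / (5/16 * r\<^sup>2)) has_real_derivative
      (- 2 * ((x - p) \<bullet> b) / (5/16 * r\<^sup>2))) (at 0)"
    by (simp add: algebra_simps)
  then show ?thesis
    unfolding cutoff_def cutoff_deriv_def
    by (rule DERIV_chain2[where f = ramp, rotated])
       (use ramp_deriv[of "(9/16 * r\<^sup>2 - (norm (x - p))\<^sup>2) / (5/16 * r\<^sup>2)"] in simp)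
qed

lemma diagonal_partials_mult:
  fixes F :: "'a::euclidean_space \<Rightarrow> 'a"
  assumes F: "diagonal_partials F d" and \<beta>: "continuous_on UNIV \<beta>"
    and \<beta>': "\<And>b. b \<in> Basis \<Longrightarrow> continuous_on UNIV (\<beta>' b)"
      "\<And>b x. b \<in> Basis \<Longrightarrow> ((\<lambda>t. \<beta> (x + t *\<^sub>R b)) has_real_derivative \<beta>' b x) (at 0)"
  shows "diagonal_partials (\<lambda>x. \<beta> x *\<^sub>R F x) (\<lambda>b x. \<beta>' b x * (F x \<bullet> b) + \<beta> x * d b x)"
  unfolding diagonal_partials_def
proof (intro conjI ballI allI)
  show "continuous_on UNIV (\<lambda>x. \<beta> x *\<^sub>R F x)"
    by (intro continuous_intros \<beta> diagonal_partialsD(1)[OF F])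
  fix b :: 'a assume b: "b \<in> Basis"
  show "continuous_on UNIV (\<lambda>x. \<beta>' b x * (F x \<bullet> b) + \<beta> x * d b x)"
    by (intro continuous_intros \<beta> \<beta>'(1) b diagonal_partialsD[OF F])
  show "((\<lambda>t. (\<beta> (x + t *\<^sub>R b) *\<^sub>R F (x + t *\<^sub>R b)) \<bullet> b) has_real_derivative
      \<beta>' b x * (F x \<bullet> b) + \<beta> x * d b x) (at 0)" for x
    using DERIV_mult[OF \<beta>'(2)[OF b, of x] diagonal_partialsD(3)[OF F b, of x]]
    by (simp add: algebra_simps)
qed

lemma integrable_indicator_continuous:
  fixes f :: "'a::euclidean_space \<Rightarrow> real"
  assumes "open \<Omega>" "bounded \<Omega>" "continuous_on UNIV f"
  shows "integrable lborel (\<lambda>x. indicator \<Omega> x * f x)"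
proof -
  have "integrable lborel (\<lambda>x. indicator (closure \<Omega>) x *\<^sub>R f x)"
    using assms by (intro borel_integrable_compact continuous_on_subset[OF assms(3)]) auto
  then have "integrable lborel (\<lambda>x. indicator \<Omega> x *\<^sub>R (indicator (closure \<Omega>) x *\<^sub>R f x))"
    by (rule integrable_mult_indicator[rotated]) (use assms in simp)
  moreover have "(\<lambda>x. indicator \<Omega> x *\<^sub>R (indicator (closure \<Omega>) x *\<^sub>R f x)) = (\<lambda>x. indicator \<Omega> x * f x)"
    using closure_subset[of \<Omega>] by (auto simp: indicator_def fun_eq_iff)
  ultimately show ?thesis by simp
qed

text \<open>Instead of a partition of unity the field is peeled off ball by ball. Multiplication by
  a cutoff splits off a part supported in one good ball, and the rest vanishes on the half-sized
  ball. After finitely many steps the field is 0 on the closure of \<Omega>.\<close>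

theorem divergence_theorem:
  fixes \<Omega> :: "(real ^ 'd) set"
  assumes \<Omega>: "C1_domain \<Omega>" and F: "diagonal_partials F d"
  shows "divergence_theorem_for \<Omega> F d"
proof -
  have op: "open \<Omega>" and bd: "bounded \<Omega>" using \<Omega> by (auto simp: C1_domain_def domain_def)
  \<comment> \<open>Fields supported in a compact part of the ball satisfy the theorem: by the
    interior case for \<open>x\<close> in \<Omega>, by the graph case for \<open>x\<close> on the
    frontier.\<close>
  let ?good = "\<lambda>x r. 0 < r \<and> (\<forall>F d K. diagonal_partials F d \<longrightarrow> compact K \<longrightarrow> K \<subseteq> ball x r \<longrightarrow>
      (\<forall>x. x \<notin> K \<longrightarrow> F x = 0) \<longrightarrow> divergence_theorem_for \<Omega> F d)"
  have "\<exists>r. ?good x r" if x: "x \<in> closure \<Omega>" for x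
  proof (cases "x \<in> \<Omega>")
    case True
    then obtain r where r: "0 < r" "ball x r \<subseteq> \<Omega>" using op openE by blast
    have "?good x r"
      using r by (auto intro: divergence_theorem_inside[OF op])
    then show ?thesis by blast
  next
    case False
    then have "x \<in> frontier \<Omega>" using x op by (simp add: frontier_def interior_open)
    then obtain r e g a where r: "0 < r" and gb: "graph_boundary e g a \<Omega> (ball x r)"
      by (rule C1_domain_graph_boundary[OF \<Omega>])
    have "?good x r"
      using r by (auto intro: graph_boundary.local_divergence_theorem[OF gb])
    then show ?thesis by blast
  qed
  then obtain r where r: "\<And>x. x \<in> closure \<Omega> \<Longrightarrow> ?good x (r x)" by metis
  have comp: "compact (closure \<Omega>)" using bd by simp
  have "x \<in> ball x (r x / 2)" if "x \<in> closure \<Omega>" for x using r[OF that] by simp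
  then have cov: "closure \<Omega> \<subseteq> (\<Union>x\<in>closure \<Omega>. ball x (r x / 2))" by blast
  obtain I where I: "I \<subseteq> closure \<Omega>" "finite I" "closure \<Omega> \<subseteq> (\<Union>x\<in>I. ball x (r x / 2))"
    by (rule compactE_image[OF comp _ cov]) auto
  have "divergence_theorem_for \<Omega> F d"
    if "diagonal_partials F d" "J \<subseteq> I" "\<And>x. x \<in> closure \<Omega> \<Longrightarrow> x \<notin> (\<Union>p\<in>J. ball p (r p / 2)) \<Longrightarrow> F x = 0" for J F d
    using finite_subset[OF that(2) I(2)] that
  proof (induction J arbitrary: F d)
    case empty
    have "divergence d x = 0" if x: "x \<in> \<Omega>" for x
    proof -
      \<comment> \<open>The field is known to vanish only on the closure of \<Omega>; its partials
        vanish as well at points of the open set \<Omega>.\<close>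
      have "F y = 0" if "y \<in> \<Omega>" for y using empty(3)[of y] that closure_subset[of \<Omega>] by auto
      then have "d b x = 0" if "b \<in> Basis" for b
        using line_derivative_support[OF diagonal_partialsD(3)[OF empty(1) that], of "- \<Omega>" x] op x
        by (simp add: closed_Compl)
      then show ?thesis by (simp add: divergence_def)
    qed
    then show ?case
      using empty(3) by (intro divergence_theorem_for_zero) (auto simp: frontier_def)
  next
    case (insert p J)
    have p: "p \<in> closure \<Omega>" and rp: "0 < r p" using insert.prems(2) I(1) r by auto
    note cutoff_C1 = continuous_cutoff continuous_cutoff_deriv cutoff_line_deriv
    let ?\<beta> = "cutoff p (r p)" and ?\<beta>' = "cutoff_deriv p (r p)"
    let ?F1 = "\<lambda>x. ?\<beta> x *\<^sub>R F x" and ?d1 = "\<lambda>b x. ?\<beta>' b x * (F x \<bullet> b) + ?\<beta> x * d b x"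
    let ?F2 = "\<lambda>x. (1 - ?\<beta> x) *\<^sub>R F x" and ?d2 = "\<lambda>b x. (0 - ?\<beta>' b x) * (F x \<bullet> b) + (1 - ?\<beta> x) * d b x"
    have 1: "diagonal_partials ?F1 ?d1"
      by (rule diagonal_partials_mult[OF insert.prems(1)]) (rule cutoff_C1)+
    have 2: "diagonal_partials ?F2 ?d2"
      by (rule diagonal_partials_mult[OF insert.prems(1)]) (intro continuous_intros DERIV_diff DERIV_const cutoff_C1)+
    have D1: "divergence_theorem_for \<Omega> ?F1 ?d1"
    proof -
      have "cball p (3 / 4 * r p) \<subseteq> ball p (r p)" using rp by (auto simp: cball_subset_ball_iff)
      moreover have "?F1 x = 0" if "x \<notin> cball p (3 / 4 * r p)" for x
        using that rp by (simp add: cutoff_eq_0 dist_norm norm_minus_commute)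
      ultimately show ?thesis using r[OF p] 1 compact_cball by blast
    qed
    have D2: "divergence_theorem_for \<Omega> ?F2 ?d2"
    proof (rule insert.IH[OF 2])
      show "J \<subseteq> I" using insert.prems(2) by simp
      fix x assume x: "x \<in> closure \<Omega>" "x \<notin> (\<Union>p\<in>J. ball p (r p / 2))"
      show "?F2 x = 0"
      proof (cases "x \<in> ball p (r p / 2)")
        case True
        then have "?\<beta> x = 1" using rp by (intro cutoff_eq_1) (auto simp: dist_norm norm_minus_commute)
        then show ?thesis by simp
      next
        case False
        then have "F x = 0" using x by (intro insert.prems(3)) auto
        then show ?thesis by simp
      qed
    qed
    have int: "integrable lborel (\<lambda>x. indicator \<Omega> x * divergence d x)" if "diagonal_partials F d"
      for F :: "real ^ 'd \<Rightarrow> real ^ 'd" and d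
      by (rule integrable_indicator_continuous[OF op bd continuous_divergence[OF that]])
    have dv: "indicator \<Omega> x * divergence d x
        = indicator \<Omega> x * divergence ?d1 x + indicator \<Omega> x * divergence ?d2 x" for x
    proof -
      have "divergence d x = divergence ?d1 x + divergence ?d2 x"
        by (simp add: divergence_def sum.distrib[symmetric] algebra_simps)
      then show ?thesis by (simp only: distrib_left)
    qed
    have Fv: "F x \<bullet> outward_unit_normal \<Omega> x
        = ?F1 x \<bullet> outward_unit_normal \<Omega> x + ?F2 x \<bullet> outward_unit_normal \<Omega> x" for x
      by (simp add: algebra_simps)
    note D1 = D1[unfolded divergence_theorem_for_def] and D2 = D2[unfolded divergence_theorem_for_def]
    show ?case
      unfolding divergence_theorem_for_def dv Fv
      using Bochner_Integration.integral_add[OF int[OF 1] int[OF 2]]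
        Bochner_Integration.integral_add[OF D1[THEN conjunct1] D2[THEN conjunct1]]
        Bochner_Integration.integrable_add[OF D1[THEN conjunct1] D2[THEN conjunct1]]
        D1[THEN conjunct2] D2[THEN conjunct2]
      by (simp only:)
  qed
  from this[OF F order_refl] show ?thesis using I(3) by blast
qed

subsection \<open>The unit ball\<close>

text \<open>Bounded away from 1, so that the graph function $-\sqrt{1-|y|^2}$ of the sphere can be continued to a
  $C^1$ function on the whole space.\<close>

definition clip :: "real \<Rightarrow> real" where
  "clip s = s - (max 0 (s - 1/4))\<^sup>2"

definition clip' :: "real \<Rightarrow> real" where
  "clip' s = 1 - 2 * max 0 (s - 1/4)"

lemma clip_deriv: "(clip has_real_derivative clip' s) (at s)"
proof -
  have "((\<lambda>s. (max 0 (s - 1/4))\<^sup>2) has_real_derivative 2 * max 0 (s - 1/4)) (at s)"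
    using max_0_square_deriv[of "s - 1/4"] DERIV_shift[of "\<lambda>s. (max 0 s)\<^sup>2" _ s "- (1/4)"] by simp
  then show ?thesis
    unfolding clip_def clip'_def by (intro DERIV_diff DERIV_ident)
qed

lemma clip_le: "clip s \<le> 1/2"
proof -
  \<comment> \<open>The parabola peaks at t = 1/2, where its value is exactly 1/2.\<close>
  have "1/4 + t - t\<^sup>2 \<le> 1/2" for t :: real
    using zero_le_power2[of "t - 1/2"] by (simp add: power2_eq_square algebra_simps)
  from this[of "s - 1/4"] show ?thesis by (simp add: clip_def max_def)
qed

lemma clip_eq: "s \<le> 1/4 \<Longrightarrow> clip s = s" by (simp add: clip_def)

lemma C1_lower_hemisphere: "C1 (\<lambda>y :: 'a::euclidean_space. - sqrt (1 - clip (y \<bullet> y)))"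
proof -
  define w :: "'a \<Rightarrow> 'a" where "w y = (clip' (y \<bullet> y) / sqrt (1 - clip (y \<bullet> y))) *\<^sub>R y" for y
  have pos: "0 < 1 - clip s" for s using clip_le[of s] by simp
  have q: "((\<lambda>s. - sqrt (1 - clip s)) has_real_derivative clip' s / (2 * sqrt (1 - clip s))) (at s)" for s
  proof -
    have "((\<lambda>s. 1 - clip s) has_real_derivative (0 - clip' s)) (at s)"
      by (intro DERIV_diff DERIV_const clip_deriv)
    then have "((\<lambda>s. sqrt (1 - clip s)) has_real_derivative (inverse (sqrt (1 - clip s)) / 2) * (0 - clip' s)) (at s)"
      by (rule DERIV_chain2[where f = sqrt, rotated]) (rule DERIV_real_sqrt[OF pos])
    from DERIV_minus[OF this] show ?thesis by (rule DERIV_cong) (simp add: field_simps)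
  qed
  have "((\<lambda>y. - sqrt (1 - clip (y \<bullet> y))) has_derivative (\<lambda>v. w y \<bullet> v)) (at y)" for y
  proof -
    have "((\<lambda>y. y \<bullet> y) has_derivative (\<lambda>v. 2 * (y \<bullet> v))) (at y)"
      by (auto intro!: derivative_eq_intros simp: inner_commute)
    from DERIV_compose_FDERIV[where f = "\<lambda>s. - sqrt (1 - clip s)", OF q this]
    show ?thesis by (rule has_derivative_eq_rhs) (simp add: w_def fun_eq_iff)
  qed
  moreover have "continuous_on UNIV w"
  proof -
    have cc: "continuous_on UNIV clip" using DERIV_continuous[OF clip_deriv] by (simp add: continuous_on_eq_continuous_at)
    have 1: "continuous_on UNIV (\<lambda>y :: 'a. clip (y \<bullet> y))"
      by (rule continuous_on_compose2[OF cc]) (auto intro!: continuous_intros)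
    have 2: "continuous_on UNIV (\<lambda>y :: 'a. clip' (y \<bullet> y))"
      unfolding clip'_def by (intro continuous_intros)
    have 3: "clip s \<noteq> 1" for s using clip_le[of s] by linarith
    show ?thesis
      unfolding w_def by (intro continuous_intros 1 2) (simp add: 3[symmetric])
  qed
  then have "continuous_on UNIV (\<lambda>y. blinfun_inner_right (w y))"
    by (intro bounded_linear.continuous_on[OF bounded_linear_blinfun_inner_right])
  ultimately show ?thesis
    unfolding C1_def by (intro exI[of _ "\<lambda>y. blinfun_inner_right (w y)"]) (simp add: blinfun_inner_right.rep_eq)
qed

text \<open>Seen from \<open>x0\<close> in the inward direction \<open>e = - x0\<close>, the ball
  lies above the lower hemisphere. Within distance 1/2 of \<open>x0\<close> the projection has
  squared norm at most 1/4, where \<open>clip\<close> is the identity, and the coordinate along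
  \<open>e\<close> is negative, so the upper hemisphere does not interfere.\<close>

lemma C1_domain_unit_ball: "C1_domain (ball (0 :: 'a::euclidean_space) 1)"
  unfolding C1_domain_def domain_def
proof (intro conjI ballI)
  show "connected (ball (0::'a) 1)" by (intro convex_connected convex_ball)
  fix x0 :: 'a assume "x0 \<in> frontier (ball 0 1)"
  then have n0: "norm x0 = 1" by simp
  define e where "e = - x0"
  have ne: "norm e = 1" and ee: "e \<bullet> e = 1" using n0 by (auto simp: e_def dot_square_norm)
  let ?\<gamma> = "\<lambda>y :: 'a. - sqrt (1 - clip (y \<bullet> y))"
  have "norm x < 1 \<longleftrightarrow> ?\<gamma> (x - (x \<bullet> e) *\<^sub>R e) < x \<bullet> e" if x: "norm (x - x0) < 1/2" for x
  proof -
    let ?y = "x - (x \<bullet> e) *\<^sub>R e" and ?t = "x \<bullet> e"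
    have yy: "?y \<bullet> ?y = x \<bullet> x - ?t\<^sup>2"
      using ee by (simp add: inner_diff_left inner_diff_right inner_commute power2_eq_square)
    have "x - x0 = ?y + (?t + 1) *\<^sub>R e" by (simp add: e_def algebra_simps)
    moreover have "orthogonal ?y ((?t + 1) *\<^sub>R e)" using ee by (simp add: orthogonal_def inner_diff_left)
    ultimately have "(norm (x - x0))\<^sup>2 = ?y \<bullet> ?y + (?t + 1)\<^sup>2"
      using ne by (simp only: norm_add_Pythagorean) (simp add: power2_norm_eq_inner power_mult_distrib)
    moreover have "(norm (x - x0))\<^sup>2 < (1/2)\<^sup>2" using x by (intro power_strict_mono) auto
    ultimately have "?y \<bullet> ?y + (?t + 1)\<^sup>2 < (1/2)\<^sup>2" by linarith
    moreover have "0 \<le> ?y \<bullet> ?y" "0 \<le> (?t + 1)\<^sup>2" by (rule inner_ge_zero, rule zero_le_power2)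
    moreover have "(1/2)\<^sup>2 = (1/4 :: real)" by (simp add: power_divide)
    ultimately have y4: "?y \<bullet> ?y \<le> 1/4" and t4: "(?t + 1)\<^sup>2 < (1/2)\<^sup>2" by linarith+
    have "\<bar>?t + 1\<bar> < 1/2" by (rule power2_less_imp_less) (use t4 in simp_all)
    then have t0: "?t < 0" by linarith
    have "norm x < 1 \<longleftrightarrow> x \<bullet> x < 1" by (metis norm_eq_sqrt_inner real_sqrt_lt_1_iff)
    also have "\<dots> \<longleftrightarrow> (- ?t)\<^sup>2 < 1 - ?y \<bullet> ?y" using yy by auto
    also have "\<dots> \<longleftrightarrow> - ?t < sqrt (1 - ?y \<bullet> ?y)"
    proof
      assume "(- ?t)\<^sup>2 < 1 - ?y \<bullet> ?y" then show "- ?t < sqrt (1 - ?y \<bullet> ?y)" by (rule real_less_rsqrt)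
    next
      assume "- ?t < sqrt (1 - ?y \<bullet> ?y)"
      then have "(- ?t)\<^sup>2 < (sqrt (1 - ?y \<bullet> ?y))\<^sup>2" using t0 by (intro power_strict_mono) auto
      then show "(- ?t)\<^sup>2 < 1 - ?y \<bullet> ?y" using y4 by simp
    qed
    finally show ?thesis using clip_eq[OF y4] by auto
  qed
  then have "ball 0 1 \<inter> ball x0 (1/2) = {x \<in> ball x0 (1/2). x \<bullet> e > ?\<gamma> (x - (x \<bullet> e) *\<^sub>R e)}"
    by (auto simp: dist_norm norm_minus_commute)
  then show "\<exists>r>0. \<exists>e. \<exists>\<gamma> :: 'a \<Rightarrow> real. norm e = 1 \<and> C1 \<gamma> \<and>
      ball 0 1 \<inter> ball x0 r = {x \<in> ball x0 r. x \<bullet> e > \<gamma> (x - (x \<bullet> e) *\<^sub>R e)}"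
    using ne C1_lower_hemisphere by (intro exI[of _ "1/2"] conjI exI[of _ e] exI[of _ ?\<gamma>]) auto
qed auto

lemma outward_unit_normal_unit_ball:
  fixes x :: "real ^ 'd"
  assumes x: "norm x = 1"
  shows "outward_unit_normal (ball 0 1) x = x"
proof (rule outward_unit_normal_eqI[OF C1_domain_unit_ball])
  show "x \<in> frontier (ball 0 1)" using x by simp
  have "x \<bullet> v = 0" if tv: "tangent_vector (frontier (ball 0 1)) x v" for v
  proof -
    from tv[unfolded tangent_vector_def] obtain c
      where c: "c 0 = x" "\<forall>\<^sub>F t in at 0. c t \<in> frontier (ball 0 1)" "(c has_vector_derivative v) (at 0)"
      by (elim exE conjE) (rule that)
    have cd: "(c has_derivative (\<lambda>t. t *\<^sub>R v)) (at 0)" using c(3) by (simp add: has_vector_derivative_def)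
    have "((\<lambda>t. c t \<bullet> c t) has_derivative (\<lambda>t. c 0 \<bullet> (t *\<^sub>R v) + (t *\<^sub>R v) \<bullet> c 0)) (at 0)"
      by (rule has_derivative_inner[OF cd cd])
    moreover have "((\<lambda>t. c t \<bullet> c t) has_derivative (\<lambda>t. 0)) (at 0)"
    proof (rule has_derivative_transform_eventually[OF has_derivative_const])
      show "\<forall>\<^sub>F t in at 0. 1 = c t \<bullet> c t"
        using c(2) by eventually_elim (simp add: dot_square_norm)
      show "1 = c 0 \<bullet> c 0" using c(1) x by (simp add: dot_square_norm)
    qed simp
    ultimately have "(\<lambda>t. c 0 \<bullet> (t *\<^sub>R v) + (t *\<^sub>R v) \<bullet> c 0) = (\<lambda>t::real. 0)"
      by (rule has_derivative_unique)
    from fun_cong[OF this, of 1] show ?thesis using c(1) by (simp add: inner_commute)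
  qed
  moreover have "\<forall>\<^sub>F t::real in at_right 0. x + t *\<^sub>R x \<notin> closure (ball 0 1) \<and> x - t *\<^sub>R x \<in> ball 0 1"
    unfolding eventually_at_right_field
  proof (intro exI[of _ 1] conjI allI impI)
    fix t :: real assume t: "0 < t" "t < 1"
    have "x + t *\<^sub>R x = (1 + t) *\<^sub>R x" "x - t *\<^sub>R x = (1 - t) *\<^sub>R x" by (simp_all add: algebra_simps)
    then show "x + t *\<^sub>R x \<notin> closure (ball 0 1)" "x - t *\<^sub>R x \<in> ball 0 1" using t x by auto
  qed simp
  ultimately show "is_outward_unit_normal (ball 0 1) x x"
    using x by (simp add: is_outward_unit_normal_def)
qed

text \<open>The identity field has c = 1 and gives the area of the sphere; fields that vanish on the
  sphere have c = 0 and give identities between volume integrals.\<close>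

lemma unit_ball_flux:
  fixes F :: "real ^ 'd \<Rightarrow> real ^ 'd"
  assumes "diagonal_partials F d" and "\<And>x. norm x = 1 \<Longrightarrow> F x \<bullet> x = c"
  shows "(LINT x|lborel. indicator (ball 0 1) x * divergence d x)
    = c * measure (hausdorff_measure (CARD('d) - 1)) (sphere (0 :: real ^ 'd) 1)"
proof -
  have "(LINT x|lborel. indicator (ball 0 1) x * divergence d x)
      = (LINT x|surface_measure (ball 0 1). F x \<bullet> outward_unit_normal (ball 0 1) x)"
    using divergence_theorem[OF C1_domain_unit_ball assms(1)] by (simp add: divergence_theorem_for_def)
  also have "\<dots> = (LINT x|surface_measure (ball 0 1 :: (real ^ 'd) set). c)"
    by (intro Bochner_Integration.integral_cong)
       (auto simp: space_surface_measure outward_unit_normal_unit_ball assms(2))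
  also have "\<dots> = c * measure (hausdorff_measure (CARD('d) - 1)) (sphere (0 :: real ^ 'd) 1)"
    unfolding integral_surface_measure(2) by simp
  finally show ?thesis .
qed

lemma measure_unit_ball: "measure lborel (ball (0 :: 'a::euclidean_space) 1) = unit_ball_vol DIM('a)"
  by (simp add: content_ball)

theorem hausdorff_measure_sphere:
  "measure (hausdorff_measure (CARD('d) - 1)) (sphere (0 :: real ^ 'd) 1) = CARD('d) * unit_ball_vol CARD('d)"
proof -
  have "diagonal_partials (\<lambda>x :: real ^ 'd. x) (\<lambda>b x. 1)"
    unfolding diagonal_partials_def
    by (auto simp: inner_add_left intro!: derivative_eq_intros continuous_intros)
  from unit_ball_flux[OF this, of 1]
  have "(LINT x|lborel. indicator (ball 0 1) (x :: real ^ 'd) * divergence (\<lambda>b x. 1) x)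
      = measure (hausdorff_measure (CARD('d) - 1)) (sphere (0 :: real ^ 'd) 1)"
    by (simp add: dot_square_norm)
  then show ?thesis by (simp add: divergence_def measure_unit_ball mult.commute)
qed

text \<open>The field (|x|^2 - 1) b vanishes on the sphere and has divergence 2 x.b.\<close>

lemma unit_ball_moment_1:
  fixes b :: "real ^ 'd"
  assumes b: "b \<in> Basis"
  shows "(LINT x|lborel. indicator (ball 0 1) x * (x \<bullet> b)) = 0"
proof -
  define d :: "real ^ 'd \<Rightarrow> real ^ 'd \<Rightarrow> real" where "d b' x = 2 * (x \<bullet> b') * (b \<bullet> b')" for b' x
  have "diagonal_partials (\<lambda>x. ((norm x)\<^sup>2 - 1) *\<^sub>R b) d"
    unfolding diagonal_partials_def d_def
  proof (intro conjI ballI allI)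
    fix b' x :: "real ^ 'd"
    show "((\<lambda>t. (((norm (x + t *\<^sub>R b'))\<^sup>2 - 1) *\<^sub>R b) \<bullet> b') has_real_derivative 2 * (x \<bullet> b') * (b \<bullet> b')) (at 0)"
      using DERIV_cmult_right[OF DERIV_diff[OF norm_square_line_deriv DERIV_const[of 1]], of x b' "b \<bullet> b'"] by simp
  qed (intro continuous_intros)+
  from unit_ball_flux[OF this, of 0] have "(LINT x|lborel. indicator (ball 0 1) x * divergence d x) = 0" by simp
  moreover have "divergence d x = 2 * (x \<bullet> b)" for x
    unfolding divergence_def d_def using b
    by (subst euclidean_inner[of x b]) (simp add: sum_distrib_left mult.assoc)
  ultimately show ?thesis by (simp add: mult.left_commute)
qed

text \<open>The field (|x|^2 - 1)(x.c) b vanishes on the sphere, so twice the moment equals (b.c) A,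
  where A is the integral of 1 - |x|^2. Summing the diagonal moments gives d A/2 = w - A with w the
  volume of the ball, whence A/2 = w/(d + 2).\<close>

lemma unit_ball_moment_2:
  fixes b c :: "real ^ 'd"
  assumes b: "b \<in> Basis" and c: "c \<in> Basis"
  shows "(LINT x|lborel. indicator (ball 0 1) x * ((x \<bullet> b) * (x \<bullet> c)))
    = (if b = c then unit_ball_vol CARD('d) / (CARD('d) + 2) else 0)"
proof -
  let ?M = "\<lambda>b c :: real ^ 'd. (LINT x|lborel. indicator (ball 0 1) x * ((x \<bullet> b) * (x \<bullet> c)))"
  define A where "A = (LINT x :: real ^ 'd|lborel. indicator (ball 0 1) x * (1 - (norm x)\<^sup>2))"
  have int: "integrable lborel (\<lambda>x. indicator (ball 0 1) x * f x)" if "continuous_on UNIV f" for f :: "real ^ 'd \<Rightarrow> real"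
    using that by (intro integrable_indicator_continuous) auto
  have key: "2 * ?M b c = (b \<bullet> c) * A" if b: "b \<in> Basis" for b c
  proof -
    define d where "d b' x = (2 * (x \<bullet> b') * (x \<bullet> c) + (b' \<bullet> c) * ((norm x)\<^sup>2 - 1)) * (b \<bullet> b')" for b' x :: "real ^ 'd"
    have "diagonal_partials (\<lambda>x. (((norm x)\<^sup>2 - 1) * (x \<bullet> c)) *\<^sub>R b) d"
      unfolding diagonal_partials_def d_def
    proof (intro conjI ballI allI)
      fix b' x :: "real ^ 'd"
      have "((\<lambda>t. (x + t *\<^sub>R b') \<bullet> c) has_real_derivative b' \<bullet> c) (at 0)"
        unfolding inner_add_left inner_scaleR_left by (auto intro!: derivative_eq_intros)
      from DERIV_cmult_right[OF DERIV_mult[OF DERIV_diff[OF norm_square_line_deriv[of x b'] DERIV_const[of 1]] this], of "b \<bullet> b'"]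
      show "((\<lambda>t. ((((norm (x + t *\<^sub>R b'))\<^sup>2 - 1) * ((x + t *\<^sub>R b') \<bullet> c)) *\<^sub>R b) \<bullet> b') has_real_derivative
          (2 * (x \<bullet> b') * (x \<bullet> c) + (b' \<bullet> c) * ((norm x)\<^sup>2 - 1)) * (b \<bullet> b')) (at 0)"
        by simp
    qed (intro continuous_intros)+
    from unit_ball_flux[OF this, of 0] have "(LINT x|lborel. indicator (ball 0 1) x * divergence d x) = 0" by simp
    moreover have "divergence d x = 2 * ((x \<bullet> b) * (x \<bullet> c)) - (b \<bullet> c) * (1 - (norm x)\<^sup>2)" for x
    proof -
      have "divergence d x = (\<Sum>b'\<in>Basis. if b' = b then 2 * ((x \<bullet> b) * (x \<bullet> c)) - (b \<bullet> c) * (1 - (norm x)\<^sup>2) else 0)"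
        unfolding divergence_def d_def using b
        by (intro sum.cong) (auto simp: inner_Basis algebra_simps)
      then show ?thesis using b by simp
    qed
    ultimately have "(LINT x|lborel. 2 * (indicator (ball 0 1) x * ((x \<bullet> b) * (x \<bullet> c)))
        - (b \<bullet> c) * (indicator (ball 0 1) x * (1 - (norm x)\<^sup>2))) = 0"
      by (simp add: algebra_simps)
    moreover have "integrable lborel (\<lambda>x. indicator (ball 0 1) x * ((x \<bullet> b) * (x \<bullet> c)))"
      "integrable lborel (\<lambda>x :: real ^ 'd. indicator (ball 0 1) x * (1 - (norm x)\<^sup>2))"
      by (intro int continuous_intros)+
    ultimately show ?thesis by (simp add: A_def)
  qed
  have diag: "?M b b = A / 2" if "b \<in> Basis" for b
    using key[OF that, of b] that by (simp add: inner_same_Basis)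
  have "(\<Sum>b\<in>Basis. ?M b b) = (LINT x :: real ^ 'd|lborel. (\<Sum>b\<in>Basis. indicator (ball 0 1) x * ((x \<bullet> b) * (x \<bullet> b))))"
    by (subst Bochner_Integration.integral_sum) (rule int, intro continuous_intros, rule refl)
  also have "\<dots> = (LINT x :: real ^ 'd|lborel. indicator (ball 0 1) x - indicator (ball 0 1) x * (1 - (norm x)\<^sup>2))"
  proof (intro Bochner_Integration.integral_cong refl)
    fix x :: "real ^ 'd"
    have "(\<Sum>b\<in>Basis. indicator (ball 0 1) x * ((x \<bullet> b) * (x \<bullet> b))) = indicator (ball 0 1) x * (x \<bullet> x)"
      by (subst euclidean_inner[of x x]) (simp only: sum_distrib_left)
    then show "(\<Sum>b\<in>Basis. indicator (ball 0 1) x * ((x \<bullet> b) * (x \<bullet> b)))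
        = indicator (ball 0 1) x - indicator (ball 0 1) x * (1 - (norm x)\<^sup>2)"
      by (simp add: power2_norm_eq_inner right_diff_distrib)
  qed
  also have "\<dots> = unit_ball_vol CARD('d) - A"
    unfolding A_def
  proof (subst Bochner_Integration.integral_diff)
    show "integrable lborel (indicator (ball (0 :: real ^ 'd) 1) :: _ \<Rightarrow> real)"
      using int[of "\<lambda>_. 1"] by simp
    show "integrable lborel (\<lambda>x :: real ^ 'd. indicator (ball 0 1) x * (1 - (norm x)\<^sup>2))"
      by (intro int continuous_intros)
  qed (simp add: measure_unit_ball)
  finally have "CARD('d) * (A / 2) = unit_ball_vol CARD('d) - A" by (simp add: diag)
  then have half: "A / 2 = unit_ball_vol CARD('d) / (CARD('d) + 2)" by (simp add: field_simps)
  show ?thesis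
  proof (cases "b = c")
    case True
    then show ?thesis using diag[OF b] half by simp
  next
    case False
    then show ?thesis using key[OF b, of c] b c by (simp add: inner_Basis)
  qed
qed

subsection \<open>The nonlocal flux\<close>

lemma C1_diagonal_partials:
  fixes G :: "'a::euclidean_space \<Rightarrow> 'a"
  assumes "continuous_on UNIV G'" "\<And>x. (G has_derivative blinfun_apply (G' x)) (at x)"
  shows "diagonal_partials G (\<lambda>b x. blinfun_apply (G' x) b \<bullet> b)"
  unfolding diagonal_partials_def
proof (intro conjI ballI allI)
  show "continuous_on UNIV G"
    using assms(2) has_derivative_continuous by (blast intro: continuous_at_imp_continuous_on)
  fix b x :: 'a
  show "continuous_on UNIV (\<lambda>x. blinfun_apply (G' x) b \<bullet> b)" by (intro continuous_intros assms(1))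
  have "((\<lambda>t. G (x + t *\<^sub>R b)) has_derivative (\<lambda>t. blinfun_apply (G' x) (t *\<^sub>R b))) (at 0)"
    by (rule has_derivative_compose[where g = G, OF _ has_derivative_eq_rhs[OF assms(2)]])
       (auto intro!: derivative_eq_intros)
  from has_derivative_inner_left[OF this, of b]
  show "((\<lambda>t. G (x + t *\<^sub>R b) \<bullet> b) has_real_derivative blinfun_apply (G' x) b \<bullet> b) (at 0)"
    unfolding has_field_derivative_def by (rule has_derivative_eq_rhs) (simp add: fun_eq_iff blinfun.scaleR_right)
qed

definition line_flux :: "('a::euclidean_space \<Rightarrow> 'a) \<Rightarrow> 'a \<Rightarrow> 'a \<Rightarrow> real" where
  "line_flux G x y = (LINT t|lborel. indicator {0..1} t * (G (x + t *\<^sub>R (y - x)) \<bullet> (y - x)))"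

text \<open>Reversing the segment by t to 1 - t leaves its points in place and flips the direction
  vector.\<close>

lemma line_flux_swap: "line_flux G y x = - line_flux G x y"
proof -
  have "line_flux G y x = \<bar>- 1\<bar> *\<^sub>R (LINT t|lborel. indicator {0..1} (1 + (-1) * t) *
      (G (y + (1 + (-1) * t) *\<^sub>R (x - y)) \<bullet> (x - y)))"
    unfolding line_flux_def by (rule lborel_integral_real_affine) simp
  also have "\<dots> = (LINT t|lborel. - (indicator {0..1} t * (G (x + t *\<^sub>R (y - x)) \<bullet> (y - x))))"
    by (auto intro!: Bochner_Integration.integral_cong simp: indicator_def inner_diff_right algebra_simps)
  finally show ?thesis by (simp add: line_flux_def)
qed

text \<open>The two kernels have the same symmetric support, so one indicator remains and their
  powers of \<epsilon> combine to \<epsilon>^(-(d+2)). On the diagonal both sides are 0.\<close>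

lemma nonlocal_field_mu_kernel:
  fixes G :: "'a::euclidean_space \<Rightarrow> 'a"
  assumes "0 < \<epsilon>"
  shows "nonlocal_field (alpha_kernel \<epsilon>) G x y * mu_kernel \<epsilon> (y - x)
    = real (DIM('a) * (DIM('a) + 2)) / measure (hausdorff_measure (DIM('a) - 1)) (sphere (0::'a) 1)
      / \<epsilon> ^ (DIM('a) + 2) * (indicator (ball 0 \<epsilon>) (y - x) * line_flux G x y)"
proof (cases "x = y")
  case True
  then show ?thesis by (simp add: nonlocal_field_def line_flux_def)
next
  case False
  have "indicator (ball 0 \<epsilon>) (x - y) = (indicator (ball 0 \<epsilon>) (y - x) :: real)"
    by (simp add: indicator_def norm_minus_commute)
  moreover have "(LINT t:{0..1}|lborel. G (x + t *\<^sub>R (y - x)) \<bullet> (y - x)) = line_flux G x y"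
    by (simp add: set_lebesgue_integral_def line_flux_def)
  ultimately show ?thesis
    using False assms by (simp add: nonlocal_field_def alpha_kernel_def mu_kernel_def indicator_def field_simps)
qed

lemma integral_uniform_shift:
  fixes f :: "'a::euclidean_space \<Rightarrow> real"
  assumes [measurable]: "f \<in> borel_measurable borel" and "0 < \<epsilon>"
  shows "(LINT x|lborel. f x) = \<epsilon> ^ DIM('a) * (LINT z|lborel. f (y + \<epsilon> *\<^sub>R z))"
proof -
  have "(LINT x|lborel. f x) = (LINT x|density (distr lborel borel (\<lambda>z. y + \<epsilon> *\<^sub>R z)) (\<lambda>_. ennreal (\<epsilon> ^ DIM('a))). f x)"
    using lborel_affine[of \<epsilon> y] assms(2) by simp
  also have "\<dots> = (LINT x|distr lborel borel (\<lambda>z. y + \<epsilon> *\<^sub>R z). \<epsilon> ^ DIM('a) * f x)"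
    using assms(2) by (subst integral_density) auto
  also have "\<dots> = (LINT z|lborel. \<epsilon> ^ DIM('a) * f (y + \<epsilon> *\<^sub>R z))"
    by (subst integral_distr) auto
  finally show ?thesis by simp
qed

section \<open>Fubini, antisymmetry and Taylor expansion for the nonlocal flux\<close>

locale bounded_flux =
  fixes \<Omega> :: "(real ^ 'd) set" and G :: "real ^ 'd \<Rightarrow> real ^ 'd" and B R :: real
  assumes open_dom: "open \<Omega>" and dom_le: "\<And>x. x \<in> \<Omega> \<Longrightarrow> norm x \<le> R"
    and cont_G: "continuous_on UNIV G" and G_le: "\<And>x. norm (G x) \<le> B"
begin

definition flux_kernel :: "real \<Rightarrow> real ^ 'd \<Rightarrow> real ^ 'd \<Rightarrow> real" where
  "flux_kernel \<epsilon> x y = indicator (ball 0 \<epsilon>) (y - x) * line_flux G x y"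

lemma G_measurable [measurable]: "G \<in> borel_measurable borel"
  by (rule borel_measurable_continuous_onI[OF cont_G])

lemma dom_measurable [measurable]: "\<Omega> \<in> sets borel" using open_dom by simp

lemma B_nonneg: "0 \<le> B" using G_le[of 0] norm_ge_zero order_trans by blast

lemma line_flux_integrand_le: "\<bar>indicator {0..1} t * (G (x + t *\<^sub>R (y - x)) \<bullet> (y - x))\<bar> \<le> B * norm (y - x) * indicator {0..1} t"
proof -
  have "\<bar>G (x + t *\<^sub>R (y - x)) \<bullet> (y - x)\<bar> \<le> norm (G (x + t *\<^sub>R (y - x))) * norm (y - x)"
    by (rule Cauchy_Schwarz_ineq2)
  also have "\<dots> \<le> B * norm (y - x)" by (intro mult_right_mono G_le) simp
  finally show ?thesis by (simp add: indicator_def)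
qed

lemma line_flux_integrable:
  "integrable lborel (\<lambda>t. indicator {0..1} t * (G (x + t *\<^sub>R (y - x)) \<bullet> (y - x)))"
proof (rule Bochner_Integration.integrable_bound)
  show "integrable lborel (\<lambda>t::real. B * norm (y - x) * indicator {0..1} t)"
    by (intro integrable_mult_right integrable_real_indicator) auto
  show "AE t in lborel. norm (indicator {0..1} t * (G (x + t *\<^sub>R (y - x)) \<bullet> (y - x)))
      \<le> norm (B * norm (y - x) * indicator {0..1} t)"
    using line_flux_integrand_le[of _ x y] B_nonneg by (intro AE_I2) (simp add: abs_mult)
qed measurable

lemma line_flux_le: "\<bar>line_flux G x y\<bar> \<le> B * norm (y - x)"
proof -
  have "norm (line_flux G x y) \<le> (LINT t|lborel. norm (indicator {0..1} t * (G (x + t *\<^sub>R (y - x)) \<bullet> (y - x))))"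
    unfolding line_flux_def by (rule integral_norm_bound)
  also have "\<dots> \<le> (LINT t|lborel. B * norm (y - x) * indicator {0..1} (t::real))"
    by (intro integral_mono integrable_norm line_flux_integrable integrable_mult_right integrable_real_indicator)
       (use line_flux_integrand_le[of _ x y] in auto)
  finally show ?thesis by simp
qed

lemma line_flux_measurable [measurable]:
  "(\<lambda>p. line_flux G (fst p) (snd p)) \<in> borel_measurable (borel \<Otimes>\<^sub>M borel)"
  unfolding line_flux_def by measurable

lemma flux_kernel_measurable [measurable]:
  "(\<lambda>p. flux_kernel \<epsilon> (fst p) (snd p)) \<in> borel_measurable (borel \<Otimes>\<^sub>M borel)"
  unfolding flux_kernel_def
  by (intro borel_measurable_times line_flux_measurable measurable_compose[OF _ borel_measurable_indicator])
     measurable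

lemma flux_kernel_swap: "flux_kernel \<epsilon> y x = - flux_kernel \<epsilon> x y"
  unfolding flux_kernel_def line_flux_swap[of G x y] by (simp add: indicator_def norm_minus_commute)

text \<open>The bound on \<epsilon> confines \<open>x\<close> to distance 1 from \<Omega>, so a
  bounded function on a bounded product set dominates. All later exchanges of integrals rest on
  this.\<close>

lemma integrable_flux_kernel:
  assumes \<epsilon>: "0 < \<epsilon>" "\<epsilon> \<le> 1" and [measurable]: "S \<in> sets borel"
  shows "integrable (lborel \<Otimes>\<^sub>M lborel) (\<lambda>(x, y). indicator S x * (indicator \<Omega> y * flux_kernel \<epsilon> x y))"
proof (rule Bochner_Integration.integrable_bound)
  let ?C = "cball 0 (R + 1) \<times> cball (0 :: real ^ 'd) R"
  have "emeasure (lborel \<Otimes>\<^sub>M lborel) ?C < \<infinity>"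
    by (subst lborel.emeasure_pair_measure_Times)
       (auto simp: ennreal_mult_less_top emeasure_compact_finite[unfolded infinity_ennreal_def])
  then show "integrable (lborel \<Otimes>\<^sub>M lborel) (\<lambda>p. B * indicator ?C p)"
    by (intro integrable_mult_right integrable_real_indicator) auto
  show "AE p in lborel \<Otimes>\<^sub>M lborel. norm (case p of (x, y) \<Rightarrow> indicator S x * (indicator \<Omega> y * flux_kernel \<epsilon> x y))
      \<le> norm (B * indicator ?C p)"
  proof (rule AE_I2, clarify)
    fix x y :: "real ^ 'd"
    show "norm (indicator S x * (indicator \<Omega> y * flux_kernel \<epsilon> x y)) \<le> norm (B * indicator ?C (x, y))"
    proof (cases "y \<in> \<Omega> \<and> norm (y - x) < \<epsilon>")
      case True
      then have y: "norm y \<le> R" using dom_le by blast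
      moreover have "norm x \<le> norm y + norm (y - x)" using norm_triangle_ineq4[of y "y - x"] by simp
      ultimately have C: "(x, y) \<in> ?C" using True \<epsilon> by auto
      have "\<bar>flux_kernel \<epsilon> x y\<bar> \<le> \<bar>line_flux G x y\<bar>" by (simp add: flux_kernel_def indicator_def)
      also have "\<dots> \<le> B * norm (y - x)" by (rule line_flux_le)
      also have "\<dots> \<le> B * 1" using True \<epsilon> B_nonneg by (intro mult_left_mono) auto
      finally show ?thesis using C B_nonneg by (auto simp: abs_mult indicator_def)
    next
      case False
      then have *: "indicator \<Omega> y * flux_kernel \<epsilon> x y = 0" by (auto simp: flux_kernel_def)
      show ?thesis unfolding * by simp
    qed
  qed
  show "(\<lambda>(x, y). indicator S x * (indicator \<Omega> y * flux_kernel \<epsilon> x y)) \<in> borel_measurable (lborel \<Otimes>\<^sub>M lborel)"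
    by (simp add: case_prod_beta')
qed

text \<open>By antisymmetry the interactions inside \<open>\<Omega>\<close> cancel, so the outer integral may run over the
  whole space.\<close>

lemma flux_outside:
  assumes \<epsilon>: "0 < \<epsilon>" "\<epsilon> \<le> 1"
  shows "(LINT x|lborel. indicator (- \<Omega>) x * (LINT y|lborel. indicator \<Omega> y * flux_kernel \<epsilon> x y))
    = (LINT y|lborel. indicator \<Omega> y * (LINT x|lborel. flux_kernel \<epsilon> x y))"
    and "integrable lborel (\<lambda>y. indicator \<Omega> y * (LINT x|lborel. flux_kernel \<epsilon> x y))"
proof -
  let ?I = "\<lambda>S. LINT x|lborel. indicator S x * (LINT y|lborel. indicator \<Omega> y * flux_kernel \<epsilon> x y)"
  have fub: "?I S = (LINT y|lborel. indicator \<Omega> y * (LINT x|lborel. indicator S x * flux_kernel \<epsilon> x y))"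
    and int1: "integrable lborel (\<lambda>x. indicator S x * (LINT y|lborel. indicator \<Omega> y * flux_kernel \<epsilon> x y))"
    and int2: "integrable lborel (\<lambda>y. indicator \<Omega> y * (LINT x|lborel. indicator S x * flux_kernel \<epsilon> x y))"
    if S: "S \<in> sets borel" for S
  proof -
    note i = integrable_flux_kernel[OF \<epsilon> S]
    have 1: "(LINT y|lborel. indicator S x * (indicator \<Omega> y * flux_kernel \<epsilon> x y))
        = indicator S x * (LINT y|lborel. indicator \<Omega> y * flux_kernel \<epsilon> x y)" for x
      by simp
    have 2: "(LINT x|lborel. indicator S x * (indicator \<Omega> y * flux_kernel \<epsilon> x y))
        = indicator \<Omega> y * (LINT x|lborel. indicator S x * flux_kernel \<epsilon> x y)" for y
      by (simp add: mult.left_commute[of "indicator S _"])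
    show "?I S = (LINT y|lborel. indicator \<Omega> y * (LINT x|lborel. indicator S x * flux_kernel \<epsilon> x y))"
      using lborel_pair.Fubini_integral[OF i] unfolding 1 2 by simp
    show "integrable lborel (\<lambda>x. indicator S x * (LINT y|lborel. indicator \<Omega> y * flux_kernel \<epsilon> x y))"
      using lborel_pair.integrable_fst[OF i] unfolding 1 .
    show "integrable lborel (\<lambda>y. indicator \<Omega> y * (LINT x|lborel. indicator S x * flux_kernel \<epsilon> x y))"
      using lborel_pair.integrable_snd[OF i] unfolding 2 .
  qed
  \<comment> \<open>Exchanging the order of integration renames \<open>x\<close> and
    \<open>y\<close>; by antisymmetry the result is the negative of the integral itself.\<close>
  have "?I \<Omega> = (LINT y|lborel. indicator \<Omega> y * (LINT x|lborel. - (indicator \<Omega> x * flux_kernel \<epsilon> y x)))"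
    unfolding fub[OF dom_measurable] by (subst flux_kernel_swap) simp
  also have "\<dots> = - ?I \<Omega>" by simp
  finally have zero: "?I \<Omega> = 0" by simp
  have "?I (- \<Omega>) = (LINT x|lborel. indicator UNIV x * (LINT y|lborel. indicator \<Omega> y * flux_kernel \<epsilon> x y)
      - indicator \<Omega> x * (LINT y|lborel. indicator \<Omega> y * flux_kernel \<epsilon> x y))"
    by (intro Bochner_Integration.integral_cong) (auto simp: indicator_def)
  also have "\<dots> = ?I UNIV - ?I \<Omega>"
    by (rule Bochner_Integration.integral_diff) (rule int1, simp, rule int1, rule dom_measurable)
  also have "\<dots> = (LINT y|lborel. indicator \<Omega> y * (LINT x|lborel. flux_kernel \<epsilon> x y))"
    using fub[of UNIV] zero by simp
  finally show "?I (- \<Omega>) = (LINT y|lborel. indicator \<Omega> y * (LINT x|lborel. flux_kernel \<epsilon> x y))" .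
  show "integrable lborel (\<lambda>y. indicator \<Omega> y * (LINT x|lborel. flux_kernel \<epsilon> x y))"
    using int2[of UNIV] by simp
qed

text \<open>The point at parameter t is \<open>y\<close> + (1 - t) \<epsilon> z and the direction is
  -\<epsilon> z. The value of \<open>G\<close> at \<open>y\<close> thus contributes -\<epsilon> (G
  y).z and the derivative -\<epsilon>^2 (1 - t) (D z).z, and 1 - t has integral 1/2.\<close>

lemma line_flux_expansion:
  assumes \<epsilon>: "0 < \<epsilon>" and \<eta>: "0 \<le> \<eta>" and z: "norm z \<le> 1"
    and near: "\<And>v. norm v \<le> \<epsilon> \<Longrightarrow> norm (G (y + v) - G y - blinfun_apply D v) \<le> \<eta> * norm v"
  shows "\<bar>line_flux G (y + \<epsilon> *\<^sub>R z) y + \<epsilon> * (G y \<bullet> z) + \<epsilon>\<^sup>2 / 2 * (blinfun_apply D z \<bullet> z)\<bar> \<le> \<epsilon>\<^sup>2 * \<eta>"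
proof -
  let ?f = "\<lambda>t. indicator {0..1} t * (G (y + \<epsilon> *\<^sub>R z + t *\<^sub>R (y - (y + \<epsilon> *\<^sub>R z))) \<bullet> (y - (y + \<epsilon> *\<^sub>R z)))"
  let ?g = "\<lambda>t::real. indicator {0..1} t *\<^sub>R (- \<epsilon> * (G y \<bullet> z) - \<epsilon>\<^sup>2 * (1 - t) * (blinfun_apply D z \<bullet> z))"
  have fi: "integrable lborel ?f" by (rule line_flux_integrable)
  have gi: "integrable lborel ?g" by (intro borel_integrable_compact continuous_intros) auto
  have gI: "(LINT t|lborel. ?g t) = - \<epsilon> * (G y \<bullet> z) - \<epsilon>\<^sup>2 / 2 * (blinfun_apply D z \<bullet> z)"
  proof -
    let ?P = "\<lambda>t::real. - \<epsilon> * (G y \<bullet> z) * t - \<epsilon>\<^sup>2 * (t - t\<^sup>2 / 2) * (blinfun_apply D z \<bullet> z)"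
    have "(LINT t|lborel. ?g t) = ?P 1 - ?P 0"
    proof (rule integral_FTC_Icc)
      fix t :: real
      have "(?P has_real_derivative (- \<epsilon> * (G y \<bullet> z) - \<epsilon>\<^sup>2 * (1 - t) * (blinfun_apply D z \<bullet> z))) (at t within {0..1})"
        by (auto intro!: derivative_eq_intros simp: algebra_simps)
      then show "(?P has_vector_derivative (- \<epsilon> * (G y \<bullet> z) - \<epsilon>\<^sup>2 * (1 - t) * (blinfun_apply D z \<bullet> z))) (at t within {0..1})"
        by (simp only: has_real_derivative_iff_has_vector_derivative)
    qed (auto intro!: continuous_intros)
    then show ?thesis by (simp add: algebra_simps)
  qed
  have le: "norm (?f t - ?g t) \<le> \<epsilon>\<^sup>2 * \<eta> * indicator {0..1} t" for t
  proof (cases "t \<in> {0..1}")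
    case True
    define v where "v = ((1 - t) * \<epsilon>) *\<^sub>R z"
    have "norm v \<le> \<epsilon>"
    proof -
      have "\<bar>(1 - t) * \<epsilon>\<bar> * norm z \<le> \<epsilon> * 1"
        using True \<epsilon> z by (intro mult_mono) (auto simp: abs_mult mult_left_le_one_le)
      then show ?thesis by (simp add: v_def)
    qed
    then have nv: "norm (G (y + v) - G y - blinfun_apply D v) \<le> \<eta> * \<epsilon>"
      using near[of v] \<eta> mult_left_mono[of "norm v" \<epsilon> \<eta>] by linarith
    have yv: "y + \<epsilon> *\<^sub>R z + t *\<^sub>R (y - (y + \<epsilon> *\<^sub>R z)) = y + v"
      by (simp add: v_def algebra_simps)
    have ft: "?f t = - \<epsilon> * (G (y + v) \<bullet> z)" using True unfolding yv by simp
    have Dv: "blinfun_apply D v = ((1 - t) * \<epsilon>) *\<^sub>R blinfun_apply D z" by (simp add: v_def blinfun.scaleR_right)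
    have "?f t - ?g t = - \<epsilon> * ((G (y + v) - G y - blinfun_apply D v) \<bullet> z)"
      unfolding ft using True by (simp add: Dv inner_diff_left power2_eq_square algebra_simps)
    then have "norm (?f t - ?g t) = \<epsilon> * \<bar>(G (y + v) - G y - blinfun_apply D v) \<bullet> z\<bar>"
      using \<epsilon> by (simp add: abs_mult)
    also have "\<bar>(G (y + v) - G y - blinfun_apply D v) \<bullet> z\<bar> \<le> norm (G (y + v) - G y - blinfun_apply D v) * norm z"
      by (rule Cauchy_Schwarz_ineq2)
    also have "\<dots> \<le> (\<eta> * \<epsilon>) * 1" using nv z \<eta> \<epsilon> by (intro mult_mono) auto
    finally show ?thesis using True \<epsilon> by (simp add: power2_eq_square algebra_simps)
  qed simp
  have "line_flux G (y + \<epsilon> *\<^sub>R z) y + \<epsilon> * (G y \<bullet> z) + \<epsilon>\<^sup>2 / 2 * (blinfun_apply D z \<bullet> z)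
      = (LINT t|lborel. ?f t) - (LINT t|lborel. ?g t)"
    unfolding gI by (simp add: line_flux_def)
  also have "\<dots> = (LINT t|lborel. ?f t - ?g t)"
    using fi gi by (rule Bochner_Integration.integral_diff[symmetric])
  finally have "\<bar>line_flux G (y + \<epsilon> *\<^sub>R z) y + \<epsilon> * (G y \<bullet> z) + \<epsilon>\<^sup>2 / 2 * (blinfun_apply D z \<bullet> z)\<bar>
      = norm (LINT t|lborel. ?f t - ?g t)" by simp
  also have "\<dots> \<le> (LINT t|lborel. norm (?f t - ?g t))" by (rule integral_norm_bound)
  also have "\<dots> \<le> (LINT t|lborel. \<epsilon>\<^sup>2 * \<eta> * indicator {0..1} (t::real))"
    using le fi gi by (intro integral_mono integrable_norm Bochner_Integration.integrable_diff integrable_mult_right integrable_real_indicator) auto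
  finally show ?thesis by simp
qed

text \<open>The first-order term integrates to 0 over the unit ball, although it dominates
  pointwise, and in the second-order term only the diagonal moments survive and leave the trace of
  \<open>D\<close>. The rescaling contributes \<epsilon>^d and the expansion \<epsilon>^2.\<close>

lemma flux_inner_expansion:
  assumes \<epsilon>: "0 < \<epsilon>" and \<eta>: "0 \<le> \<eta>"
    and near: "\<And>v. norm v \<le> \<epsilon> \<Longrightarrow> norm (G (y + v) - G y - blinfun_apply D v) \<le> \<eta> * norm v"
  shows "\<bar>(LINT x|lborel. flux_kernel \<epsilon> x y)
      + \<epsilon> ^ (CARD('d) + 2) / 2 * (unit_ball_vol CARD('d) / (CARD('d) + 2)) * (\<Sum>b\<in>Basis. blinfun_apply D b \<bullet> b)\<bar>
    \<le> \<epsilon> ^ (CARD('d) + 2) * \<eta> * unit_ball_vol CARD('d)"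
proof -
  let ?i = "\<lambda>z :: real ^ 'd. indicator (ball 0 1) z :: real" and ?w = "unit_ball_vol CARD('d)"
  have int: "integrable lborel (\<lambda>x. ?i x * f x)" if "continuous_on UNIV f" for f :: "real ^ 'd \<Rightarrow> real"
    using that by (intro integrable_indicator_continuous) auto
  have "(LINT x|lborel. flux_kernel \<epsilon> x y) = \<epsilon> ^ CARD('d) * (LINT z|lborel. flux_kernel \<epsilon> (y + \<epsilon> *\<^sub>R z) y)"
    using integral_uniform_shift[of "\<lambda>x. flux_kernel \<epsilon> x y" \<epsilon> y] \<epsilon>
      measurable_compose[OF measurable_Pair2' flux_kernel_measurable] by simp
  also have "(\<lambda>z. flux_kernel \<epsilon> (y + \<epsilon> *\<^sub>R z) y) = (\<lambda>z. ?i z * line_flux G (y + \<epsilon> *\<^sub>R z) y)"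
    using \<epsilon> by (auto simp: flux_kernel_def indicator_def fun_eq_iff)
  finally have T: "(LINT x|lborel. flux_kernel \<epsilon> x y) = \<epsilon> ^ CARD('d) * (LINT z|lborel. ?i z * line_flux G (y + \<epsilon> *\<^sub>R z) y)" .
  have m1: "(LINT z|lborel. ?i z * (G y \<bullet> z)) = 0"
  proof -
    have "(LINT z|lborel. ?i z * (G y \<bullet> z)) = (LINT z|lborel. (\<Sum>b\<in>Basis. (G y \<bullet> b) * (?i z * (z \<bullet> b))))"
      by (subst euclidean_inner) (simp add: sum_distrib_left mult.left_commute)
    also have "\<dots> = (\<Sum>b\<in>Basis. LINT z|lborel. (G y \<bullet> b) * (?i z * (z \<bullet> b)))"
      by (rule Bochner_Integration.integral_sum) (intro integrable_mult_right int continuous_intros)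
    also have "\<dots> = 0" by (simp add: unit_ball_moment_1)
    finally show ?thesis .
  qed
  have m2: "(LINT z|lborel. ?i z * (blinfun_apply D z \<bullet> z)) = ?w / (CARD('d) + 2) * (\<Sum>b\<in>Basis. blinfun_apply D b \<bullet> b)"
  proof -
    have "blinfun_apply D z \<bullet> z = (\<Sum>b\<in>Basis. \<Sum>c\<in>Basis. (blinfun_apply D c \<bullet> b) * ((z \<bullet> c) * (z \<bullet> b)))" for z
    proof -
      have "blinfun_apply D z = blinfun_apply D (\<Sum>c\<in>Basis. (z \<bullet> c) *\<^sub>R c)" by (simp only: euclidean_representation)
      also have "\<dots> = (\<Sum>c\<in>Basis. (z \<bullet> c) *\<^sub>R blinfun_apply D c)" by (simp add: blinfun.sum_right blinfun.scaleR_right)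
      finally have "blinfun_apply D z \<bullet> b = (\<Sum>c\<in>Basis. (z \<bullet> c) * (blinfun_apply D c \<bullet> b))" for b
        by (simp add: inner_sum_left)
      then show ?thesis
        by (subst euclidean_inner) (simp add: sum_distrib_left sum_distrib_right mult.commute mult.left_commute)
    qed
    then have "(LINT z|lborel. ?i z * (blinfun_apply D z \<bullet> z))
        = (LINT z|lborel. (\<Sum>b\<in>Basis. \<Sum>c\<in>Basis. (blinfun_apply D c \<bullet> b) * (?i z * ((z \<bullet> c) * (z \<bullet> b)))))"
      by (simp add: sum_distrib_left mult.left_commute)
    also have "\<dots> = (\<Sum>b\<in>Basis. LINT z|lborel. (\<Sum>c\<in>Basis. (blinfun_apply D c \<bullet> b) * (?i z * ((z \<bullet> c) * (z \<bullet> b)))))"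
      by (rule Bochner_Integration.integral_sum)
         (intro Bochner_Integration.integrable_sum integrable_mult_right int continuous_intros)
    also have "\<dots> = (\<Sum>b\<in>Basis. \<Sum>c\<in>Basis. LINT z|lborel. (blinfun_apply D c \<bullet> b) * (?i z * ((z \<bullet> c) * (z \<bullet> b))))"
      by (intro sum.cong refl Bochner_Integration.integral_sum integrable_mult_right int continuous_intros)
    also have "\<dots> = (\<Sum>b\<in>Basis. \<Sum>c\<in>Basis. if c = b then (blinfun_apply D b \<bullet> b) * (?w / (CARD('d) + 2)) else 0)"
      by (intro sum.cong refl) (simp add: unit_ball_moment_2)
    also have "\<dots> = ?w / (CARD('d) + 2) * (\<Sum>b\<in>Basis. blinfun_apply D b \<bullet> b)"
      by (simp add: sum_distrib_left sum_divide_distrib mult.commute)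
    finally show ?thesis .
  qed
  let ?L = "\<lambda>z. ?i z * line_flux G (y + \<epsilon> *\<^sub>R z) y"
  have Lm: "(\<lambda>z. line_flux G (y + \<epsilon> *\<^sub>R z) y) \<in> borel_measurable borel"
    unfolding line_flux_def by measurable
  have Li: "integrable lborel ?L"
  proof (rule Bochner_Integration.integrable_bound[where g = ?L])
    show "integrable lborel (\<lambda>z. B * \<epsilon> * ?i z)"
      by (intro integrable_mult_right integrable_real_indicator) (auto simp: emeasure_bounded_finite[unfolded infinity_ennreal_def])
    show "AE z in lborel. norm (?L z) \<le> norm (B * \<epsilon> * ?i z)"
    proof (rule AE_I2)
      fix z :: "real ^ 'd"
      have "\<bar>line_flux G (y + \<epsilon> *\<^sub>R z) y\<bar> \<le> B * norm (\<epsilon> *\<^sub>R z)"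
        using line_flux_le[of "y + \<epsilon> *\<^sub>R z" y] by simp
      also have "\<dots> \<le> B * \<epsilon>" if "norm z < 1"
        using that \<epsilon> B_nonneg by (intro mult_left_mono) auto
      finally show "norm (?L z) \<le> norm (B * \<epsilon> * ?i z)"
        using B_nonneg \<epsilon> by (auto simp: indicator_def abs_mult)
    qed
    show "?L \<in> borel_measurable lborel"
      using Lm by (intro borel_measurable_times borel_measurable_indicator) simp_all
  qed
  have i1: "integrable lborel (\<lambda>z. ?i z * (G y \<bullet> z))" "integrable lborel (\<lambda>z. ?i z * (blinfun_apply D z \<bullet> z))"
    by (intro int continuous_intros)+
  let ?E = "\<lambda>z. ?L z + \<epsilon> * (?i z * (G y \<bullet> z)) + \<epsilon>\<^sup>2 / 2 * (?i z * (blinfun_apply D z \<bullet> z))"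
  have Ei: "integrable lborel ?E"
    by (intro Bochner_Integration.integrable_add integrable_mult_right Li i1)
  have EI: "(LINT z|lborel. ?E z) = (LINT z|lborel. ?L z) + \<epsilon>\<^sup>2 / 2 * (?w / (CARD('d) + 2) * (\<Sum>b\<in>Basis. blinfun_apply D b \<bullet> b))"
    using Li i1 m1 m2 by simp
  have "\<bar>LINT z|lborel. ?E z\<bar> \<le> (LINT z|lborel. norm (?E z))"
    using integral_norm_bound[of lborel ?E] by simp
  also have "\<dots> \<le> (LINT z|lborel. \<epsilon>\<^sup>2 * \<eta> * ?i z)"
  proof (intro integral_mono integrable_norm Ei)
    show "integrable lborel (\<lambda>z. \<epsilon>\<^sup>2 * \<eta> * ?i z)"
      by (intro integrable_mult_right integrable_real_indicator) (auto simp: emeasure_bounded_finite[unfolded infinity_ennreal_def])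
    show "norm (?E z) \<le> \<epsilon>\<^sup>2 * \<eta> * ?i z" for z
    proof (cases "z \<in> ball 0 1")
      case True
      then have "norm z \<le> 1" by simp
      from line_flux_expansion[OF \<epsilon> \<eta> this near] show ?thesis using True by simp
    qed simp
  qed
  also have "\<dots> = \<epsilon>\<^sup>2 * \<eta> * ?w" by (simp add: measure_unit_ball)
  finally have A: "\<epsilon> ^ CARD('d) * \<bar>LINT z|lborel. ?E z\<bar> \<le> \<epsilon> ^ CARD('d) * (\<epsilon>\<^sup>2 * \<eta> * ?w)"
    using \<epsilon> by (intro mult_left_mono) auto
  have eq: "(LINT x|lborel. flux_kernel \<epsilon> x y)
      + \<epsilon> ^ (CARD('d) + 2) / 2 * (?w / (CARD('d) + 2)) * (\<Sum>b\<in>Basis. blinfun_apply D b \<bullet> b)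
      = \<epsilon> ^ CARD('d) * (LINT z|lborel. ?E z)"
    unfolding T EI power_add by (simp add: distrib_left)
  have "\<bar>\<epsilon> ^ CARD('d)\<bar> = \<epsilon> ^ CARD('d)" using \<epsilon> by simp
  then show ?thesis
    using A unfolding eq abs_mult by (simp only: power_add mult.assoc)
qed

end

text \<open>The mean value inequality for \<open>G\<close> minus its linearisation at
  \<open>y\<close>, with uniform continuity of \<open>G'\<close> on a ball. The radius R + 1 leaves
  room for the whole ball of radius \<open>norm v\<close> around \<open>y\<close>, as
  \<open>norm v\<close> is below 1.\<close>

lemma C1_uniform_expansion:
  fixes G :: "'a::euclidean_space \<Rightarrow> 'b::euclidean_space"
  assumes c: "continuous_on UNIV G'" and d: "\<And>x. (G has_derivative blinfun_apply (G' x)) (at x)" and \<eta>: "0 < \<eta>"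
  obtains \<rho> where "0 < \<rho>"
    "\<And>y v. norm y \<le> R \<Longrightarrow> norm v < \<rho> \<Longrightarrow> norm (G (y + v) - G y - blinfun_apply (G' y) v) \<le> \<eta> * norm v"
proof -
  have "uniformly_continuous_on (cball 0 (R + 1)) G'"
    by (intro compact_uniformly_continuous continuous_on_subset[OF c]) auto
  then obtain \<rho> where \<rho>: "0 < \<rho>"
    "\<And>p q. p \<in> cball 0 (R + 1) \<Longrightarrow> q \<in> cball 0 (R + 1) \<Longrightarrow> dist q p < \<rho> \<Longrightarrow> dist (G' q) (G' p) < \<eta>"
    using \<eta> unfolding uniformly_continuous_on_def by metis
  show thesis
  proof (rule that)
    show "0 < min \<rho> 1" using \<rho>(1) by simp
    fix y v :: 'a assume y: "norm y \<le> R" and v: "norm v < min \<rho> 1"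
    have "norm ((G (y + v) - blinfun_apply (G' y) (y + v)) - (G y - blinfun_apply (G' y) y)) \<le> \<eta> * norm ((y + v) - y)"
    proof (rule differentiable_bound[where f' = "\<lambda>x. blinfun_apply (G' x - G' y)"])
      show "convex (cball y (norm v))" by simp
      show "((\<lambda>x. G x - blinfun_apply (G' y) x) has_derivative blinfun_apply (G' x - G' y)) (at x within cball y (norm v))" for x
        by (rule has_derivative_eq_rhs[OF has_derivative_diff[OF has_derivative_at_withinI[OF d]
              bounded_linear_imp_has_derivative[OF blinfun.bounded_linear_right]]]) (simp add: fun_eq_iff blinfun.diff_left)
      show "onorm (blinfun_apply (G' x - G' y)) \<le> \<eta>" if x: "x \<in> cball y (norm v)" for x
      proof -
        have xy: "norm (x - y) \<le> norm v" using x by (simp add: dist_norm norm_minus_commute)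
        have "norm x \<le> norm y + norm (x - y)" by (rule norm_triangle_sub)
        then have "norm x \<le> R + 1" using y v xy by simp
        then have "dist (G' x) (G' y) < \<eta>" using y xy v by (intro \<rho>(2)) (auto simp: dist_norm)
        then show ?thesis by (simp add: dist_norm norm_blinfun.rep_eq)
      qed
    qed (auto simp: dist_norm)
    then show "norm (G (y + v) - G y - blinfun_apply (G' y) v) \<le> \<eta> * norm v"
      by (simp add: blinfun.add_right algebra_simps)
  qed
qed

theorem theorem3p3:
  fixes \<Omega> :: "(real ^ 'd) set"
    and F Fext :: "real ^ 'd \<Rightarrow> real ^ 'd"
  assumes "C1_domain \<Omega>"
    and "C1_closure \<Omega> F"
    and "C1 Fext" and "compactly_supported Fext" and "\<And>x. x \<in> closure \<Omega> \<Longrightarrow> Fext x = F x"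
  shows "((\<lambda>\<epsilon>. LINT x:(- \<Omega>)|lborel.
             nonlocal_normal \<Omega> (mu_kernel \<epsilon>) (nonlocal_field (alpha_kernel \<epsilon>) Fext) x)
          \<longlongrightarrow> (LINT x|surface_measure \<Omega>. F x \<bullet> outward_unit_normal \<Omega> x)) (at_right 0)"
proof -
  have op: "open \<Omega>" and bd: "bounded \<Omega>" using assms(1) by (auto simp: C1_domain_def domain_def)
  obtain R where R: "\<And>x. x \<in> \<Omega> \<Longrightarrow> norm x \<le> R" using bd by (meson bounded_iff)
  obtain G' where c': "continuous_on UNIV G'" and d': "\<And>x. (Fext has_derivative blinfun_apply (G' x)) (at x)"
    using assms(3) unfolding C1_def by blast
  define d where "d b x = blinfun_apply (G' x) b \<bullet> b" for b x
  have dp: "diagonal_partials Fext d" unfolding d_def[abs_def] by (rule C1_diagonal_partials[OF c' d'])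
  have cG: "continuous_on UNIV Fext" using dp by (rule diagonal_partialsD)
  obtain B where B: "\<And>x. norm (Fext x) \<le> B"
  proof -
    have "compact (closure {x. Fext x \<noteq> 0})" using assms(4) by (simp add: compactly_supported_def)
    moreover have "norm (Fext x) = 0" if "x \<notin> closure {x. Fext x \<noteq> 0}" for x
      using that closure_subset[of "{x. Fext x \<noteq> 0}"] by auto
    ultimately show thesis
      using bounded_compact_support[of "\<lambda>x. norm (Fext x)" "closure {x. Fext x \<noteq> 0}"] that
        continuous_on_norm[OF cG] by (metis abs_norm_cancel)
  qed
  define V where "V = (LINT x|lborel. indicator \<Omega> x * divergence d x)"
  have V: "(LINT x|surface_measure \<Omega>. F x \<bullet> outward_unit_normal \<Omega> x) = V"
  proof -
    have "(LINT x|surface_measure \<Omega>. F x \<bullet> outward_unit_normal \<Omega> x)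
        = (LINT x|surface_measure \<Omega>. Fext x \<bullet> outward_unit_normal \<Omega> x)"
      using assms(5) by (intro Bochner_Integration.integral_cong) (auto simp: space_surface_measure frontier_def)
    then show ?thesis
      using divergence_theorem[OF assms(1) dp] by (simp add: divergence_theorem_for_def V_def)
  qed
  let ?n = "CARD('d)" and ?w = "unit_ball_vol CARD('d)"
  define C where "C = real (?n * (?n + 2)) / measure (hausdorff_measure (?n - 1)) (sphere (0 :: real ^ 'd) 1)"
  have w0: "0 < ?w" by simp
  \<comment> \<open>The sphere has measure d w, so \<open>C\<close> equals (d + 2)/w, the reciprocal
    of the second moment.\<close>
  have Cw: "C * (?w / (?n + 2)) = 1"
  proof -
    have "(n * (n + 2)) / (n * w) * (w / (n + 2)) = 1" if "0 < n" "0 < w" for n w :: real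
    proof -
      have "n + 2 \<noteq> 0" using that by simp
      then show ?thesis using that by (simp add: divide_simps)
    qed
    from this[of "real ?n" ?w] show ?thesis
      using w0 unfolding C_def hausdorff_measure_sphere
      by (simp only: of_nat_mult of_nat_add of_nat_numeral of_nat_0_less_iff zero_less_card_finite)
  qed
  then have C0: "0 \<le> C" using w0 by (simp add: C_def)
  interpret bounded_flux \<Omega> Fext B R by unfold_locales (fact op R cG B)+
  define T where "T \<epsilon> y = (LINT x|lborel. flux_kernel \<epsilon> x y)" for \<epsilon> y
  let ?K = "\<lambda>\<epsilon>. LINT x:(- \<Omega>)|lborel. nonlocal_normal \<Omega> (mu_kernel \<epsilon>) (nonlocal_field (alpha_kernel \<epsilon>) Fext) x"
  have K: "?K \<epsilon> = (LINT y|lborel. indicator \<Omega> y * (- 2 * (C / \<epsilon> ^ (?n + 2)) * T \<epsilon> y))" if \<epsilon>: "0 < \<epsilon>" "\<epsilon> \<le> 1" for \<epsilon>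
  proof -
    have "nonlocal_normal \<Omega> (mu_kernel \<epsilon>) (nonlocal_field (alpha_kernel \<epsilon>) Fext) x
        = - 2 * (C / \<epsilon> ^ (?n + 2)) * (LINT y|lborel. indicator \<Omega> y * flux_kernel \<epsilon> x y)" for x
    proof -
      have "nonlocal_field (alpha_kernel \<epsilon>) Fext x y * mu_kernel \<epsilon> (y - x) = C / \<epsilon> ^ (?n + 2) * flux_kernel \<epsilon> x y" for y
        unfolding nonlocal_field_mu_kernel[OF \<epsilon>(1)] by (simp add: C_def flux_kernel_def)
      then show ?thesis
        unfolding nonlocal_normal_def set_lebesgue_integral_def by (simp add: mult.left_commute[of "indicator \<Omega> _"])
    qed
    then have "?K \<epsilon> = - 2 * (C / \<epsilon> ^ (?n + 2)) *
        (LINT x|lborel. indicator (- \<Omega>) x * (LINT y|lborel. indicator \<Omega> y * flux_kernel \<epsilon> x y))"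
      unfolding set_lebesgue_integral_def by (simp add: mult.left_commute[of "indicator (- \<Omega>) _"])
    also have "\<dots> = - 2 * (C / \<epsilon> ^ (?n + 2)) * (LINT y|lborel. indicator \<Omega> y * T \<epsilon> y)"
      using flux_outside(1)[OF \<epsilon>] by (simp add: T_def)
    finally show ?thesis by (simp add: mult.left_commute[of "indicator \<Omega> _"])
  qed
  \<comment> \<open>Pure algebra, to be read with \<open>p\<close> = \<epsilon>^(d+2),
    \<open>q\<close> the second moment, \<open>D\<close> the divergence and \<open>t\<close> the
    inner integral; then \<open>c * q\<close> is 1 by \<open>Cw\<close>.\<close>
  have rescale: "\<bar>- 2 * (c / p) * t - (c * q) * D\<bar> \<le> 2 * c * k"
    if "0 < p" "0 \<le> c" "\<bar>t + p / 2 * q * D\<bar> \<le> p * k" for c p q t D k :: real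
  proof -
    have "- 2 * (c / p) * t - (c * q) * D = - (2 * (c / p)) * (t + p / 2 * q * D)"
      using that(1) by (simp add: field_simps)
    then have "\<bar>- 2 * (c / p) * t - (c * q) * D\<bar> = 2 * (c / p) * \<bar>t + p / 2 * q * D\<bar>"
      using that by (simp only: abs_mult) simp
    also have "\<dots> \<le> 2 * (c / p) * (p * k)" using that by (intro mult_left_mono) auto
    also have "\<dots> = 2 * c * k" using that(1) by simp
    finally show ?thesis .
  qed
  define M where "M = 2 * C * ?w * measure lborel \<Omega>"
  have M0: "0 \<le> M" using C0 w0 by (simp add: M_def)
  have est: "\<exists>\<rho>>0. \<forall>\<epsilon>>0. \<epsilon> < \<rho> \<longrightarrow> \<bar>?K \<epsilon> - V\<bar> \<le> \<eta> * M" if \<eta>: "0 < \<eta>" for \<eta>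
  proof -
    obtain \<rho> where \<rho>: "0 < \<rho>" "\<And>y v. norm y \<le> R \<Longrightarrow> norm v < \<rho> \<Longrightarrow>
        norm (Fext (y + v) - Fext y - blinfun_apply (G' y) v) \<le> \<eta> * norm v"
      by (rule C1_uniform_expansion[OF c' d' \<eta>]) blast
    \<comment> \<open>Below \<rho> the expansion applies to all displacements of length at most
      \<epsilon>; below 1 the exchange of integrals is available.\<close>
    have "\<bar>?K \<epsilon> - V\<bar> \<le> \<eta> * M" if \<epsilon>: "0 < \<epsilon>" "\<epsilon> < min \<rho> 1" for \<epsilon>
    proof -
      have \<epsilon>1: "\<epsilon> \<le> 1" using \<epsilon> by simp
      let ?p = "\<epsilon> ^ (?n + 2)"
      have p0: "0 < ?p" using \<epsilon> by simp
      let ?a = "\<lambda>y. indicator \<Omega> y * (- 2 * (C / ?p) * T \<epsilon> y)" and ?b = "\<lambda>y. indicator \<Omega> y * divergence d y"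
      have ai: "integrable lborel ?a"
        using integrable_mult_right[OF flux_outside(2)[OF \<epsilon>(1) \<epsilon>1], of "- 2 * (C / ?p)"]
        by (simp add: T_def mult.left_commute[of "indicator \<Omega> _"])
      have bi: "integrable lborel ?b"
        by (rule integrable_indicator_continuous[OF op bd continuous_divergence[OF dp]])
      have le: "norm (?a y - ?b y) \<le> 2 * C * \<eta> * ?w * indicator \<Omega> y" for y
      proof (cases "y \<in> \<Omega>")
        case True
        have "\<bar>T \<epsilon> y + ?p / 2 * (?w / (?n + 2)) * divergence d y\<bar> \<le> ?p * (\<eta> * ?w)"
          unfolding T_def divergence_def d_def mult.assoc[symmetric, of ?p \<eta> ?w]
          using \<eta> \<epsilon> R[OF True] by (intro flux_inner_expansion \<rho>(2)) auto
        from rescale[OF p0 C0 this] show ?thesis using True unfolding Cw by (simp add: mult.assoc)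
      qed simp
      have "?K \<epsilon> - V = (LINT y|lborel. ?a y - ?b y)"
        unfolding K[OF \<epsilon>(1) \<epsilon>1] V_def using ai bi by (rule Bochner_Integration.integral_diff[symmetric])
      then have "\<bar>?K \<epsilon> - V\<bar> \<le> (LINT y|lborel. norm (?a y - ?b y))"
        using integral_norm_bound[of lborel "\<lambda>y. ?a y - ?b y"] by simp
      also have "\<dots> \<le> (LINT y|lborel. 2 * C * \<eta> * ?w * indicator \<Omega> y)"
      proof (intro integral_mono integrable_norm Bochner_Integration.integrable_diff ai bi le)
        show "integrable lborel (\<lambda>y. 2 * C * \<eta> * ?w * indicator \<Omega> y)"
          using op emeasure_bounded_finite[OF bd] by (intro integrable_mult_right integrable_real_indicator) auto
      qed
      also have "\<dots> = \<eta> * M" by (simp add: M_def)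
      finally show ?thesis .
    qed
    then show ?thesis using \<rho>(1) by (intro exI[of _ "min \<rho> 1"]) simp
  qed
  show ?thesis
    unfolding V
  proof (rule tendstoI)
    fix r :: real assume r: "0 < r"
    \<comment> \<open>The summand 1 covers M = 0 and makes the final inequality strict.\<close>
    define \<eta> where "\<eta> = r / (M + 1)"
    have \<eta>: "0 < \<eta>" using r M0 by (simp add: \<eta>_def)
    have lt: "\<eta> * M < r" using r M0 by (simp add: \<eta>_def field_simps)
    obtain \<rho> where "0 < \<rho>" "\<And>\<epsilon>. 0 < \<epsilon> \<Longrightarrow> \<epsilon> < \<rho> \<Longrightarrow> \<bar>?K \<epsilon> - V\<bar> \<le> \<eta> * M" using est[OF \<eta>] by blast
    then show "\<forall>\<^sub>F \<epsilon> in at_right 0. dist (?K \<epsilon>) V < r"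
      unfolding eventually_at_right_field dist_real_def using lt by (intro exI[of _ \<rho>]) force
  qed
qed

end
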